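(* There is a unique biquadratic quartic transformation of $\mathrm{Hl}$, up to pre- and post-composition with Möbius and F-homotopic transformations of $\mathrm{Hl}$. Valid on a neighborhood of $x=0$, it is $$\mathrm{Hl}(a,q;\,2\gamma-1,\gamma;\,\gamma,\gamma;\,x)=(1-x^2/a)^{-\gamma+\frac12}\,\mathrm{Hl}\bigl(a,q/4;\,\tfrac{\gamma}{2}-\tfrac14,\tfrac{\gamma}{2}+\tfrac14;\,\gamma,\tfrac12;\,S(x)\bigr),$$ where the biquadratic quartic map $S$ is defined by $$S(x)=\frac{4a\,x(1-x)(a-x)}{(a-x^2)^2}=1-\frac{(a-2ax+x^2)^2}{(a-x^2)^2}=a-\frac{a(a-2x+x^2)^2}{(a-x^2)^2}.$$
   Context: The Heun equation (HE) with complex parameters $a\ (\neq0,1),q;\alpha,\beta;\gamma,\delta,\epsilon$, where $\epsilon=\alpha+\beta-\gamma-\delta+1$, is $$F''+\Bigl[\frac{\gamma}{x}+\frac{\delta}{x-1}+\frac{\epsilon}{x-a}\Bigr]F'+\frac{\alpha\beta x-q}{x(x-1)(x-a)}F=0 .$$ It is Fuchsian with singular points $0,1,a,\infty$ and respective characteristic exponents $0,1-\gamma$; $0,1-\delta$; $0,1-\epsilon$; $\alpha,\beta$. It is assumed throughout that $\gamma$ is not a nonpositive integer; $\mathrm{Hl}(a,q;\alpha,\beta;\gamma,\delta;x)$ then denotes the solution that is analytic at $x=0$ and equals $1$ there. It is invariant under $\alpha\leftrightarrow\beta$, and this interchange is disregarded when listing transformations. Biquadratic quartic transformations. If $R:\mathbb{P}^1_x\to\mathbb{P}^1_{x'}$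 is a rational map and $\mathcal{L}u=0$ is an HE on $\mathbb{P}^1_{x'}$ with singular points $0,1,a',\infty$, the change of variable $x'=R(x)$ lifts it to a Fuchsian equation $(R^*\mathcal{L})v=0$ on $\mathbb{P}^1_x$. If $R^*\mathcal{L}$ has only four singular points, the lifted equation is an HE in its own right (up to multiplying the dependent variable by powers of linear factors, to make one exponent zero at each finite singular point); such a lifting is called a degree-$(\deg R)$ transformation of the HE. If moreover $R(0)=0$, there results a formula relating a local solution of the form $\mathrm{Hl}(x)$ to one of the form $\mathrm{Hl}(R(x))$, called a transformation of $\mathrm{Hl}$. A quartic ($\deg R=4$) transformation is biquadratic if it is the composition of two quadratic (degree-2) ones. To avoid degenerate cases, it is assumed that each critical value of the underlying rational map, on $\mathbb{P}^1_{x'}$, is one of the HE singular points $0,1,a',\infty$. The Möbius and F-homotopic transformations of $\mathrm{Hl}$ are the elements of the group of transformations of $\mathrm{Hl}(a,q;\alpha,\beta;\gamma,\delta;x)$ (of order 24, disregarding $\alpha\leftrightarrow\beta$) generated under composition by the Möbius transformations $$\mathrm{Hl}(a,q;\alpha,\beta;\gamma,\delta;x)=(1-x)^{-\alpha}\mathrm{Hl}\bigl(\tfrac{a}{a-1},\tfrac{-q+\gamma\alpha a}{a-1};\alpha,\alpha-\delta+1;\gamma,\alpha-\beta+1;\tfrac{x}{x-1}\bigr),$$ $$\mathrm{Hl}(a,q;\alpha,\beta;\gamma,\delta;x)=\mathrm{Hl}\bigl(\tfrac1a,\tfrac qa;\alpha,\beta;\gamma,\alpha+\beta-\gamma-\delta+1;\tfrac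 xa\bigr),$$ and the F-homotopic transformation $$\mathrm{Hl}(a,q;\alpha,\beta;\gamma,\delta;x)=(1-x)^{1-\delta}\mathrm{Hl}\bigl(a,q-(\delta-1)\gamma a;\beta-\delta+1,\alpha-\delta+1;\gamma,2-\delta;x\bigr).$$ Pre- and post-composition means applying such transformations to the left-hand and right-hand $\mathrm{Hl}$ of an identity.
   Formalization: Uniqueness is stated with an added condition: if all exponent differences of the right-hand HE are ±1/2, then 0 is not a critical value of R; otherwise iterated Landen maps are counterexamples. An HE is required to have four singular points not removable by powers. *)

theory Defs
  imports "HOL-Complex_Analysis.Complex_Analysis"
begin

text \<open>Second-order linear equations on the Riemann sphere. The pair \<open>(P, Q)\<close> stands for
  \<open>u'' + P u' + Q u = 0\<close>; only the values of \<open>P\<close> and \<open>Q\<close> off a finite set matter.\<close>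

type_synonym ode2 = "(complex \<Rightarrow> complex) \<times> (complex \<Rightarrow> complex)"

definition ode_solves :: "ode2 \<Rightarrow> (complex \<Rightarrow> complex) \<Rightarrow> complex \<Rightarrow> bool" where
  "ode_solves E f x \<longleftrightarrow> deriv (deriv f) x + fst E x * deriv f x + snd E x * f x = 0"

text \<open>The equation satisfied by \<open>v x = u (R x)\<close> when \<open>u\<close> satisfies \<open>E\<close>.\<close>

definition ode_pullback :: "(complex \<Rightarrow> complex) \<Rightarrow> ode2 \<Rightarrow> ode2" where
  "ode_pullback R E =
     (\<lambda>x. fst E (R x) * deriv R x - deriv (deriv R) x / deriv R x,
      \<lambda>x. snd E (R x) * (deriv R x)\<^sup>2)"

text \<open>The equation satisfied by \<open>w x = h x * v x\<close> when \<open>v\<close> satisfies \<open>E\<close>, where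
  \<open>\<eta> = h'/h\<close>. For a product \<open>h\<close> of powers \<open>(x - c) powr \<kappa> c\<close> of linear factors, \<open>\<eta> x\<close> is the
  sum of the \<open>\<kappa> c / (x - c)\<close>.\<close>

definition ode_rescale :: "(complex \<Rightarrow> complex) \<Rightarrow> ode2 \<Rightarrow> ode2" where
  "ode_rescale \<eta> E =
     (\<lambda>x. fst E x - 2 * \<eta> x,
      \<lambda>x. snd E x - fst E x * \<eta> x + (\<eta> x)\<^sup>2 - deriv \<eta> x)"

datatype point = Pt complex | Infinity

definition ordinary_at :: "ode2 \<Rightarrow> complex \<Rightarrow> bool" where
  "ordinary_at E c \<longleftrightarrow> (\<exists>l. (fst E \<longlongrightarrow> l) (at c)) \<and> (\<exists>l. (snd E \<longlongrightarrow> l) (at c))"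

text \<open>Singular points are counted up to multiplication of the dependent variable by powers: a
  point that becomes ordinary after such a multiplication is not singular. The points over
  \<open>\<infinity>\<close> of a lifted equation, for instance, typically have exponents \<open>\<lambda>\<close>, \<open>\<lambda> + 1\<close> and no
  logarithm, and do not count.\<close>

definition removable_at :: "ode2 \<Rightarrow> complex \<Rightarrow> bool" where
  "removable_at E c \<longleftrightarrow> (\<exists>\<kappa>. ordinary_at (ode_rescale (\<lambda>x. \<kappa> / (x - c)) E) c)"

primrec singular_point :: "ode2 \<Rightarrow> point \<Rightarrow> bool" where
  "singular_point E (Pt c) \<longleftrightarrow> \<not> removable_at E c"
| "singular_point E Infinity \<longleftrightarrow> \<not> removable_at (ode_pullback inverse E) 0"

text \<open>The order of the parameters is that of \<open>Hl(a, q; \<alpha>, \<beta>; \<gamma>, \<delta>; x)\<close>.\<close>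

datatype heun = Heun (par_a: complex) (par_q: complex) (par_alpha: complex)
  (par_beta: complex) (par_gamma: complex) (par_delta: complex)

definition par_epsilon :: "heun \<Rightarrow> complex" where
  "par_epsilon p = par_alpha p + par_beta p - par_gamma p - par_delta p + 1"

definition heun_ode :: "heun \<Rightarrow> ode2" where
  "heun_ode p =
     (\<lambda>x. par_gamma p / x + par_delta p / (x - 1) + par_epsilon p / (x - par_a p),
      \<lambda>x. (par_alpha p * par_beta p * x - par_q p) / (x * (x - 1) * (x - par_a p)))"

definition heun_points :: "heun \<Rightarrow> point set" where
  "heun_points p = {Pt 0, Pt 1, Pt (par_a p), Infinity}"

definition heun_equation :: "heun \<Rightarrow> bool" where
  "heun_equation p \<longleftrightarrow> par_a p \<noteq> 0 \<and> par_a p \<noteq> 1 \<and>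
     {z. singular_point (heun_ode p) z} = heun_points p"

text \<open>The local function \<open>Hl\<close>, as the sum of the Taylor series at \<open>0\<close> of the solution that is
  analytic there and equals \<open>1\<close>. It is uniquely determined when \<open>a \<noteq> 0, 1\<close> and \<open>\<gamma>\<close> is not a
  nonpositive integer.\<close>

definition Hl :: "heun \<Rightarrow> complex \<Rightarrow> complex" where
  "Hl p = eval_fps (THE F. fps_conv_radius F > 0 \<and> eval_fps F 0 = 1 \<and>
     (\<forall>\<^sub>F x in at 0. ode_solves (heun_ode p) (eval_fps F) x))"

text \<open>A rational map \<open>N/D\<close> is given by the pair \<open>(N, D)\<close>, assumed coprime where it is used. The
  multiplicity of \<open>R\<close> at \<open>z\<close> over \<open>w\<close> is positive if and only if \<open>R z = w\<close> on the sphere, and at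
  least \<open>2\<close> if and only if moreover \<open>z\<close> is a critical point.\<close>

type_synonym ratmap = "complex poly \<times> complex poly"

definition rat_fun :: "ratmap \<Rightarrow> complex \<Rightarrow> complex" where
  "rat_fun R x = poly (fst R) x / poly (snd R) x"

definition rat_deg :: "ratmap \<Rightarrow> nat" where
  "rat_deg R = max (degree (fst R)) (degree (snd R))"

primrec fibre_poly :: "ratmap \<Rightarrow> point \<Rightarrow> complex poly" where
  "fibre_poly R (Pt c) = fst R - smult c (snd R)"
| "fibre_poly R Infinity = snd R"

primrec rat_mult :: "ratmap \<Rightarrow> point \<Rightarrow> point \<Rightarrow> nat" where
  "rat_mult R w (Pt x) = order x (fibre_poly R w)"
| "rat_mult R w Infinity = rat_deg R - degree (fibre_poly R w)"

definition critical_values :: "ratmap \<Rightarrow> point set" where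
  "critical_values R = {w. \<exists>z. 2 \<le> rat_mult R w z}"

text \<open>\<open>x' = R x\<close> lifts the Heun equation \<open>p'\<close> to the Heun equation \<open>p\<close>, up to the multiplication
  of the dependent variable by powers of linear factors with logarithmic derivative \<open>\<eta>\<close>. Both
  equations have exactly four singular points, and the nondegeneracy condition on the critical
  values is included.\<close>

definition heun_lift :: "ratmap \<Rightarrow> heun \<Rightarrow> heun \<Rightarrow> (complex \<Rightarrow> complex) \<Rightarrow> bool" where
  "heun_lift R p p' \<eta> \<longleftrightarrow>
     coprime (fst R) (snd R) \<and> heun_equation p \<and> heun_equation p' \<and>
     critical_values R \<subseteq> heun_points p' \<and>
     (\<forall>\<^sub>\<infinity>x. fst (ode_rescale \<eta> (ode_pullback (rat_fun R) (heun_ode p'))) x = fst (heun_ode p) x \<and>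
          snd (ode_rescale \<eta> (ode_pullback (rat_fun R) (heun_ode p'))) x = snd (heun_ode p) x)"

definition heun_transformation :: "nat \<Rightarrow> ratmap \<Rightarrow> heun \<Rightarrow> heun \<Rightarrow> bool" where
  "heun_transformation n R p p' \<longleftrightarrow> rat_deg R = n \<and>
     (\<exists>C \<kappa>. finite C \<and> heun_lift R p p' (\<lambda>x. \<Sum>c\<in>C. \<kappa> c / (x - c)))"

definition biquadratic :: "ratmap \<Rightarrow> heun \<Rightarrow> heun \<Rightarrow> bool" where
  "biquadratic R p p' \<longleftrightarrow> heun_transformation 4 R p p' \<and>
     (\<exists>R1 R2 p1. heun_transformation 2 R1 p p1 \<and> heun_transformation 2 R2 p1 p' \<and>
        (\<forall>\<^sub>\<infinity>x. rat_fun R x = rat_fun R2 (rat_fun R1 x)))"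

text \<open>The transformation \<open>Hl p x = h x * Hl p' (R x)\<close> of \<open>Hl\<close>. Both sides equal \<open>1\<close> at \<open>0\<close>, so
  the prefactor \<open>h\<close> has no factor that is a power of \<open>x\<close>, and its other factors are normalized
  to \<open>1\<close> at \<open>0\<close>. As \<open>R\<close> is in lowest terms, vanishing of its numerator at \<open>0\<close> says \<open>R 0 = 0\<close>.\<close>

definition Hl_transformation ::
  "heun \<Rightarrow> (complex \<Rightarrow> complex) \<Rightarrow> ratmap \<Rightarrow> heun \<Rightarrow> bool" where
  "Hl_transformation p h R p' \<longleftrightarrow>
     par_gamma p \<notin> \<int>\<^sub>\<le>\<^sub>0 \<and> par_gamma p' \<notin> \<int>\<^sub>\<le>\<^sub>0 \<and> poly (fst R) 0 = 0 \<and>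
     (\<exists>C \<kappa>. finite C \<and> 0 \<notin> C \<and> heun_lift R p p' (\<lambda>x. \<Sum>c\<in>C. \<kappa> c / (x - c)) \<and>
        (\<forall>\<^sub>F x in nhds 0. h x = (\<Prod>c\<in>C. (1 - x / c) powr \<kappa> c))) \<and>
     (\<forall>\<^sub>F x in nhds 0. Hl p x = h x * Hl p' (rat_fun R x))"

definition biquadratic_Hl_transformation ::
  "heun \<Rightarrow> (complex \<Rightarrow> complex) \<Rightarrow> ratmap \<Rightarrow> heun \<Rightarrow> bool" where
  "biquadratic_Hl_transformation p h R p' \<longleftrightarrow> Hl_transformation p h R p' \<and> biquadratic R p p'"

text \<open>\<open>moebius_F p h \<phi> p'\<close>: the identity \<open>Hl p x = h x * Hl p' (\<phi> x)\<close> is a Moebius or F-homotopic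
  transformation of \<open>Hl\<close>. The generators are involutions up to the interchange of \<open>\<alpha>\<close> and \<open>\<beta>\<close>,
  so that closure under composition yields a group.\<close>

inductive moebius_F ::
  "heun \<Rightarrow> (complex \<Rightarrow> complex) \<Rightarrow> (complex \<Rightarrow> complex) \<Rightarrow> heun \<Rightarrow> bool" where
  ident: "moebius_F p (\<lambda>x. 1) (\<lambda>x. x) p"
| swap: "moebius_F (Heun a q \<alpha> \<beta> \<gamma> \<delta>) (\<lambda>x. 1) (\<lambda>x. x) (Heun a q \<beta> \<alpha> \<gamma> \<delta>)"
| moebius1: "moebius_F (Heun a q \<alpha> \<beta> \<gamma> \<delta>) (\<lambda>x. (1 - x) powr (- \<alpha>)) (\<lambda>x. x / (x - 1))
    (Heun (a / (a - 1)) ((- q + \<gamma> * \<alpha> * a) / (a - 1)) \<alpha> (\<alpha> - \<delta> + 1) \<gamma> (\<alpha> - \<beta> + 1))"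
| moebius2: "moebius_F (Heun a q \<alpha> \<beta> \<gamma> \<delta>) (\<lambda>x. 1) (\<lambda>x. x / a)
    (Heun (1 / a) (q / a) \<alpha> \<beta> \<gamma> (\<alpha> + \<beta> - \<gamma> - \<delta> + 1))"
| F_homotopic: "moebius_F (Heun a q \<alpha> \<beta> \<gamma> \<delta>) (\<lambda>x. (1 - x) powr (1 - \<delta>)) (\<lambda>x. x)
    (Heun a (q - (\<delta> - 1) * \<gamma> * a) (\<beta> - \<delta> + 1) (\<alpha> - \<delta> + 1) \<gamma> (2 - \<delta>))"
| compose: "moebius_F p h \<phi> p1 \<Longrightarrow> moebius_F p1 k \<psi> p2 \<Longrightarrow>
    moebius_F p (\<lambda>x. h x * k (\<phi> x)) (\<lambda>x. \<psi> (\<phi> x)) p2"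

text \<open>The exponent differences at \<open>0, 1, a, \<infinity>\<close> are \<open>1 - \<gamma>\<close>, \<open>1 - \<delta>\<close>, \<open>1 - \<epsilon>\<close>, \<open>\<alpha> - \<beta>\<close>, up to
  sign. When all of them are \<open>1/2\<close> there are further biquadratic transformations, namely the
  two-fold iterates of Landen's transformation: for \<open>0 < k < 1\<close> and \<open>k' = 2 sqrt k / (1 + k)\<close>,
  the map \<open>(1 + k)\<^sup>2 x / (1 + k x)\<^sup>2\<close> lifts such a Heun equation with \<open>a' = 1/k'\<^sup>2\<close> to one
  with \<open>a = 1/k\<^sup>2\<close>. The value \<open>0\<close> is critical for such an iterate.\<close>

definition all_exponent_differences_half :: "heun \<Rightarrow> bool" where
  "all_exponent_differences_half p \<longleftrightarrow>
     (\<forall>d \<in> {1 - par_gamma p, 1 - par_delta p, 1 - par_epsilon p, par_alpha p - par_beta p}.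
        d = 1/2 \<or> d = - 1/2)"

text \<open>The map \<open>S\<close>; numerator and denominator are coprime for \<open>a \<noteq> 0, 1\<close>.\<close>

definition quartic_map :: "complex \<Rightarrow> ratmap" where
  "quartic_map a = ([:0, 4 * a:] * [:1, -1:] * [:a, -1:], [:a, 0, -1:]\<^sup>2)"

definition quartic_source :: "complex \<Rightarrow> complex \<Rightarrow> complex \<Rightarrow> heun" where
  "quartic_source a q \<gamma> = Heun a q (2 * \<gamma> - 1) \<gamma> \<gamma> \<gamma>"

definition quartic_target :: "complex \<Rightarrow> complex \<Rightarrow> complex \<Rightarrow> heun" where
  "quartic_target a q \<gamma> = Heun a (q / 4) (\<gamma> / 2 - 1/4) (\<gamma> / 2 + 1/4) \<gamma> (1/2)"

definition quartic_prefactor :: "complex \<Rightarrow> complex \<Rightarrow> complex \<Rightarrow> complex" where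
  "quartic_prefactor a \<gamma> x = (1 - x\<^sup>2 / a) powr (- \<gamma> + 1/2)"

end

theory Submission
  imports Defs "HOL-Computational_Algebra.Fundamental_Theorem_Algebra"
begin

text \<open>The transformation is a statement about two equations: an analytic solution at \<open>0\<close> with value \<open>1\<close>
exists and is unique as long as \<open>\<gamma>\<close> is not a nonpositive integer, so \<open>Hl p x = h x * Hl p' (\<phi> x)\<close> holds as soon as
the substitution \<open>x' = \<phi> x\<close> and the multiplication by \<open>h\<close> carry the equation of \<open>p'\<close> to that of \<open>p\<close>.
For the map \<open>S\<close> this is a comparison of coefficients (\<open>ode_at_quartic_lift\<close>). It is manageable because
\<open>S\<close>, \<open>S - 1\<close> and \<open>S - a\<close> have the numerators \<open>4 a x (1 - x) (a - x)\<close>, \<open>- F\<^sup>2\<close> and \<open>- a G\<^sup>2\<close> over the same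
denominator \<open>D\<^sup>2\<close>, with quadratic \<open>D, F, G\<close>. The lifted equation is invariant under \<open>x \<mapsto> a / x\<close>, up to
multiplication of the dependent variable; with \<open>s\<^sup>2 = a\<close>, the quotient map
\<open>(x + s)\<^sup>2 / (4 s x)\<close> by this involution is the first of the two quadratic maps whose composition is \<open>S\<close>.\<close>

text \<open>Uniqueness rests on the invariant \<open>I = Q - P' / 2 - P\<^sup>2 / 4\<close> of \<open>u'' + P u' + Q u = 0\<close>. Multiplication of
the dependent variable leaves \<open>I\<close> unchanged, and a substitution \<open>r\<close> replaces it by \<open>I(r) r'\<^sup>2\<close> plus half
the Schwarzian derivative of \<open>r\<close>. From the behaviour of \<open>I\<close> at a point one reads off whether the point is
singular, and the square of its exponent difference; hence a lift multiplies exponent differences by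
the multiplicity (\<open>exponent_diff_sq_lift\<close>), and unramified points over singular points are singular
(\<open>singular_point_lift\<close>).

For a quadratic map between Heun equations, the four singular points upstairs leave room for two
noncritical singular points downstairs, and a quadratic map has at most two critical values. So exactly two
of the singular points downstairs are critical values, with exponent difference \<open>1/2\<close>
(\<open>quadratic_lift_structure\<close>). For a composition of two such maps with \<open>0 \<mapsto> 0\<close>, either all four singular
points upstairs lie over \<open>0\<close>, or all exponent differences downstairs are \<open>1/2\<close>; in the latter case
\<open>0\<close> is by hypothesis not a critical value, and the four singular points lie over \<open>0\<close> again
(\<open>biquadratic_fibre\<close>, \<open>quartic_fibres\<close>). Every point over \<open>1\<close>, \<open>a'\<close> or \<open>\<infinity>\<close> is therefore
ordinary, hence ramified.

If \<open>R = N / M\<close>, this means that \<open>N\<close> is a multiple of \<open>x (x - 1) (x - a)\<close>, while \<open>M\<close>, \<open>N - M\<close> and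
\<open>N - a' M\<close> are squares. Factoring the differences of squares \<open>M - (M - N)\<close> and \<open>M - (M - N / a')\<close> leaves
six possibilities for \<open>R\<close>, one for each ordering of \<open>{0, 1, a}\<close> (\<open>three_squares\<close>, \<open>quartic_normal_form\<close>).
They are the images of \<open>S\<close> under the six Moebius transformations that fix \<open>0\<close> and permute the other
singular points (\<open>quartic_map_moebius\<close>). The exponent differences of both equations are now known
up to sign, and the F-homotopic transformations change the signs (\<open>moebius_F_exponent_signs\<close>). Finally, the
map and the exponents determine the prefactor and the accessory parameter \<open>q\<close> (\<open>normalized_lift_unique\<close>), so
that the given transformation coincides with the composite one.\<close>

section \<open>Calculus of lifted equations\<close>

lemma eventually_at_imp_eventually_nhds:
  fixes a :: "'a::t1_space"
  assumes "eventually P (at a)"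
  shows "\<forall>\<^sub>F x in at a. eventually P (nhds x)"
proof -
  obtain S where S: "open S" "a \<in> S" "\<And>x. x \<in> S \<Longrightarrow> x \<noteq> a \<Longrightarrow> P x"
    using assms unfolding eventually_at_topological by blast
  have "open (S - {a})" using S(1) by blast
  then have "eventually P (nhds x)" if "x \<in> S" "x \<noteq> a" for x
    using S(3) that by (auto simp: eventually_nhds)
  then show ?thesis
    using S(1,2) unfolding eventually_at_topological by blast
qed

lemma eventually_nhds_analytic_at:
  fixes f :: "complex \<Rightarrow> complex"
  assumes "f analytic_on {a}"
  shows "\<forall>\<^sub>F x in nhds a. f analytic_on {x}"
proof -
  obtain S where "open S" "a \<in> S" "f holomorphic_on S"
    using assms by (auto simp: analytic_at)
  then show ?thesis
    unfolding eventually_nhds by (metis analytic_at)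
qed

lemma eventually_at_analytic_at:
  fixes f :: "complex \<Rightarrow> complex"
  assumes "f analytic_on {a}"
  shows "\<forall>\<^sub>F x in at a. f analytic_on {x}"
  using eventually_nhds_analytic_at[OF assms] by (simp add: eventually_nhds_conv_at)

lemma analytic_at_compose:
  fixes f g :: "complex \<Rightarrow> complex"
  assumes "g analytic_on {x}" "f analytic_on {g x}"
  shows "(\<lambda>x. f (g x)) analytic_on {x}"
  using analytic_on_compose[of g "{x}" f] assms by (simp add: o_def)

lemma analytic_at_imp_has_deriv:
  fixes f :: "complex \<Rightarrow> complex"
  assumes "f analytic_on {x}"
  shows "(f has_field_derivative deriv f x) (at x)"
  using assms analytic_on_imp_differentiable_at field_differentiable_derivI by blast

lemma deriv_compose_at:
  fixes f g :: "complex \<Rightarrow> complex"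
  assumes "g analytic_on {x}" "f analytic_on {g x}"
  shows "deriv (\<lambda>x. f (g x)) x = deriv f (g x) * deriv g x"
  by (rule DERIV_imp_deriv, rule DERIV_chain2)
     (use assms analytic_at_imp_has_deriv in blast)+

lemma eventually_analytic_compose:
  fixes f g :: "complex \<Rightarrow> complex"
  assumes "g analytic_on {x}" "f analytic_on {g x}"
  shows "\<forall>\<^sub>F y in nhds x. f analytic_on {g y}"
proof -
  have "filterlim g (nhds (g x)) (nhds x)"
    using analytic_at_imp_isCont[OF assms(1)] by (simp add: isCont_def tendsto_nhds_iff)
  then show ?thesis
    using eventually_nhds_analytic_at[OF assms(2)] by (rule eventually_compose_filterlim[rotated])
qed

lemma eventually_deriv_compose:
  fixes f g :: "complex \<Rightarrow> complex"
  assumes "g analytic_on {x}" "f analytic_on {g x}"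
  shows "\<forall>\<^sub>F y in nhds x. deriv (\<lambda>x. f (g x)) y = deriv f (g y) * deriv g y"
  using eventually_nhds_analytic_at[OF assms(1)] eventually_analytic_compose[OF assms]
  by eventually_elim (rule deriv_compose_at)

lemma deriv2_compose_at:
  fixes f g :: "complex \<Rightarrow> complex"
  assumes "g analytic_on {x}" "f analytic_on {g x}"
  shows "deriv (deriv (\<lambda>x. f (g x))) x =
    deriv (deriv f) (g x) * (deriv g x)\<^sup>2 + deriv f (g x) * deriv (deriv g) x"
proof -
  have df: "deriv f analytic_on {g x}" and dg: "deriv g analytic_on {x}"
    using assms by (auto intro: analytic_deriv)
  have "deriv (deriv (\<lambda>x. f (g x))) x = deriv (\<lambda>y. deriv f (g y) * deriv g y) x"
    by (rule deriv_cong_ev[OF eventually_deriv_compose[OF assms] refl])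
  also have "\<dots> = deriv f (g x) * deriv (deriv g) x + deriv (\<lambda>y. deriv f (g y)) x * deriv g x"
    by (rule complex_derivative_mult_at) (use dg analytic_at_compose[OF assms(1) df] in auto)
  also have "deriv (\<lambda>y. deriv f (g y)) x = deriv (deriv f) (g x) * deriv g x"
    by (rule deriv_compose_at[OF assms(1) df])
  finally show ?thesis
    by (simp add: power2_eq_square algebra_simps)
qed

text \<open>The values of both coefficients at one point, so that equations can be compared pointwise.\<close>

definition ode_at :: "ode2 \<Rightarrow> complex \<Rightarrow> complex \<times> complex" where
  "ode_at E x = (fst E x, snd E x)"

lemma ode_at_eq_iff: "ode_at E x = ode_at F y \<longleftrightarrow> fst E x = fst F y \<and> snd E x = snd F y"
  by (simp add: ode_at_def)

lemma ode_at_pullback_cong: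
  assumes "ode_at E (r x) = ode_at F (r x)" "\<forall>\<^sub>F y in nhds x. r y = s y"
  shows "ode_at (ode_pullback r E) x = ode_at (ode_pullback s F) x"
proof -
  have "r x = s x" using assms(2) eventually_nhds_x_imp_x by fast
  moreover have "deriv r x = deriv s x" by (rule deriv_cong_ev[OF assms(2) refl])
  moreover have "deriv (deriv r) x = deriv (deriv s) x"
    using higher_deriv_cong_ev[OF assms(2) refl, of 2] by (simp add: numeral_2_eq_2)
  ultimately show ?thesis using assms(1) by (simp add: ode_at_eq_iff ode_pullback_def)
qed

lemma ode_at_rescale_cong:
  assumes "ode_at E x = ode_at F x" "\<forall>\<^sub>F y in nhds x. \<eta> y = \<theta> y"
  shows "ode_at (ode_rescale \<eta> E) x = ode_at (ode_rescale \<theta> F) x"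
proof -
  have "\<eta> x = \<theta> x" using assms(2) eventually_nhds_x_imp_x by fast
  moreover have "deriv \<eta> x = deriv \<theta> x" by (rule deriv_cong_ev[OF assms(2) refl])
  ultimately show ?thesis using assms(1) by (simp add: ode_at_eq_iff ode_rescale_def)
qed

text \<open>The term \<open>r'' / r'\<close> of a pullback is the logarithmic derivative of \<open>r'\<close>; the chain rule turns it into a
sum, which makes pullback functorial. A multiplier \<open>\<eta>\<close>, being a logarithmic derivative itself, is
transported like a differential.\<close>

lemma ode_at_pullback_compose:
  assumes "g analytic_on {x}" "f analytic_on {g x}" "deriv g x \<noteq> 0" "deriv f (g x) \<noteq> 0"
  shows "ode_at (ode_pullback (\<lambda>x. f (g x)) E) x = ode_at (ode_pullback g (ode_pullback f E)) x"
proof -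
  have "(b * c\<^sup>2 + a * d) / (a * c) = b / a * c + d / c" if "a \<noteq> 0" "c \<noteq> 0" for a b c d :: complex
    using that by (simp add: add_divide_distrib power2_eq_square)
  note e = this[OF assms(4,3)]
  show ?thesis
    unfolding ode_at_eq_iff ode_pullback_def fst_conv snd_conv deriv_compose_at[OF assms(1,2)]
      deriv2_compose_at[OF assms(1,2)] e by (simp add: algebra_simps)
qed

lemma ode_at_pullback_rescale:
  assumes "g analytic_on {x}" "\<eta> analytic_on {g x}" "deriv g x \<noteq> 0"
  shows "ode_at (ode_pullback g (ode_rescale \<eta> E)) x =
    ode_at (ode_rescale (\<lambda>x. \<eta> (g x) * deriv g x) (ode_pullback g E)) x"
proof -
  have "deriv (\<lambda>x. \<eta> (g x) * deriv g x) x =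
      \<eta> (g x) * deriv (deriv g) x + deriv (\<lambda>x. \<eta> (g x)) x * deriv g x"
    by (rule complex_derivative_mult_at) (use analytic_deriv[OF assms(1)] analytic_at_compose[OF assms(1,2)] in auto)
  also have "deriv (\<lambda>x. \<eta> (g x)) x = deriv \<eta> (g x) * deriv g x"
    by (rule deriv_compose_at[OF assms(1,2)])
  finally have d: "deriv (\<lambda>x. \<eta> (g x) * deriv g x) x =
      \<eta> (g x) * deriv (deriv g) x + deriv \<eta> (g x) * (deriv g x)\<^sup>2"
    by (simp add: power2_eq_square)
  have "(P * c - d / c) * (e * c) = P * e * c\<^sup>2 - e * d" if "c \<noteq> 0" for P c d e :: complex
    using that by (simp add: left_diff_distrib power2_eq_square)
  note e = this[OF assms(3)]
  show ?thesis
    unfolding ode_at_eq_iff ode_pullback_def ode_rescale_def fst_conv snd_conv d e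
    by (simp add: algebra_simps)
qed

lemma ode_at_rescale_rescale:
  assumes "\<eta> analytic_on {x}" "\<theta> analytic_on {x}"
  shows "ode_at (ode_rescale \<eta> (ode_rescale \<theta> E)) x = ode_at (ode_rescale (\<lambda>x. \<eta> x + \<theta> x) E) x"
proof -
  have "deriv (\<lambda>x. \<eta> x + \<theta> x) x = deriv \<eta> x + deriv \<theta> x"
    by (rule complex_derivative_add_at[OF assms])
  then show ?thesis
    by (simp add: ode_at_eq_iff ode_rescale_def algebra_simps power2_eq_square)
qed

text \<open>Near \<open>0\<close>, the equation \<open>E\<close> is the lift of \<open>E'\<close> along \<open>r\<close>, up to the multiplication of the
  dependent variable by a function with logarithmic derivative \<open>\<eta>\<close>. Since every map between
  charts of the sphere can be brought to the form \<open>0 \<mapsto> 0\<close>, only the point \<open>0\<close> is needed.\<close>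

definition germ_lift :: "ode2 \<Rightarrow> (complex \<Rightarrow> complex) \<Rightarrow> (complex \<Rightarrow> complex) \<Rightarrow> ode2 \<Rightarrow> bool" where
  "germ_lift E \<eta> r E' \<longleftrightarrow>
     (\<forall>\<^sub>F t in at 0. ode_at (ode_rescale \<eta> (ode_pullback r E')) t = ode_at E t)"

definition germ_map :: "(complex \<Rightarrow> complex) \<Rightarrow> bool" where
  "germ_map r \<longleftrightarrow> r analytic_on {0} \<and> filterlim r (at 0) (at 0) \<and>
     (\<forall>\<^sub>F t in at 0. deriv r t \<noteq> 0)"

lemma germ_lift_compose:
  assumes E: "germ_lift E1 \<eta> r E2" "germ_lift E2 \<theta> s E3" and r: "germ_map r" and s: "germ_map s"
    and \<eta>: "\<forall>\<^sub>F t in at 0. \<eta> analytic_on {t}" and \<theta>: "\<forall>\<^sub>F t in at 0. \<theta> analytic_on {t}"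
  shows "germ_lift E1 (\<lambda>t. \<eta> t + \<theta> (r t) * deriv r t) (\<lambda>t. s (r t)) E3"
proof -
  have lim: "filterlim r (at 0) (at 0)" using r by (simp add: germ_map_def)
  have "\<forall>\<^sub>F t in at 0. ode_at (ode_rescale \<eta> (ode_pullback r E2)) t = ode_at E1 t"
    using E(1) by (simp add: germ_lift_def)
  moreover have "\<forall>\<^sub>F t in at 0. ode_at (ode_rescale \<theta> (ode_pullback s E3)) (r t) = ode_at E2 (r t)"
    by (rule eventually_compose_filterlim[OF _ lim]) (use E(2) in \<open>simp add: germ_lift_def\<close>)
  moreover have "\<forall>\<^sub>F t in at 0. \<theta> analytic_on {r t}"
    by (rule eventually_compose_filterlim[OF \<theta> lim])
  moreover have "\<forall>\<^sub>F t in at 0. s analytic_on {r t}"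
    by (rule eventually_compose_filterlim[OF eventually_at_analytic_at lim]) (use s in \<open>simp add: germ_map_def\<close>)
  moreover have "\<forall>\<^sub>F t in at 0. deriv s (r t) \<noteq> 0"
    by (rule eventually_compose_filterlim[OF _ lim]) (use s in \<open>simp add: germ_map_def\<close>)
  moreover have "\<forall>\<^sub>F t in at 0. r analytic_on {t}"
    using r by (simp add: germ_map_def eventually_at_analytic_at)
  moreover have "\<forall>\<^sub>F t in at 0. deriv r t \<noteq> 0" using r by (simp add: germ_map_def)
  ultimately show ?thesis
    unfolding germ_lift_def using \<eta>
  proof eventually_elim
    case (elim t)
    let ?\<theta> = "\<lambda>t. \<theta> (r t) * deriv r t"
    have an: "?\<theta> analytic_on {t}"
      by (rule analytic_on_mult[OF analytic_at_compose[OF elim(6,3)] analytic_deriv[OF elim(6)]])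
    have "ode_at (ode_rescale (\<lambda>t. \<eta> t + ?\<theta> t) (ode_pullback (\<lambda>t. s (r t)) E3)) t =
        ode_at (ode_rescale \<eta> (ode_rescale ?\<theta> (ode_pullback r (ode_pullback s E3)))) t"
      using ode_at_rescale_cong[OF ode_at_pullback_compose[OF elim(6,4,7,5)]]
        ode_at_rescale_rescale[OF elim(8) an] by simp
    also have "\<dots> = ode_at (ode_rescale \<eta> (ode_pullback r (ode_rescale \<theta> (ode_pullback s E3)))) t"
      by (rule ode_at_rescale_cong) (use ode_at_pullback_rescale[OF elim(6,3,7)] in auto)
    also have "\<dots> = ode_at (ode_rescale \<eta> (ode_pullback r E2)) t"
      by (intro ode_at_rescale_cong ode_at_pullback_cong elim(2)) auto
    finally show ?case using elim(1) by simp
  qed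
qed

section \<open>The projective invariant of an equation\<close>

text \<open>The coefficient of the normal form \<open>y'' + I y = 0\<close>, which is what remains of an equation when
  multiplication of the dependent variable is disregarded. All questions about singular points and
  exponent differences depend on it only.\<close>

definition normal_invariant :: "ode2 \<Rightarrow> complex \<Rightarrow> complex" where
  "normal_invariant E x = snd E x - deriv (fst E) x / 2 - (fst E x)\<^sup>2 / 4"

text \<open>Written in terms of \<open>r'' / r'\<close>, which has a simple pole at a ramification point.\<close>

definition half_schwarzian :: "(complex \<Rightarrow> complex) \<Rightarrow> complex \<Rightarrow> complex" where
  "half_schwarzian r x = deriv (\<lambda>x. deriv (deriv r) x / deriv r x) x / 2 - (deriv (deriv r) x / deriv r x)\<^sup>2 / 4"

lemma normal_invariant_cong:
  assumes "\<forall>\<^sub>F y in nhds x. ode_at E y = ode_at F y"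
  shows "normal_invariant E x = normal_invariant F x"
proof -
  have "ode_at E x = ode_at F x" using assms eventually_nhds_x_imp_x by fast
  moreover have "deriv (fst E) x = deriv (fst F) x"
    by (rule deriv_cong_ev) (use assms in \<open>auto simp: ode_at_eq_iff elim: eventually_mono\<close>)
  ultimately show ?thesis by (simp add: normal_invariant_def ode_at_eq_iff)
qed

text \<open>Rescaling shifts \<open>P\<close> by \<open>- 2 \<eta>\<close>, and the shift of \<open>Q\<close> is exactly what \<open>P' / 2 + P\<^sup>2 / 4\<close> gains.\<close>

lemma normal_invariant_rescale:
  assumes "fst E analytic_on {x}" "\<eta> analytic_on {x}"
  shows "normal_invariant (ode_rescale \<eta> E) x = normal_invariant E x"
proof -
  have "deriv (\<lambda>x. fst E x - 2 * \<eta> x) x = deriv (fst E) x - deriv (\<lambda>x. 2 * \<eta> x) x"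
    by (rule complex_derivative_diff_at) (use assms in \<open>auto intro: analytic_intros\<close>)
  also have "\<dots> = deriv (fst E) x - 2 * deriv \<eta> x"
    using deriv_cmult_at[OF assms(2)] by simp
  finally have d: "deriv (\<lambda>x. fst E x - 2 * \<eta> x) x = deriv (fst E) x - 2 * deriv \<eta> x" .
  have "Q - P * e + e\<^sup>2 - e' - (P' - 2 * e') / 2 - (P - 2 * e)\<^sup>2 / 4 = Q - P' / 2 - P\<^sup>2 / 4"
    for P P' Q e e' :: complex
    by (simp add: diff_divide_distrib add_divide_distrib power2_diff power_mult_distrib)
  then show ?thesis
    by (simp add: normal_invariant_def ode_rescale_def d)
qed

lemma analytic_pullback_fst:
  assumes "r analytic_on {x}" "fst E analytic_on {r x}" "deriv r x \<noteq> 0"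
  shows "fst (ode_pullback r E) analytic_on {x}"
  using assms analytic_at_compose[OF assms(1,2)]
  by (auto simp: ode_pullback_def intro!: analytic_intros)

lemma normal_invariant_pullback:
  assumes "r analytic_on {x}" "fst E analytic_on {r x}" "deriv r x \<noteq> 0"
  shows "normal_invariant (ode_pullback r E) x =
    normal_invariant E (r x) * (deriv r x)\<^sup>2 + half_schwarzian r x"
proof -
  let ?\<rho> = "\<lambda>x. deriv (deriv r) x / deriv r x"
  have an: "(\<lambda>x. fst E (r x)) analytic_on {x}" "deriv r analytic_on {x}" "?\<rho> analytic_on {x}"
    using assms analytic_at_compose[OF assms(1,2)] by (auto intro!: analytic_intros)
  have "deriv (\<lambda>x. fst E (r x) * deriv r x - ?\<rho> x) x
      = deriv (\<lambda>x. fst E (r x) * deriv r x) x - deriv ?\<rho> x"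
    by (rule complex_derivative_diff_at) (use an in \<open>auto intro: analytic_intros\<close>)
  also have "deriv (\<lambda>x. fst E (r x) * deriv r x) x
      = fst E (r x) * deriv (deriv r) x + deriv (\<lambda>x. fst E (r x)) x * deriv r x"
    by (rule complex_derivative_mult_at[OF an(1,2)])
  also have "deriv (\<lambda>x. fst E (r x)) x = deriv (fst E) (r x) * deriv r x"
    by (rule deriv_compose_at[OF assms(1,2)])
  finally have d: "deriv (\<lambda>x. fst E (r x) * deriv r x - ?\<rho> x) x =
    fst E (r x) * deriv (deriv r) x + deriv (fst E) (r x) * deriv r x * deriv r x - deriv ?\<rho> x" .
  have "Q * c\<^sup>2 - (P * d + P' * c * c - e) / 2 - (P * c - d / c)\<^sup>2 / 4 =
      (Q - P' / 2 - P\<^sup>2 / 4) * c\<^sup>2 + (e / 2 - (d / c)\<^sup>2 / 4)"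
    if "c \<noteq> 0" for P P' Q c d e :: complex
  proof -
    have "(P * c - d / c)\<^sup>2 = P\<^sup>2 * c\<^sup>2 - 2 * P * d + (d / c)\<^sup>2"
      using that by (simp add: power2_diff power_mult_distrib)
    then show ?thesis by (simp add: add_divide_distrib diff_divide_distrib algebra_simps power2_eq_square)
  qed
  from this[OF assms(3)] show ?thesis
    by (simp add: normal_invariant_def ode_pullback_def half_schwarzian_def d)
qed

lemma germ_lift_normal_invariant:
  assumes E: "germ_lift E \<eta> r E'" and r: "germ_map r"
    and \<eta>: "\<forall>\<^sub>F t in at 0. \<eta> analytic_on {t}" and P: "\<forall>\<^sub>F t in at 0. fst E' analytic_on {t}"
  shows "\<forall>\<^sub>F t in at 0. normal_invariant E t =
    normal_invariant E' (r t) * (deriv r t)\<^sup>2 + half_schwarzian r t"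
proof -
  have lim: "filterlim r (at 0) (at 0)" using r by (simp add: germ_map_def)
  have "\<forall>\<^sub>F t in at 0. \<forall>\<^sub>F t in nhds t. ode_at (ode_rescale \<eta> (ode_pullback r E')) t = ode_at E t"
    using E by (intro eventually_at_imp_eventually_nhds) (simp add: germ_lift_def)
  moreover have "\<forall>\<^sub>F t in at 0. fst E' analytic_on {r t}"
    by (rule eventually_compose_filterlim[OF P lim])
  moreover have "\<forall>\<^sub>F t in at 0. r analytic_on {t}"
    using r by (simp add: germ_map_def eventually_at_analytic_at)
  moreover have "\<forall>\<^sub>F t in at 0. deriv r t \<noteq> 0" using r by (simp add: germ_map_def)
  ultimately show ?thesis using \<eta>
  proof eventually_elim
    case (elim t)
    have "normal_invariant E t = normal_invariant (ode_rescale \<eta> (ode_pullback r E')) t"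
      by (rule normal_invariant_cong) (use elim(1) in \<open>auto elim: eventually_mono\<close>)
    also have "\<dots> = normal_invariant (ode_pullback r E') t"
      by (rule normal_invariant_rescale[OF analytic_pullback_fst elim(5)]) (use elim in auto)
    finally show ?case using normal_invariant_pullback[of r t E'] elim by simp
  qed
qed

section \<open>Germs of maps of order m\<close>

text \<open>A local homeomorphism maps punctured neighbourhoods of \<open>0\<close> onto punctured neighbourhoods of \<open>0\<close>.\<close>

lemma tendsto_compose_local_iso:
  fixes f r :: "complex \<Rightarrow> complex"
  assumes r: "r analytic_on {0}" "r 0 = 0" "deriv r 0 \<noteq> 0" and lim: "((\<lambda>t. f (r t)) \<longlongrightarrow> l) (at 0)"
  shows "(f \<longlongrightarrow> l) (at 0)"
proof -
  have "at 0 \<le> filtermap r (at 0)"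
  proof (rule filter_leI)
    fix P assume "eventually P (filtermap r (at 0))"
    then obtain d where d: "d > 0" "\<And>t. t \<noteq> 0 \<Longrightarrow> dist t 0 < d \<Longrightarrow> P (r t)"
      by (auto simp: eventually_filtermap eventually_at)
    obtain S where S: "open S" "0 \<in> S" "r holomorphic_on S"
      using r(1) by (auto simp: analytic_at)
    have hol: "r holomorphic_on (S \<inter> ball 0 d)" using S(3) holomorphic_on_subset by blast
    obtain e where e: "e > 0" "ball 0 e \<subseteq> S \<inter> ball 0 d" "open (r ` ball 0 e)"
      using has_complex_derivative_locally_invertible[OF hol _ _ r(3)] S d(1)
      by (metis IntI centre_in_ball open_Int open_ball)
    have "0 \<in> r ` ball 0 e" using e(1) r(2) by (metis centre_in_ball image_eqI)
    moreover have "P y" if y: "y \<in> r ` ball 0 e" "y \<noteq> 0" for y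
    proof -
      obtain t where t: "t \<in> ball 0 e" "y = r t" using y(1) by blast
      moreover have "t \<noteq> 0" using t(2) y(2) r(2) by blast
      ultimately show ?thesis using d(2)[of t] e(2) by (auto simp: dist_commute)
    qed
    ultimately show "eventually P (at 0)" using e(3) by (auto simp: eventually_at_topological)
  qed
  moreover have "(f \<longlongrightarrow> l) (filtermap r (at 0))"
    using lim by (simp add: filterlim_filtermap)
  ultimately show ?thesis using filterlim_mono by blast
qed

text \<open>The germ \<open>r t = t\<^sup>m u t\<close> with \<open>u 0 \<noteq> 0\<close>. Its derivative is \<open>t\<^bsup>m - 1\<^esup> v t\<close>, and \<open>w = v' / v\<close> is the regular
part of \<open>r'' / r'\<close>, whose residue is \<open>m - 1\<close>.\<close>

locale power_germ =
  fixes m :: nat and u :: "complex \<Rightarrow> complex"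
  assumes m: "0 < m" and u: "u analytic_on {0}" "u 0 \<noteq> 0"
begin

definition r :: "complex \<Rightarrow> complex" where "r t = t ^ m * u t"

definition v :: "complex \<Rightarrow> complex" where "v t = of_nat m * u t + t * deriv u t"

lemma v: "v analytic_on {0}" "v 0 \<noteq> 0"
  using u m by (auto simp: v_def [abs_def] intro!: analytic_intros)

lemma r_analytic: "r analytic_on {0}"
  using u by (auto simp: r_def [abs_def] intro!: analytic_intros)

lemma deriv_r: "\<forall>\<^sub>F t in nhds 0. deriv r t = t ^ (m - 1) * v t"
  using eventually_nhds_analytic_at[OF u(1)]
proof eventually_elim
  case (elim t)
  have "(r has_field_derivative (of_nat m * t ^ (m - Suc 0) * u t + deriv u t * t ^ m)) (at t)"
    unfolding r_def [abs_def]
    by (auto intro!: derivative_eq_intros analytic_at_imp_has_deriv[OF elim])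
  moreover have "t ^ m = t ^ (m - 1) * t" using m by (metis power_minus_mult)
  ultimately show ?case by (auto simp: v_def algebra_simps dest!: DERIV_imp_deriv)
qed

definition w :: "complex \<Rightarrow> complex" where "w t = deriv v t / v t"

lemma w: "w analytic_on {0}"
  using v by (auto simp: w_def [abs_def] intro!: analytic_intros)

lemma v_nz: "\<forall>\<^sub>F t in at 0. v t \<noteq> 0"
  using v analytic_at_neq_imp_eventually_neq by blast

lemma deriv_r_nz: "\<forall>\<^sub>F t in at 0. deriv r t \<noteq> 0"
  using v_nz deriv_r[unfolded eventually_nhds_conv_at, THEN conjunct1] eventually_neq_at_within[of 0 0]
  by eventually_elim simp

lemma germ_map_r: "germ_map r"
proof -
  have "\<forall>\<^sub>F t in at 0. u t \<noteq> 0"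
    using u analytic_at_neq_imp_eventually_neq by blast
  then have "\<forall>\<^sub>F t in at 0. r t \<noteq> 0"
    using eventually_neq_at_within[of 0 0] by eventually_elim (simp add: r_def)
  moreover have "(r \<longlongrightarrow> r 0) (at 0)"
    using analytic_at_imp_isCont[OF r_analytic] isContD by blast
  ultimately have "filterlim r (at 0) (at 0)"
    using m by (simp add: filterlim_at r_def zero_power)
  then show ?thesis using deriv_r_nz r_analytic by (simp add: germ_map_def)
qed

lemma log_deriv2_r:
  "\<forall>\<^sub>F t in at 0. deriv (deriv r) t / deriv r t = of_nat (m - 1) / t + w t"
proof -
  have "\<forall>\<^sub>F t in at 0. \<forall>\<^sub>F t in nhds t. deriv r t = t ^ (m - 1) * v t"
    by (rule eventually_at_imp_eventually_nhds[OF deriv_r[unfolded eventually_nhds_conv_at, THEN conjunct1]])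
  then show ?thesis
    using eventually_at_analytic_at[OF v(1)] v_nz eventually_neq_at_within[of 0 0]
  proof eventually_elim
    case (elim t)
    have "((\<lambda>t. t ^ (m - 1) * v t) has_field_derivative
        (of_nat (m - 1) * t ^ (m - 1 - Suc 0) * v t + deriv v t * t ^ (m - 1))) (at t)"
      by (auto intro!: derivative_eq_intros analytic_at_imp_has_deriv[OF elim(2)])
    then have "deriv (deriv r) t = of_nat (m - 1) * t ^ (m - 1 - Suc 0) * v t + deriv v t * t ^ (m - 1)"
      using deriv_cong_ev[OF elim(1) refl] DERIV_imp_deriv by simp
    also have "of_nat (m - 1) * t ^ (m - 1 - Suc 0) = of_nat (m - 1) * (t ^ (m - 1) / t)"
      using elim(4) by (cases "m - 1") auto
    moreover have "deriv r t = t ^ (m - 1) * v t" using elim(1) eventually_nhds_x_imp_x by fast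
    ultimately show ?case using elim(3,4) by (simp add: w_def field_simps)
  qed
qed

lemma half_schwarzian_r:
  "\<forall>\<^sub>F t in at 0. half_schwarzian r t =
     (deriv w t - of_nat (m - 1) / t\<^sup>2) / 2 - (of_nat (m - 1) / t + w t)\<^sup>2 / 4"
  using eventually_at_imp_eventually_nhds[OF log_deriv2_r]
    eventually_at_analytic_at[OF w] eventually_neq_at_within[of 0 0]
proof eventually_elim
  case (elim t)
  have "((\<lambda>t. of_nat (m - 1) / t + w t) has_field_derivative
      (deriv w t - of_nat (m - 1) / t\<^sup>2)) (at t)"
    using elim(3) by (auto intro!: derivative_eq_intros analytic_at_imp_has_deriv[OF elim(2)]
        simp: power2_eq_square)
  then show ?case
    using deriv_cong_ev[OF elim(1) refl] eventually_nhds_x_imp_x[OF elim(1)]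
    by (simp add: half_schwarzian_def DERIV_imp_deriv)
qed

text \<open>The leading term is that of \<open>t\<^sup>m\<close>, for which half the Schwarzian derivative is \<open>(1 - m\<^sup>2) / (4 t\<^sup>2)\<close>.\<close>

lemma tendsto_half_schwarzian_r:
  "((\<lambda>t. t\<^sup>2 * half_schwarzian r t) \<longlongrightarrow> (1 - (of_nat m)\<^sup>2) / 4) (at 0)"
proof -
  let ?k = "of_nat (m - 1) :: complex"
  have lim: "(w \<longlongrightarrow> w 0) (at 0)" "(deriv w \<longlongrightarrow> deriv w 0) (at 0)"
    using analytic_at_imp_isCont[OF w] analytic_at_imp_isCont[OF analytic_deriv[OF w]] isContD by blast+
  have "((\<lambda>t. (t\<^sup>2 * deriv w t - ?k) / 2 - (?k + t * w t)\<^sup>2 / 4)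
      \<longlongrightarrow> (0\<^sup>2 * deriv w 0 - ?k) / 2 - (?k + 0 * w 0)\<^sup>2 / 4) (at 0)"
    by (intro tendsto_intros lim) auto
  also have "(0\<^sup>2 * deriv w 0 - ?k) / 2 - (?k + 0 * w 0)\<^sup>2 / 4 = (1 - (of_nat m)\<^sup>2) / 4"
  proof -
    have "of_nat m = ?k + 1" using m by (simp add: of_nat_diff)
    then show ?thesis by (simp add: power2_eq_square field_simps)
  qed
  finally show ?thesis
  proof (rule Lim_transform_eventually)
    show "\<forall>\<^sub>F t in at 0. (t\<^sup>2 * deriv w t - ?k) / 2 - (?k + t * w t)\<^sup>2 / 4 = t\<^sup>2 * half_schwarzian r t"
      using half_schwarzian_r eventually_neq_at_within[of 0 0]
    proof eventually_elim
      case (elim t)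
      have "t * (?k / t + w t) = ?k + t * w t" using elim(2) by (simp add: field_simps)
      then have "(?k + t * w t)\<^sup>2 = t\<^sup>2 * (?k / t + w t)\<^sup>2" by (metis power_mult_distrib)
      moreover have "t\<^sup>2 * deriv w t - ?k = t\<^sup>2 * (deriv w t - ?k / t\<^sup>2)"
        using elim(2) by (simp add: field_simps)
      ultimately show ?case using elim(1) by (simp add: right_diff_distrib)
    qed
  qed
qed

lemma tendsto_half_schwarzian_r_unramified:
  assumes "m = 1"
  shows "(half_schwarzian r \<longlongrightarrow> deriv w 0 / 2 - (w 0)\<^sup>2 / 4) (at 0)"
proof -
  have lim: "(w \<longlongrightarrow> w 0) (at 0)" "(deriv w \<longlongrightarrow> deriv w 0) (at 0)"
    using analytic_at_imp_isCont[OF w] analytic_at_imp_isCont[OF analytic_deriv[OF w]] isContD by blast+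
  have "((\<lambda>t. deriv w t / 2 - (w t)\<^sup>2 / 4) \<longlongrightarrow> deriv w 0 / 2 - (w 0)\<^sup>2 / 4) (at 0)"
    by (intro tendsto_intros lim) auto
  then show ?thesis
    by (rule Lim_transform_eventually) (use half_schwarzian_r assms in \<open>auto elim: eventually_mono\<close>)
qed

lemma tendsto_log_deriv_r: "((\<lambda>t. t * deriv r t / r t) \<longlongrightarrow> of_nat m) (at 0)"
proof -
  have lim: "(u \<longlongrightarrow> u 0) (at 0)" "(v \<longlongrightarrow> v 0) (at 0)"
    using analytic_at_imp_isCont[OF u(1)] analytic_at_imp_isCont[OF v(1)] isContD by blast+
  have "((\<lambda>t. v t / u t) \<longlongrightarrow> v 0 / u 0) (at 0)"
    by (intro tendsto_intros lim u)
  also have "v 0 / u 0 = of_nat m" using u by (simp add: v_def)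
  finally show ?thesis
  proof (rule Lim_transform_eventually)
    show "\<forall>\<^sub>F t in at 0. v t / u t = t * deriv r t / r t"
      using deriv_r[unfolded eventually_nhds_conv_at, THEN conjunct1] eventually_neq_at_within[of 0 0]
    proof eventually_elim
      case (elim t)
      have "t * t ^ (m - 1) = t ^ m" using m by (metis power_eq_if less_numeral_extra(3))
      then have "t * deriv r t / r t = (t ^ m * v t) / (t ^ m * u t)"
        unfolding elim(1) r_def by (metis mult.assoc)
      then show ?case using elim(2) by simp
    qed
  qed
qed

lemma deriv_r_0: "m = 1 \<Longrightarrow> deriv r 0 \<noteq> 0"
  using deriv_r v(2) eventually_nhds_x_imp_x by fastforce

lemma r_0: "r 0 = 0" using m by (simp add: r_def)

end

section \<open>Exponent differences and removable points\<close>

text \<open>An equation with a regular singular point at \<open>0\<close>; the exponents are the roots of the indicial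
  equation \<open>\<lambda> (\<lambda> - 1) + A \<lambda> + B = 0\<close>.\<close>

definition regular_singular :: "ode2 \<Rightarrow> complex \<Rightarrow> complex \<Rightarrow> bool" where
  "regular_singular E A B \<longleftrightarrow> (\<exists>g. g analytic_on {0} \<and> (\<forall>\<^sub>F t in at 0. fst E t = A / t + g t)) \<and>
     ((\<lambda>t. t\<^sup>2 * snd E t) \<longlongrightarrow> B) (at 0)"

text \<open>The square of the exponent difference.\<close>

definition indicial_discriminant :: "complex \<Rightarrow> complex \<Rightarrow> complex" where
  "indicial_discriminant A B = (1 - A)\<^sup>2 - 4 * B"

lemma normal_invariant_simple_pole:
  assumes "g analytic_on {0}" "\<forall>\<^sub>F t in at 0. fst E t = A / t + g t"
  shows "\<forall>\<^sub>F t in at 0. normal_invariant E t = snd E t - (deriv g t - A / t\<^sup>2) / 2 - (A / t + g t)\<^sup>2 / 4"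
  using eventually_at_imp_eventually_nhds[OF assms(2)] eventually_at_analytic_at[OF assms(1)]
    eventually_neq_at_within[of 0 0]
proof eventually_elim
  case (elim t)
  have "((\<lambda>t. A / t + g t) has_field_derivative (deriv g t - A / t\<^sup>2)) (at t)"
    using elim(3) by (auto intro!: derivative_eq_intros analytic_at_imp_has_deriv[OF elim(2)]
        simp: power2_eq_square)
  then show ?case
    using deriv_cong_ev[OF elim(1) refl] eventually_nhds_x_imp_x[OF elim(1)]
    by (simp add: normal_invariant_def DERIV_imp_deriv)
qed

lemma regular_singular_imp_analytic:
  assumes "regular_singular E A B"
  shows "\<forall>\<^sub>F t in at 0. fst E analytic_on {t}"
proof -
  obtain g where g: "g analytic_on {0}" "\<forall>\<^sub>F t in at 0. fst E t = A / t + g t"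
    using assms by (auto simp: regular_singular_def)
  show ?thesis
    using eventually_at_imp_eventually_nhds[OF g(2)] eventually_at_analytic_at[OF g(1)]
      eventually_neq_at_within[of 0 0]
  proof eventually_elim
    case (elim t)
    have "(\<lambda>t. A / t + g t) analytic_on {t}"
      using elim by (auto intro!: analytic_intros)
    then show ?case using analytic_at_cong[OF elim(1) refl] by simp
  qed
qed

text \<open>The invariant forgets the exponents except for their difference, since multiplication by a power of \<open>t\<close>
shifts both of them.\<close>

lemma tendsto_normal_invariant:
  assumes "regular_singular E A B"
  shows "((\<lambda>t. t\<^sup>2 * normal_invariant E t) \<longlongrightarrow> (1 - indicial_discriminant A B) / 4) (at 0)"
proof -
  obtain g where g: "g analytic_on {0}" "\<forall>\<^sub>F t in at 0. fst E t = A / t + g t"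
    and B: "((\<lambda>t. t\<^sup>2 * snd E t) \<longlongrightarrow> B) (at 0)"
    using assms by (auto simp: regular_singular_def)
  have lim: "(g \<longlongrightarrow> g 0) (at 0)" "(deriv g \<longlongrightarrow> deriv g 0) (at 0)"
    using analytic_at_imp_isCont[OF g(1)] analytic_at_imp_isCont[OF analytic_deriv[OF g(1)]] isContD by blast+
  have "((\<lambda>t. t\<^sup>2 * snd E t - (t\<^sup>2 * deriv g t - A) / 2 - (A + t * g t)\<^sup>2 / 4)
      \<longlongrightarrow> B - (0\<^sup>2 * deriv g 0 - A) / 2 - (A + 0 * g 0)\<^sup>2 / 4) (at 0)"
    by (intro tendsto_intros lim B) auto
  also have "B - (0\<^sup>2 * deriv g 0 - A) / 2 - (A + 0 * g 0)\<^sup>2 / 4 = (1 - indicial_discriminant A B) / 4"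
    by (simp add: indicial_discriminant_def power2_eq_square field_simps)
  finally show ?thesis
  proof (rule Lim_transform_eventually)
    show "\<forall>\<^sub>F t in at 0. t\<^sup>2 * snd E t - (t\<^sup>2 * deriv g t - A) / 2 - (A + t * g t)\<^sup>2 / 4 = t\<^sup>2 * normal_invariant E t"
      using normal_invariant_simple_pole[OF g] eventually_neq_at_within[of 0 0]
    proof eventually_elim
      case (elim t)
      have "t * (A / t + g t) = A + t * g t" using elim(2) by (simp add: field_simps)
      then have "(A + t * g t)\<^sup>2 = t\<^sup>2 * (A / t + g t)\<^sup>2" by (metis power_mult_distrib)
      moreover have "t\<^sup>2 * deriv g t - A = t\<^sup>2 * (deriv g t - A / t\<^sup>2)"
        using elim(2) by (simp add: field_simps)
      ultimately show ?case using elim(1) by (simp add: right_diff_distrib)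
    qed
  qed
qed

text \<open>Multiplication by a power of \<open>t\<close> can clear the pole of the first coefficient and does not
  change the invariant, so the invariant alone decides.\<close>

lemma removable_at_iff_normal_invariant:
  assumes "regular_singular E A B"
  shows "removable_at E 0 \<longleftrightarrow> (\<exists>l. (normal_invariant E \<longlongrightarrow> l) (at 0))"
proof -
  obtain g where g: "g analytic_on {0}" "\<forall>\<^sub>F t in at 0. fst E t = A / t + g t"
    using assms by (auto simp: regular_singular_def)
  have lim: "(g \<longlongrightarrow> g 0) (at 0)" "(deriv g \<longlongrightarrow> deriv g 0) (at 0)"
    using analytic_at_imp_isCont[OF g(1)] analytic_at_imp_isCont[OF analytic_deriv[OF g(1)]] isContD by blast+
  have rescaled: "\<forall>\<^sub>F t in at 0. snd (ode_rescale (\<lambda>x. A / 2 / (x - 0)) E) t =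
      normal_invariant E t + deriv g t / 2 + (g t)\<^sup>2 / 4"
    using normal_invariant_simple_pole[OF g] g(2) eventually_neq_at_within[of 0 0]
  proof eventually_elim
    case (elim t)
    have "((\<lambda>x. A / 2 / (x - 0)) has_field_derivative (- (A / t\<^sup>2 / 2))) (at t)"
      using elim(3) by (auto intro!: derivative_eq_intros simp: power2_eq_square)
    then have d: "deriv (\<lambda>x. A / 2 / (x - 0)) t = - (A / t\<^sup>2 / 2)" by (rule DERIV_imp_deriv)
    have s: "A / 2 / (t - 0) = A / t / 2" by simp
    have "Q - (s + g) * (s / 2) + (s / 2)\<^sup>2 - - (a / 2) =
        Q - (g' - a) / 2 - (s + g)\<^sup>2 / 4 + g' / 2 + g\<^sup>2 / 4" for Q s g g' a :: complex
      by (simp add: power2_eq_square add_divide_distrib diff_divide_distrib algebra_simps)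
    then show ?case unfolding ode_rescale_def snd_conv d s elim(1,2) by simp
  qed
  show ?thesis
  proof
    assume "removable_at E 0"
    then obtain \<kappa> k l where k: "(fst (ode_rescale (\<lambda>x. \<kappa> / (x - 0)) E) \<longlongrightarrow> k) (at 0)"
      and l: "(snd (ode_rescale (\<lambda>x. \<kappa> / (x - 0)) E) \<longlongrightarrow> l) (at 0)"
      by (auto simp: removable_at_def ordinary_at_def)
    have "((\<lambda>t. t * (fst (ode_rescale (\<lambda>x. \<kappa> / (x - 0)) E) t - g t)) \<longlongrightarrow> 0 * (k - g 0)) (at 0)"
      by (intro tendsto_intros k lim)
    moreover have "\<forall>\<^sub>F t in at 0. t * (fst (ode_rescale (\<lambda>x. \<kappa> / (x - 0)) E) t - g t) = A - 2 * \<kappa>"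
      using g(2) eventually_neq_at_within[of 0 0]
      by eventually_elim (simp add: ode_rescale_def field_simps)
    ultimately have "((\<lambda>t. A - 2 * \<kappa>) \<longlongrightarrow> 0) (at (0::complex))"
      using Lim_transform_eventually by fastforce
    then have "A - 2 * \<kappa> = 0" by (simp add: tendsto_const_iff)
    then have \<kappa>: "\<kappa> = A / 2" by simp
    have "((\<lambda>t. snd (ode_rescale (\<lambda>x. A / 2 / (x - 0)) E) t - deriv g t / 2 - (g t)\<^sup>2 / 4)
        \<longlongrightarrow> l - deriv g 0 / 2 - (g 0)\<^sup>2 / 4) (at 0)"
      using l unfolding \<kappa> by (intro tendsto_intros lim) auto
    then have "(normal_invariant E \<longlongrightarrow> l - deriv g 0 / 2 - (g 0)\<^sup>2 / 4) (at 0)"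
      by (rule Lim_transform_eventually) (use rescaled in \<open>auto elim: eventually_mono\<close>)
    then show "\<exists>l. (normal_invariant E \<longlongrightarrow> l) (at 0)" by blast
  next
    assume "\<exists>l. (normal_invariant E \<longlongrightarrow> l) (at 0)"
    then obtain l where l: "(normal_invariant E \<longlongrightarrow> l) (at 0)" by blast
    have "((\<lambda>t. normal_invariant E t + deriv g t / 2 + (g t)\<^sup>2 / 4)
        \<longlongrightarrow> l + deriv g 0 / 2 + (g 0)\<^sup>2 / 4) (at 0)"
      by (intro tendsto_intros lim l) auto
    then have "(snd (ode_rescale (\<lambda>x. A / 2 / (x - 0)) E) \<longlongrightarrow> l + deriv g 0 / 2 + (g 0)\<^sup>2 / 4) (at 0)"
      by (rule Lim_transform_eventually) (use rescaled in \<open>auto elim: eventually_mono\<close>)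
    moreover have "(fst (ode_rescale (\<lambda>x. A / 2 / (x - 0)) E) \<longlongrightarrow> g 0) (at 0)"
      by (rule Lim_transform_eventually[OF lim(1)])
         (use g(2) in \<open>auto simp: ode_rescale_def elim: eventually_mono\<close>)
    ultimately show "removable_at E 0"
      unfolding removable_at_def ordinary_at_def by blast
  qed
qed

text \<open>With \<open>t\<^sup>2 I \<rightarrow> (1 - d\<^sup>2) / 4\<close> upstairs and the same downstairs for \<open>d'\<close>, the transformation law of \<open>I\<close>
gives \<open>1 - d\<^sup>2 = (1 - d'\<^sup>2) m\<^sup>2 + (1 - m\<^sup>2)\<close> in the limit.\<close>

lemma (in power_germ) indicial_discriminant_lift:
  assumes "germ_lift E \<eta> r E'" "\<forall>\<^sub>F t in at 0. \<eta> analytic_on {t}"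
    and E: "regular_singular E A B" and E': "regular_singular E' A' B'"
  shows "indicial_discriminant A B = (of_nat m)\<^sup>2 * indicial_discriminant A' B'"
proof -
  let ?D = "indicial_discriminant A B" and ?D' = "indicial_discriminant A' B'"
  have r: "filterlim r (at 0) (at 0)" using germ_map_r by (simp add: germ_map_def)
  have "((\<lambda>t. (r t)\<^sup>2 * normal_invariant E' (r t)) \<longlongrightarrow> (1 - ?D') / 4) (at 0)"
    using filterlim_compose[OF tendsto_normal_invariant[OF E'] r] .
  then have "((\<lambda>t. ((r t)\<^sup>2 * normal_invariant E' (r t)) * (t * deriv r t / r t)\<^sup>2 + t\<^sup>2 * half_schwarzian r t)
      \<longlongrightarrow> (1 - ?D') / 4 * (of_nat m)\<^sup>2 + (1 - (of_nat m)\<^sup>2) / 4) (at 0)"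
    by (intro tendsto_intros tendsto_log_deriv_r tendsto_half_schwarzian_r)
  moreover have "\<forall>\<^sub>F t in at 0. ((r t)\<^sup>2 * normal_invariant E' (r t)) * (t * deriv r t / r t)\<^sup>2 +
      t\<^sup>2 * half_schwarzian r t = t\<^sup>2 * normal_invariant E t"
  proof -
    have "\<forall>\<^sub>F t in at 0. r t \<noteq> 0" using r by (simp add: filterlim_at)
    with germ_lift_normal_invariant[OF assms(1) germ_map_r assms(2) regular_singular_imp_analytic[OF E']]
    show ?thesis
    proof eventually_elim
      case (elim t)
      have "(r t)\<^sup>2 * (t * deriv r t / r t)\<^sup>2 = t\<^sup>2 * (deriv r t)\<^sup>2"
        using elim(2) by (simp add: power_divide power_mult_distrib)
      then show ?case unfolding elim(1) by (simp add: algebra_simps)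
    qed
  qed
  ultimately have "((\<lambda>t. t\<^sup>2 * normal_invariant E t)
      \<longlongrightarrow> (1 - ?D') / 4 * (of_nat m)\<^sup>2 + (1 - (of_nat m)\<^sup>2) / 4) (at 0)"
    by (rule Lim_transform_eventually)
  from tendsto_unique[OF _ this tendsto_normal_invariant[OF E]]
  show ?thesis by (simp add: field_simps)
qed

text \<open>At an unramified point the Schwarzian derivative is finite and \<open>r' 0 \<noteq> 0\<close>, so the invariants upstairs and
downstairs have limits simultaneously.\<close>

lemma (in power_germ) removable_at_lift:
  assumes "germ_lift E \<eta> r E'" "\<forall>\<^sub>F t in at 0. \<eta> analytic_on {t}"
    and E: "regular_singular E A B" and E': "regular_singular E' A' B'"
    and "m = 1" "removable_at E 0"
  shows "removable_at E' 0"
proof -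
  obtain l where "(normal_invariant E \<longlongrightarrow> l) (at 0)"
    using assms(6) removable_at_iff_normal_invariant[OF E] by blast
  moreover have "(deriv r \<longlongrightarrow> deriv r 0) (at 0)"
    using analytic_at_imp_isCont[OF analytic_deriv[OF r_analytic]] isContD by blast
  ultimately have "((\<lambda>t. (normal_invariant E t - half_schwarzian r t) / (deriv r t)\<^sup>2) \<longlongrightarrow>
      (l - (deriv w 0 / 2 - (w 0)\<^sup>2 / 4)) / (deriv r 0)\<^sup>2) (at 0)"
    using deriv_r_0[OF assms(5)] by (intro tendsto_intros tendsto_half_schwarzian_r_unramified assms(5)) auto
  moreover have "\<forall>\<^sub>F t in at 0. (normal_invariant E t - half_schwarzian r t) / (deriv r t)\<^sup>2 = normal_invariant E' (r t)"
    using germ_lift_normal_invariant[OF assms(1) germ_map_r assms(2) regular_singular_imp_analytic[OF E']]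
      deriv_r_nz by eventually_elim simp
  ultimately have "((\<lambda>t. normal_invariant E' (r t)) \<longlongrightarrow>
      (l - (deriv w 0 / 2 - (w 0)\<^sup>2 / 4)) / (deriv r 0)\<^sup>2) (at 0)"
    by (rule Lim_transform_eventually)
  from tendsto_compose_local_iso[OF r_analytic r_0 deriv_r_0[OF assms(5)] this]
  show ?thesis using removable_at_iff_normal_invariant[OF E'] by blast
qed

section \<open>Charts of the sphere\<close>

primrec chart :: "point \<Rightarrow> complex \<Rightarrow> complex" where
  "chart (Pt c) = (\<lambda>t. c + t)"
| "chart Infinity = inverse"

primrec cochart :: "point \<Rightarrow> complex \<Rightarrow> complex" where
  "cochart (Pt c) = (\<lambda>x. x - c)"
| "cochart Infinity = inverse"

lemma chart_cochart [simp]: "chart w (cochart w y) = y"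
  by (cases w) auto

definition localize :: "point \<Rightarrow> ode2 \<Rightarrow> ode2" where
  "localize z E = ode_pullback (chart z) E"

lemma deriv_shift [simp]: "deriv (\<lambda>t::complex. c + t) = (\<lambda>t. 1)"
  by (rule ext, rule DERIV_imp_deriv) (auto intro!: derivative_eq_intros)

lemma deriv_inverse: "t \<noteq> 0 \<Longrightarrow> deriv inverse (t::complex) = - (1 / t\<^sup>2)"
  by (rule DERIV_imp_deriv)
     (auto intro!: derivative_eq_intros simp: power2_eq_square divide_inverse)

lemma deriv2_inverse:
  assumes "t \<noteq> 0"
  shows "deriv (deriv inverse) (t::complex) = 2 / t ^ 3"
proof -
  have "\<forall>\<^sub>F t in nhds t. t \<noteq> 0" using assms t1_space_nhds by blast
  then have ev: "\<forall>\<^sub>F t in nhds t. deriv inverse t = - (1 / t\<^sup>2)"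
    by eventually_elim (rule deriv_inverse)
  have "((\<lambda>t::complex. - (1 / t\<^sup>2)) has_field_derivative 2 / t ^ 3) (at t)"
    using assms by (auto intro!: derivative_eq_intros simp: power2_eq_square power3_eq_cube field_simps)
  then show ?thesis using deriv_cong_ev[OF ev refl] DERIV_imp_deriv by simp
qed

lemma localize_Pt: "localize (Pt c) E = (\<lambda>t. fst E (c + t), \<lambda>t. snd E (c + t))"
  by (simp add: localize_def ode_pullback_def)

lemma localize_Infinity:
  assumes "t \<noteq> 0"
  shows "fst (localize Infinity E) t = 2 / t - fst E (1 / t) / t\<^sup>2"
    "snd (localize Infinity E) t = snd E (1 / t) / t ^ 4"
  using assms by (auto simp: localize_def ode_pullback_def deriv_inverse deriv2_inverse
      power2_eq_square power3_eq_cube power4_eq_xxxx field_simps)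

lemma removable_at_shift: "removable_at E c \<longleftrightarrow> removable_at (localize (Pt c) E) 0"
proof -
  have *: "ordinary_at (ode_rescale (\<lambda>x. \<kappa> / (x - c)) E) c \<longleftrightarrow>
      ordinary_at (ode_rescale (\<lambda>x. \<kappa> / (x - 0)) (localize (Pt c) E)) 0" for \<kappa>
  proof -
    have d: "deriv (\<lambda>x. \<kappa> / (x - b)) t = - (\<kappa> / (t - b)\<^sup>2)" if "t \<noteq> b" for t b :: complex
      by (rule DERIV_imp_deriv)
         (use that in \<open>auto intro!: derivative_eq_intros simp: power2_eq_square\<close>)
    let ?F = "ode_rescale (\<lambda>x. \<kappa> / (x - c)) E"
      and ?G = "ode_rescale (\<lambda>x. \<kappa> / (x - 0)) (localize (Pt c) E)"
    have same: "fst ?F (t + c) = fst ?G t" "snd ?F (t + c) = snd ?G t" if "t \<noteq> 0" for t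
      unfolding ode_rescale_def fst_conv snd_conv localize_Pt
      using that d[of "t + c" c] d[of t 0] by (simp_all add: add.commute)
    have 1: "\<forall>\<^sub>F t in at 0. fst ?F (t + c) = fst ?G t"
      by (rule eventually_mono[OF eventually_neq_at_within[of 0 0]]) (rule same)
    have 2: "\<forall>\<^sub>F t in at 0. snd ?F (t + c) = snd ?G t"
      by (rule eventually_mono[OF eventually_neq_at_within[of 0 0]]) (rule same)
    show ?thesis
      unfolding ordinary_at_def filterlim_at_to_0[of _ _ c]
        filterlim_cong[OF refl refl 1] filterlim_cong[OF refl refl 2] ..
  qed
  show ?thesis unfolding removable_at_def by (rule ex_cong1[OF *])
qed

lemma singular_point_iff: "singular_point E z \<longleftrightarrow> \<not> removable_at (localize z E) 0"
proof (cases z)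
  case (Pt c)
  then show ?thesis using removable_at_shift[of E c] by simp
qed (simp add: localize_def)

section \<open>Local exponents of the Heun equation\<close>

text \<open>The square is free of the choice of order of the two exponents. The exponents at an ordinary point
are \<open>0\<close> and \<open>1\<close>, whence the value \<open>1\<close>.\<close>

primrec exponent_diff_sq :: "heun \<Rightarrow> point \<Rightarrow> complex" where
  "exponent_diff_sq p (Pt c) =
     (if c = 0 then (1 - par_gamma p)\<^sup>2 else if c = 1 then (1 - par_delta p)\<^sup>2
      else if c = par_a p then (1 - par_epsilon p)\<^sup>2 else 1)"
| "exponent_diff_sq p Infinity = (par_alpha p - par_beta p)\<^sup>2"

lemma exponent_diff_sq_ordinary: "z \<notin> heun_points p \<Longrightarrow> exponent_diff_sq p z = 1"
  by (cases z) (auto simp: heun_points_def)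

text \<open>The residue of the first coefficient at \<open>\<infinity>\<close> is \<open>2 - (\<gamma> + \<delta> + \<epsilon>) = 1 - \<alpha> - \<beta>\<close>, so that the indicial equation
there has the discriminant \<open>(\<alpha> + \<beta>)\<^sup>2 - 4 \<alpha> \<beta>\<close>. At a finite point one exponent is \<open>0\<close>.\<close>

lemma heun_regular_singular:
  assumes "par_a p \<noteq> 0" "par_a p \<noteq> 1"
  shows "\<exists>A B. regular_singular (localize z (heun_ode p)) A B \<and>
    indicial_discriminant A B = exponent_diff_sq p z"
proof -
  define a \<gamma> \<delta> \<epsilon> \<alpha> \<beta> q where defs: "a = par_a p" "\<gamma> = par_gamma p" "\<delta> = par_delta p"
    "\<epsilon> = par_epsilon p" "\<alpha> = par_alpha p" "\<beta> = par_beta p" "q = par_q p"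
  have a: "a \<noteq> 0" "a \<noteq> 1" using assms by (auto simp: defs)
  have fuchs: "\<gamma> + \<delta> + \<epsilon> = \<alpha> + \<beta> + 1" by (simp add: defs par_epsilon_def)
  show ?thesis
  proof (cases z)
    case Infinity
    let ?E = "localize z (heun_ode p)"
    have "\<forall>\<^sub>F t::complex in at 0. 1 - t \<noteq> 0 \<and> 1 - a * t \<noteq> 0"
      by (intro eventually_conj; rule tendsto_imp_eventually_ne[where c = 1])
         (auto intro!: tendsto_eq_intros)
    then have ev: "\<forall>\<^sub>F t::complex in at 0. t \<noteq> 0 \<and> 1 - t \<noteq> 0 \<and> 1 - a * t \<noteq> 0"
      using eventually_neq_at_within[of 0 0] by eventually_elim auto
    have "\<forall>\<^sub>F t in at 0. fst ?E t = (1 - \<alpha> - \<beta>) / t + (- \<delta> / (1 - t) - a * \<epsilon> / (1 - a * t))"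
      using ev
    proof eventually_elim
      case (elim t)
      have e: "\<gamma> / (1 / t) = \<gamma> * t" "\<delta> / (1 / t - 1) = \<delta> * t / (1 - t)"
        "\<epsilon> / (1 / t - a) = \<epsilon> * t / (1 - a * t)"
        using elim by (auto simp: field_simps)
      have f: "x * t / (1 - c * t) / t\<^sup>2 = x / t + c * x / (1 - c * t)" if "1 - c * t \<noteq> 0" for x c
        using elim that by (simp add: field_simps power2_eq_square)
      have "fst ?E t = 2 / t - (\<gamma> * t + \<delta> * t / (1 - t) + \<epsilon> * t / (1 - a * t)) / t\<^sup>2"
        unfolding Infinity using localize_Infinity(1)[of t] elim by (simp add: heun_ode_def e flip: defs)
      also have "\<dots> = 2 / t - \<gamma> / t - \<delta> * t / (1 - t) / t\<^sup>2 - \<epsilon> * t / (1 - a * t) / t\<^sup>2"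
        using elim by (simp add: add_divide_distrib power2_eq_square)
      also have "\<dots> = 2 / t - \<gamma> / t - (\<delta> / t + \<delta> / (1 - t)) - (\<epsilon> / t + a * \<epsilon> / (1 - a * t))"
        using f[of 1 \<delta>] f[of a \<epsilon>] elim by simp
      also have "\<dots> = (2 - (\<gamma> + \<delta> + \<epsilon>)) / t + (- \<delta> / (1 - t) - a * \<epsilon> / (1 - a * t))"
        by (simp add: add_divide_distrib diff_divide_distrib)
      finally show ?case by (simp add: fuchs)
    qed
    moreover have "(\<lambda>t. - \<delta> / (1 - t) - a * \<epsilon> / (1 - a * t)) analytic_on {0}"
      by (auto intro!: analytic_intros)
    moreover have "((\<lambda>t. t\<^sup>2 * snd ?E t) \<longlongrightarrow> \<alpha> * \<beta>) (at 0)"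
    proof (rule Lim_transform_eventually)
      show "((\<lambda>t. (\<alpha> * \<beta> - q * t) / ((1 - t) * (1 - a * t))) \<longlongrightarrow> \<alpha> * \<beta>) (at 0)"
        by (auto intro!: tendsto_eq_intros)
      show "\<forall>\<^sub>F t in at 0. (\<alpha> * \<beta> - q * t) / ((1 - t) * (1 - a * t)) = t\<^sup>2 * snd ?E t"
        using ev
      proof eventually_elim
        case (elim t)
        have e: "\<alpha> * \<beta> * (1 / t) - q = (\<alpha> * \<beta> - q * t) / t"
          "1 / t * (1 / t - 1) * (1 / t - a) = (1 - t) * (1 - a * t) / t ^ 3"
          using elim by (auto simp: field_simps power3_eq_cube)
        have "snd (heun_ode p) (1 / t) = (\<alpha> * \<beta> - q * t) / t / ((1 - t) * (1 - a * t) / t ^ 3)"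
          unfolding heun_ode_def snd_conv defs[symmetric] e ..
        then have "snd ?E t = (\<alpha> * \<beta> - q * t) / t / ((1 - t) * (1 - a * t) / t ^ 3) / t ^ 4"
          unfolding Infinity using localize_Infinity(2)[of t] elim by simp
        also have "\<dots> = (\<alpha> * \<beta> - q * t) / ((1 - t) * (1 - a * t)) / t\<^sup>2"
          using elim by (simp add: power2_eq_square power3_eq_cube power4_eq_xxxx)
        finally show ?case using elim by simp
      qed
    qed
    ultimately have "regular_singular ?E (1 - \<alpha> - \<beta>) (\<alpha> * \<beta>)"
      unfolding regular_singular_def by blast
    moreover have "indicial_discriminant (1 - \<alpha> - \<beta>) (\<alpha> * \<beta>) = exponent_diff_sq p z"
      by (simp add: indicial_discriminant_def Infinity defs power2_eq_square algebra_simps)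
    ultimately show ?thesis by blast
  next
    case (Pt c)
    let ?E = "localize z (heun_ode p)"
    have P: "fst ?E t = \<gamma> / (c + t) + \<delta> / (c + t - 1) + \<epsilon> / (c + t - a)" for t
      by (simp add: Pt localize_Pt heun_ode_def defs)
    have Q: "snd ?E t = (\<alpha> * \<beta> * (c + t) - q) / ((c + t) * (c + t - 1) * (c + t - a))" for t
      by (simp add: Pt localize_Pt heun_ode_def defs)
    have reg: "regular_singular ?E A 0"
      if "g analytic_on {0}" "\<And>t. t \<noteq> 0 \<Longrightarrow> fst ?E t = A / t + g t"
        "((\<lambda>t. t\<^sup>2 * snd ?E t) \<longlongrightarrow> 0) (at 0)" for g A
    proof -
      have "\<forall>\<^sub>F t in at 0. fst ?E t = A / t + g t"
        using eventually_neq_at_within[of 0 0] by eventually_elim (rule that(2))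
      then show ?thesis using that unfolding regular_singular_def by blast
    qed
    have D: "indicial_discriminant A 0 = (1 - A)\<^sup>2" for A by (simp add: indicial_discriminant_def)
    have lim: "((\<lambda>t. t\<^sup>2 * snd ?E t) \<longlongrightarrow> 0) (at 0)"
      if "\<And>t. t \<noteq> 0 \<Longrightarrow> t\<^sup>2 * snd ?E t = t * f t" "isCont f 0" for f
    proof (rule Lim_transform_eventually)
      show "((\<lambda>t. t * f t) \<longlongrightarrow> 0) (at 0)"
        using tendsto_mult[OF tendsto_ident_at isContD[OF that(2)]] by simp
      show "\<forall>\<^sub>F t in at 0. t * f t = t\<^sup>2 * snd ?E t"
        using eventually_neq_at_within[of 0 0] by eventually_elim (simp add: that(1))
    qed
    consider "c = 0" | "c = 1" | "c = a" | "c \<noteq> 0" "c \<noteq> 1" "c \<noteq> a" by blast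
    then show ?thesis
    proof cases
      case 1
      have "regular_singular ?E \<gamma> 0"
      proof (rule reg)
        show "(\<lambda>t. \<delta> / (t - 1) + \<epsilon> / (t - a)) analytic_on {0}"
          using a by (auto intro!: analytic_intros)
        show "((\<lambda>t. t\<^sup>2 * snd ?E t) \<longlongrightarrow> 0) (at 0)"
          by (rule lim[of "\<lambda>t. (\<alpha> * \<beta> * t - q) / ((t - 1) * (t - a))"])
             (use a in \<open>auto simp: Q 1 power2_eq_square intro!: continuous_intros\<close>)
      qed (simp add: P 1)
      then show ?thesis using D[of \<gamma>] by (auto simp: Pt 1 defs)
    next
      case 2
      have "regular_singular ?E \<delta> 0"
      proof (rule reg)
        show "(\<lambda>t. \<gamma> / (1 + t) + \<epsilon> / (1 + t - a)) analytic_on {0}"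
          using a by (auto intro!: analytic_intros)
        show "((\<lambda>t. t\<^sup>2 * snd ?E t) \<longlongrightarrow> 0) (at 0)"
          by (rule lim[of "\<lambda>t. (\<alpha> * \<beta> * (1 + t) - q) / ((1 + t) * (1 + t - a))"])
             (use a in \<open>auto simp: Q 2 power2_eq_square intro!: continuous_intros\<close>)
      qed (simp add: P 2)
      then show ?thesis using D[of \<delta>] by (auto simp: Pt 2 defs)
    next
      case 3
      have "regular_singular ?E \<epsilon> 0"
      proof (rule reg)
        show "(\<lambda>t. \<gamma> / (a + t) + \<delta> / (a + t - 1)) analytic_on {0}"
          using a by (auto intro!: analytic_intros)
        show "((\<lambda>t. t\<^sup>2 * snd ?E t) \<longlongrightarrow> 0) (at 0)"
          by (rule lim[of "\<lambda>t. (\<alpha> * \<beta> * (a + t) - q) / ((a + t) * (a + t - 1))"])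
             (use a in \<open>auto simp: Q 3 power2_eq_square intro!: continuous_intros\<close>)
      qed (simp add: P 3)
      then show ?thesis using D[of \<epsilon>] a by (auto simp: Pt 3 defs)
    next
      case 4
      have "regular_singular ?E 0 0"
      proof (rule reg)
        show "(\<lambda>t. \<gamma> / (c + t) + \<delta> / (c + t - 1) + \<epsilon> / (c + t - a)) analytic_on {0}"
          using 4 by (auto intro!: analytic_intros)
        show "((\<lambda>t. t\<^sup>2 * snd ?E t) \<longlongrightarrow> 0) (at 0)"
          by (rule lim[of "\<lambda>t. t * ((\<alpha> * \<beta> * (c + t) - q) / ((c + t) * (c + t - 1) * (c + t - a)))"])
             (use 4 in \<open>auto simp: Q power2_eq_square intro!: continuous_intros\<close>)
      qed (simp add: P)
      then show ?thesis using D[of 0] 4 by (auto simp: Pt defs)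
    qed
  qed
qed

lemma heun_points_if_singular:
  assumes "par_a p \<noteq> 0" "par_a p \<noteq> 1" "singular_point (heun_ode p) z"
  shows "z \<in> heun_points p"
proof (rule ccontr)
  assume z: "z \<notin> heun_points p"
  then obtain c where c: "z = Pt c" "c \<noteq> 0" "c \<noteq> 1" "c \<noteq> par_a p"
    by (cases z) (auto simp: heun_points_def)
  let ?E = "ode_rescale (\<lambda>x. 0 / (x - c)) (heun_ode p)"
  have 1: "(fst ?E \<longlongrightarrow> fst (heun_ode p) c) (at c)"
    using c by (auto simp: ode_rescale_def heun_ode_def intro!: tendsto_intros)
  have 2: "(snd ?E \<longlongrightarrow> snd (heun_ode p) c) (at c)"
    using c by (auto simp: ode_rescale_def heun_ode_def intro!: tendsto_intros)
  have "ordinary_at ?E c" unfolding ordinary_at_def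
    by (rule conjI; rule exI) (rule 1, rule 2)
  then have "removable_at (heun_ode p) c" unfolding removable_at_def by (rule exI[of _ 0])
  then show False using assms(3) c by simp
qed

lemma heun_equation_iff:
  "heun_equation p \<longleftrightarrow> par_a p \<noteq> 0 \<and> par_a p \<noteq> 1 \<and> (\<forall>z \<in> heun_points p. singular_point (heun_ode p) z)"
  using heun_points_if_singular[of p] unfolding heun_equation_def by blast

section \<open>Lifting along a rational map\<close>

text \<open>In the coordinate at \<open>w\<close>, the map \<open>R\<close> is the quotient of the fibre polynomial by this polynomial.\<close>

primrec cofibre_poly :: "ratmap \<Rightarrow> point \<Rightarrow> complex poly" where
  "cofibre_poly R (Pt c) = snd R"
| "cofibre_poly R Infinity = fst R"

lemma cochart_rat_fun:
  assumes "poly (snd R) x \<noteq> 0"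
  shows "cochart w (rat_fun R x) = poly (fibre_poly R w) x / poly (cofibre_poly R w) x"
  using assms by (cases w) (auto simp: rat_fun_def field_simps)

lemma analytic_on_poly: "(poly p :: complex \<Rightarrow> complex) analytic_on A"
proof (induction p)
  case 0
  have "poly 0 = (\<lambda>x::complex. 0)" by (rule ext) simp
  then show ?case by simp
next
  case (pCons a p)
  have "poly (pCons a p) = (\<lambda>x. a + x * poly p x)" by (rule ext) simp
  moreover have "(\<lambda>x. a + x * poly p x) analytic_on A" by (intro analytic_intros pCons.IH)
  ultimately show ?case by simp
qed

lemma coprime_fibre_cofibre:
  assumes "coprime (fst R) (snd R)"
  shows "coprime (fibre_poly R w) (cofibre_poly R w)"
proof (cases w)
  case (Pt c)
  have "coprime (fst R - smult c (snd R)) (snd R)"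
  proof (rule coprimeI)
    fix k assume k: "k dvd fst R - smult c (snd R)" "k dvd snd R"
    then have "k dvd (fst R - smult c (snd R)) + smult c (snd R)"
      by (intro dvd_add dvd_smult)
    then show "is_unit k" using assms k(2) by (simp add: coprime_common_divisor)
  qed
  then show ?thesis using Pt by simp
next
  case Infinity
  then show ?thesis using assms by (simp add: coprime_commute)
qed

lemma fibre_poly_nz:
  assumes "coprime (fst R) (snd R)" "0 < rat_deg R"
  shows "fibre_poly R w \<noteq> 0"
proof
  assume 0: "fibre_poly R w = 0"
  then have "is_unit (cofibre_poly R w)"
    using coprime_fibre_cofibre[OF assms(1), of w] by simp
  then have d: "degree (cofibre_poly R w) = 0" by (auto simp: is_unit_poly_iff)
  have "rat_deg R = 0"
  proof (cases w)
    case (Pt c)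
    then have "fst R = smult c (snd R)" using 0 by simp
    then show ?thesis
      using d Pt degree_smult_le[of c "snd R"] by (simp add: rat_deg_def)
  next
    case Infinity
    then show ?thesis using 0 d by (simp add: rat_deg_def)
  qed
  then show False using assms(2) by simp
qed

lemma snd_nz: "coprime (fst R) (snd R) \<Longrightarrow> 0 < rat_deg R \<Longrightarrow> snd R \<noteq> 0"
  using fibre_poly_nz[of R Infinity] by simp

lemma degree_cofibre_poly:
  assumes "degree (fibre_poly R w) < rat_deg R"
  shows "degree (cofibre_poly R w) = rat_deg R"
proof (cases w)
  case (Pt c)
  have "degree (fst R) = degree (fibre_poly R w)" if "degree (snd R) < degree (fst R)"
    using that degree_add_eq_left[of "- smult c (snd R)" "fst R"] Pt
    by (simp add: le_less_trans[OF degree_smult_le])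
  then show ?thesis using assms Pt
    by (cases "degree (snd R) < degree (fst R)") (auto simp: rat_deg_def)
next
  case Infinity
  then show ?thesis using assms by (auto simp: rat_deg_def)
qed

lemma degree_fibre_poly: "degree (fibre_poly R w) \<le> rat_deg R"
proof (cases w)
  case (Pt c)
  have "degree (smult c (snd R)) \<le> degree (snd R)" by (rule degree_smult_le)
  then show ?thesis
    using Pt degree_diff_le_max[of "fst R" "smult c (snd R)"] by (auto simp: rat_deg_def)
next
  case Infinity
  then show ?thesis by (simp add: rat_deg_def)
qed

text \<open>At a finite point the factor \<open>t\<^sup>m\<close> comes from the \<open>m\<close>-fold root of the fibre polynomial. At \<open>\<infinity>\<close>, it
comes from the defect of its degree, by reversing the coefficients of both polynomials.\<close>

lemma rat_mult_local_form:
  assumes R: "coprime (fst R) (snd R)" "0 < rat_deg R" and m: "rat_mult R w z = m" "0 < m"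
  shows "\<exists>u. u analytic_on {0} \<and> u 0 \<noteq> 0 \<and>
    (\<forall>\<^sub>F t in at 0. poly (snd R) (chart z t) \<noteq> 0 \<longrightarrow> cochart w (rat_fun R (chart z t)) = t ^ m * u t)"
proof (cases z)
  case (Pt x)
  let ?f = "fibre_poly R w" and ?g = "cofibre_poly R w"
  obtain G where G: "?f = [:- x, 1:] ^ m * G" "\<not> [:- x, 1:] dvd G"
    using order_decomp[OF fibre_poly_nz[OF R], of w x] m Pt by auto
  have Gx: "poly G x \<noteq> 0" using G(2) poly_eq_0_iff_dvd by blast
  have "poly ?f x = 0" using G(1) m(2) by simp
  then have gx: "poly ?g x \<noteq> 0" using coprime_poly_0[OF coprime_fibre_cofibre[OF R(1)]] by blast
  let ?u = "\<lambda>t. poly G (x + t) / poly ?g (x + t)"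
  have "(\<lambda>t. poly p (x + t)) analytic_on {0}" for p :: "complex poly"
    by (rule analytic_at_compose[OF _ analytic_on_poly]) (auto intro!: analytic_intros)
  then have "?u analytic_on {0}" using gx by (intro analytic_intros) auto
  moreover have "?u 0 \<noteq> 0" using Gx gx by simp
  moreover have "cochart w (rat_fun R (chart z t)) = t ^ m * ?u t"
    if "poly (snd R) (chart z t) \<noteq> 0" for t
    using cochart_rat_fun[OF that] Pt by (simp add: G(1))
  ultimately show ?thesis by (intro exI[of _ ?u]) auto
next
  case Infinity
  let ?f = "fibre_poly R w" and ?g = "cofibre_poly R w"
  have m': "m = rat_deg R - degree ?f" using m Infinity by simp
  then have dg: "degree ?g = rat_deg R" using m(2) by (intro degree_cofibre_poly) simp
  have nz: "?f \<noteq> 0" "?g \<noteq> 0"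
    using fibre_poly_nz[OF R] dg R(2) by auto
  let ?u = "\<lambda>t. poly (reflect_poly ?f) t / poly (reflect_poly ?g) t"
  have "?u analytic_on {0}" using nz by (intro analytic_intros analytic_on_poly) auto
  moreover have "?u 0 \<noteq> 0" using nz by simp
  moreover have "cochart w (rat_fun R (chart z t)) = t ^ m * ?u t"
    if "poly (snd R) (chart z t) \<noteq> 0" "t \<noteq> 0" for t
  proof -
    have "t ^ rat_deg R = t ^ m * t ^ degree ?f"
      using m' m(2) by (simp flip: power_add)
    then have "t ^ m * ?u t = poly ?f (inverse t) / poly ?g (inverse t)"
      using that(2) by (simp add: poly_reflect_poly_nz dg field_simps)
    then show ?thesis using cochart_rat_fun[OF that(1)] Infinity by simp
  qed
  then have "\<forall>\<^sub>F t in at 0. poly (snd R) (chart z t) \<noteq> 0 \<longrightarrow> cochart w (rat_fun R (chart z t)) = t ^ m * ?u t"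
    by (intro eventually_mono[OF eventually_neq_at_within[of 0 0]]) blast
  ultimately show ?thesis by blast
qed

lemma eventually_chart_cofinite:
  assumes "\<forall>\<^sub>\<infinity>x. P x"
  shows "\<forall>\<^sub>F t in at 0. P (chart z t)"
proof -
  have fin: "finite {x. \<not> P x}" using assms by (simp add: eventually_cofinite)
  have "\<forall>\<^sub>F t in at 0. chart z t \<noteq> c" for c
  proof (cases z)
    case (Pt d)
    show ?thesis by (rule eventually_mono[OF eventually_neq_at_within[of "c - d" 0]]) (auto simp: Pt)
  next
    case Infinity
    show ?thesis by (rule eventually_mono[OF eventually_neq_at_within[of "inverse c" 0]]) (auto simp: Infinity)
  qed
  then have "\<forall>\<^sub>F t in at 0. \<forall>c \<in> {x. \<not> P x}. chart z t \<noteq> c"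
    using fin by (intro eventually_ball_finite) auto
  then show ?thesis by (rule eventually_mono) auto
qed

text \<open>The part of \<open>heun_lift\<close> that concerns the coefficients only.\<close>

definition rat_lift :: "ode2 \<Rightarrow> (complex \<Rightarrow> complex) \<Rightarrow> ratmap \<Rightarrow> ode2 \<Rightarrow> bool" where
  "rat_lift E \<eta> R E' \<longleftrightarrow> coprime (fst R) (snd R) \<and> 0 < rat_deg R \<and> (\<forall>\<^sub>\<infinity>x. \<eta> analytic_on {x}) \<and>
     (\<forall>\<^sub>\<infinity>x. ode_at (ode_rescale \<eta> (ode_pullback (rat_fun R) E')) x = ode_at E x)"

lemma rat_lift_sum:
  assumes "coprime (fst R) (snd R)" "0 < rat_deg R" "finite C"
    "\<forall>\<^sub>\<infinity>x. ode_at (ode_rescale (\<lambda>x. \<Sum>c\<in>C. \<kappa> c / (x - c)) (ode_pullback (rat_fun R) E')) x = ode_at E x"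
  shows "rat_lift E (\<lambda>x. \<Sum>c\<in>C. \<kappa> c / (x - c)) R E'"
proof -
  have "(\<lambda>x. \<Sum>c\<in>C. \<kappa> c / (x - c)) analytic_on {x}" if "x \<notin> C" for x
    using that by (auto intro!: analytic_intros)
  then have "{x. \<not> (\<lambda>x. \<Sum>c\<in>C. \<kappa> c / (x - c)) analytic_on {x}} \<subseteq> C" by blast
  then have "\<forall>\<^sub>\<infinity>x. (\<lambda>x. \<Sum>c\<in>C. \<kappa> c / (x - c)) analytic_on {x}"
    unfolding eventually_cofinite using assms(3) finite_subset by blast
  then show ?thesis using assms by (simp add: rat_lift_def)
qed

lemma rat_fun_analytic: "poly (snd R) x \<noteq> 0 \<Longrightarrow> rat_fun R analytic_on {x}"
  unfolding rat_fun_def [abs_def] by (intro analytic_intros analytic_on_poly) auto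

lemma chart_analytic: "t \<noteq> 0 \<Longrightarrow> chart z analytic_on {t}"
  by (cases z) (auto intro!: analytic_intros)

lemma deriv_chart_nz: "t \<noteq> 0 \<Longrightarrow> deriv (chart z) t \<noteq> 0"
  by (cases z) (auto simp: deriv_inverse)

text \<open>Both sides of a lift are moved to the charts: the map becomes a power germ, and \<open>\<eta>\<close> is transported as a
differential. The points where \<open>R\<close> has a pole, or where the coefficients do not match, are finitely many, so
a punctured neighbourhood avoids them.\<close>

lemma rat_lift_germ_lift:
  assumes lift: "rat_lift E \<eta> R E'" and m: "rat_mult R w z = m" "0 < m"
  obtains u \<theta> where "power_germ m u" "\<forall>\<^sub>F t in at 0. \<theta> analytic_on {t}"
    "germ_lift (localize z E) \<theta> (power_germ.r m u) (localize w E')"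
proof -
  have R: "coprime (fst R) (snd R)" "0 < rat_deg R" using lift by (auto simp: rat_lift_def)
  obtain u where u: "u analytic_on {0}" "u 0 \<noteq> 0" and loc: "\<forall>\<^sub>F t in at 0.
      poly (snd R) (chart z t) \<noteq> 0 \<longrightarrow> cochart w (rat_fun R (chart z t)) = t ^ m * u t"
    using rat_mult_local_form[OF R m] by blast
  interpret power_germ m u by unfold_locales (use u m in auto)
  define \<theta> where "\<theta> = (\<lambda>t. \<eta> (chart z t) * deriv (chart z) t)"
  have "\<forall>\<^sub>\<infinity>x. poly (snd R) x \<noteq> 0"
    using poly_roots_finite[OF snd_nz[OF R]] by (simp add: eventually_cofinite)
  from eventually_chart_cofinite[OF this]
  have D: "\<forall>\<^sub>F t in at 0. poly (snd R) (chart z t) \<noteq> 0" .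
  have an: "\<forall>\<^sub>F t in at 0. \<eta> analytic_on {chart z t}"
    using lift by (intro eventually_chart_cofinite) (simp add: rat_lift_def)
  have ode: "\<forall>\<^sub>F t in at 0. ode_at (ode_rescale \<eta> (ode_pullback (rat_fun R) E')) (chart z t) = ode_at E (chart z t)"
    using lift by (intro eventually_chart_cofinite) (simp add: rat_lift_def)
  have "\<forall>\<^sub>F t in at 0. rat_fun R (chart z t) = chart w (r t)"
    using loc D by eventually_elim (metis chart_cochart r_def)
  note conj = eventually_at_imp_eventually_nhds[OF this]
  have an\<theta>: "\<forall>\<^sub>F t in at 0. \<theta> analytic_on {t}"
    using an eventually_neq_at_within[of 0 0]
  proof eventually_elim
    case (elim t)
    have c: "chart z analytic_on {t}" using chart_analytic elim(2) by blast
    show ?case unfolding \<theta>_def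
      by (rule analytic_on_mult[OF analytic_at_compose[OF c elim(1)] analytic_deriv[OF c]])
  qed
  have rlim: "filterlim r (at 0) (at 0)" using germ_map_r by (simp add: germ_map_def)
  have "\<forall>\<^sub>F t in at 0. r t \<noteq> 0" using rlim by (simp add: filterlim_at)
  then have "germ_lift (localize z E) \<theta> r (localize w E')"
    unfolding germ_lift_def
    using conj D an ode deriv_r_nz eventually_neq_at_within[of 0 0] eventually_at_analytic_at[OF r_analytic]
  proof eventually_elim
    case (elim t)
    have c: "chart z analytic_on {t}" "deriv (chart z) t \<noteq> 0"
      and c': "chart w analytic_on {r t}" "deriv (chart w) (r t) \<noteq> 0"
      using elim(1,7) chart_analytic deriv_chart_nz by blast+
    have Ran: "rat_fun R analytic_on {chart z t}" using elim(3) rat_fun_analytic by blast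
    have "deriv (rat_fun R) (chart z t) * deriv (chart z) t = deriv (chart w) (r t) * deriv r t"
      using deriv_cong_ev[OF elim(2) refl] deriv_compose_at[OF c(1) Ran] deriv_compose_at[OF elim(8) c'(1)]
      by simp
    then have dR: "deriv (rat_fun R) (chart z t) \<noteq> 0" using c'(2) elim(6) by force
    have "ode_at (localize z E) t =
        ode_at (ode_pullback (chart z) (ode_rescale \<eta> (ode_pullback (rat_fun R) E'))) t"
      unfolding localize_def by (rule ode_at_pullback_cong) (use elim(5) in auto)
    also have "\<dots> = ode_at (ode_rescale \<theta> (ode_pullback (chart z) (ode_pullback (rat_fun R) E'))) t"
      unfolding \<theta>_def by (rule ode_at_pullback_rescale[OF c(1) elim(4) c(2)])
    also have "\<dots> = ode_at (ode_rescale \<theta> (ode_pullback (\<lambda>t. rat_fun R (chart z t)) E')) t"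
      by (rule ode_at_rescale_cong) (use ode_at_pullback_compose[OF c(1) Ran c(2) dR] in auto)
    also have "\<dots> = ode_at (ode_rescale \<theta> (ode_pullback (\<lambda>t. chart w (r t)) E')) t"
      using eventually_nhds_x_imp_x[OF elim(2)]
      by (intro ode_at_rescale_cong ode_at_pullback_cong elim(2)) (auto simp: ode_at_def)
    also have "\<dots> = ode_at (ode_rescale \<theta> (ode_pullback r (localize w E'))) t"
      unfolding localize_def
      by (rule ode_at_rescale_cong) (use ode_at_pullback_compose[OF elim(8) c'(1) elim(6) c'(2)] in auto)
    finally show ?case by simp
  qed
  then show thesis using that[of u \<theta>] an\<theta> power_germ_axioms by blast
qed

lemma exponent_diff_sq_lift:
  assumes "rat_lift (heun_ode p) \<eta> R (heun_ode p')" "0 < rat_mult R w z"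
    "par_a p \<noteq> 0" "par_a p \<noteq> 1" "par_a p' \<noteq> 0" "par_a p' \<noteq> 1"
  shows "exponent_diff_sq p z = (of_nat (rat_mult R w z))\<^sup>2 * exponent_diff_sq p' w"
proof -
  obtain u \<theta> where u: "power_germ (rat_mult R w z) u" "\<forall>\<^sub>F t in at 0. \<theta> analytic_on {t}"
    "germ_lift (localize z (heun_ode p)) \<theta> (power_germ.r (rat_mult R w z) u) (localize w (heun_ode p'))"
    by (rule rat_lift_germ_lift[OF assms(1) refl assms(2)])
  obtain A B where E: "regular_singular (localize z (heun_ode p)) A B"
      "indicial_discriminant A B = exponent_diff_sq p z"
    using heun_regular_singular[OF assms(3,4), of z] by blast
  obtain A' B' where E': "regular_singular (localize w (heun_ode p')) A' B'"
      "indicial_discriminant A' B' = exponent_diff_sq p' w"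
    using heun_regular_singular[OF assms(5,6), of w] by blast
  show ?thesis using power_germ.indicial_discriminant_lift[OF u(1,3,2) E(1) E'(1)] E(2) E'(2) by simp
qed

lemma singular_point_lift:
  assumes "rat_lift (heun_ode p) \<eta> R (heun_ode p')" "rat_mult R w z = 1"
    "par_a p \<noteq> 0" "par_a p \<noteq> 1" "par_a p' \<noteq> 0" "par_a p' \<noteq> 1" "singular_point (heun_ode p') w"
  shows "singular_point (heun_ode p) z"
proof -
  obtain u \<theta> where u: "power_germ 1 u" "\<forall>\<^sub>F t in at 0. \<theta> analytic_on {t}"
    "germ_lift (localize z (heun_ode p)) \<theta> (power_germ.r 1 u) (localize w (heun_ode p'))"
    by (rule rat_lift_germ_lift[OF assms(1,2) zero_less_one])
  obtain A B where E: "regular_singular (localize z (heun_ode p)) A B"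
    using heun_regular_singular[OF assms(3,4), of z] by blast
  obtain A' B' where E': "regular_singular (localize w (heun_ode p')) A' B'"
    using heun_regular_singular[OF assms(5,6), of w] by blast
  show ?thesis using power_germ.removable_at_lift[OF u(1,3,2) E E'] assms(7)
    unfolding singular_point_iff by blast
qed

section \<open>Fibres of rational maps\<close>

definition fibre :: "ratmap \<Rightarrow> point \<Rightarrow> point multiset" where
  "fibre R w = image_mset Pt (proots (fibre_poly R w)) +
     replicate_mset (rat_deg R - degree (fibre_poly R w)) Infinity"

lemma size_fibre: "size (fibre R w) = rat_deg R"
  using degree_fibre_poly[of R w] by (simp add: fibre_def size_proots_complex)

lemma count_fibre:
  assumes "coprime (fst R) (snd R)" "0 < rat_deg R"
  shows "count (fibre R w) z = rat_mult R w z"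
proof (cases z)
  case (Pt x)
  have "count (image_mset Pt M) (Pt x) = count M x" for M
    by (induction M) auto
  then show ?thesis using Pt fibre_poly_nz[OF assms] by (simp add: fibre_def)
next
  case Infinity
  have "count (image_mset Pt M) Infinity = 0" for M
    by (rule count_eq_zero_iff[THEN iffD2]) auto
  then show ?thesis using Infinity by (simp add: fibre_def)
qed

lemma set_mset_fibre:
  assumes "coprime (fst R) (snd R)" "0 < rat_deg R"
  shows "z \<in># fibre R w \<longleftrightarrow> 0 < rat_mult R w z"
  by (simp flip: count_fibre[OF assms])

lemma rat_mult_pos_Pt:
  assumes "coprime (fst R) (snd R)" "0 < rat_deg R"
  shows "0 < rat_mult R w (Pt x) \<longleftrightarrow> poly (fibre_poly R w) x = 0"
  using order_root[of "fibre_poly R w" x] fibre_poly_nz[OF assms] by simp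

lemma rat_mult_value_exists:
  assumes "coprime (fst R) (snd R)" "0 < rat_deg R"
  shows "\<exists>w. 0 < rat_mult R w z"
proof (cases z)
  case (Pt x)
  show ?thesis
  proof (cases "poly (snd R) x = 0")
    case True
    then have "0 < rat_mult R Infinity z" using rat_mult_pos_Pt[OF assms, of Infinity x] Pt by simp
    then show ?thesis ..
  next
    case False
    then have "0 < rat_mult R (Pt (poly (fst R) x / poly (snd R) x)) z"
      using rat_mult_pos_Pt[OF assms, of "Pt (poly (fst R) x / poly (snd R) x)" x] Pt by simp
    then show ?thesis ..
  qed
next
  case Infinity
  let ?n = "rat_deg R"
  show ?thesis
  proof (cases "degree (snd R) < ?n")
    case True
    then show ?thesis using Infinity by (intro exI[of _ Infinity]) simp
  next
    case False
    then have n: "degree (snd R) = ?n" by (auto simp: rat_deg_def)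
    define c where "c = coeff (fst R) ?n / coeff (snd R) ?n"
    have "coeff (snd R) ?n \<noteq> 0" using n assms snd_nz by (metis leading_coeff_neq_0)
    then have c: "coeff (fibre_poly R (Pt c)) ?n = 0" by (simp add: c_def)
    have "degree (fibre_poly R (Pt c)) < ?n"
      by (rule ccontr)
         (use c degree_fibre_poly[of R "Pt c"] fibre_poly_nz[OF assms, of "Pt c"] leading_coeff_neq_0 in
          \<open>metis le_neq_implies_less\<close>)
    then show ?thesis using Infinity by (intro exI[of _ "Pt c"]) simp
  qed
qed

lemma rat_mult_filterlim:
  assumes R: "coprime (fst R) (snd R)" "0 < rat_deg R" and m: "0 < rat_mult R w z"
  shows "filterlim (\<lambda>t. cochart w (rat_fun R (chart z t))) (at 0) (at 0)"
proof -
  obtain u where u: "u analytic_on {0}" "u 0 \<noteq> 0" and loc: "\<forall>\<^sub>F t in at 0.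
      poly (snd R) (chart z t) \<noteq> 0 \<longrightarrow> cochart w (rat_fun R (chart z t)) = t ^ rat_mult R w z * u t"
    using rat_mult_local_form[OF R refl m] by blast
  interpret power_germ "rat_mult R w z" u by unfold_locales (use u m in auto)
  have "\<forall>\<^sub>\<infinity>x. poly (snd R) x \<noteq> 0"
    using poly_roots_finite[OF snd_nz[OF R]] by (simp add: eventually_cofinite)
  from eventually_chart_cofinite[OF this, of z] loc
  have ev: "\<forall>\<^sub>F t in at 0. r t = cochart w (rat_fun R (chart z t))"
    by eventually_elim (simp add: r_def)
  have "filterlim r (at 0) (at 0)" using germ_map_r by (simp add: germ_map_def)
  then show ?thesis by (rule filterlim_cong[OF refl refl ev, THEN iffD1])
qed

lemma filterlim_cochart_unique:
  assumes "filterlim (\<lambda>t. cochart w (y t)) (at 0) F" "filterlim (\<lambda>t. cochart w' (y t)) (at 0) F"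
    and "F \<noteq> bot"
  shows "w = w'"
proof -
  have fin: "(y \<longlongrightarrow> c) F" if "filterlim (\<lambda>t. cochart (Pt c) (y t)) (at 0) F" for c
    using that Lim_null[of y c F] by (simp add: filterlim_at)
  have inf: "filterlim y at_infinity F" if "filterlim (\<lambda>t. cochart Infinity (y t)) (at 0) F"
    using that filterlim_inverse_at_iff[of y F] by simp
  have neq: False if "filterlim (\<lambda>t. cochart (Pt c) (y t)) (at 0) F"
    "filterlim (\<lambda>t. cochart Infinity (y t)) (at 0) F" for c
    using not_tendsto_and_filterlim_at_infinity[OF assms(3) fin[OF that(1)] inf[OF that(2)]] .
  show ?thesis
  proof (cases w)
    case w: (Pt c)
    show ?thesis
    proof (cases w')
      case (Pt c')
      have "c = c'" by (rule tendsto_unique[OF assms(3)]; rule fin) (use assms w Pt in auto)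
      then show ?thesis using w Pt by simp
    next
      case Infinity
      have False by (rule neq) (use assms w Infinity in auto)
      then show ?thesis ..
    qed
  next
    case w: Infinity
    show ?thesis
    proof (cases w')
      case (Pt c)
      have False by (rule neq) (use assms w Pt in auto)
      then show ?thesis ..
    qed (use w in simp)
  qed
qed

lemma rat_mult_value_unique:
  assumes "coprime (fst R) (snd R)" "0 < rat_deg R" "0 < rat_mult R w z" "0 < rat_mult R w' z"
  shows "w = w'"
  using filterlim_cochart_unique[OF rat_mult_filterlim[OF assms(1-3)] rat_mult_filterlim[OF assms(1,2,4)]]
  by simp

text \<open>Positive multiplicity at \<open>z\<close> over \<open>w\<close> says that \<open>R\<close> tends to \<open>w\<close> at \<open>z\<close>, and limits compose.\<close>

lemma rat_mult_compose:
  assumes R: "coprime (fst R) (snd R)" "0 < rat_deg R"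
    and R1: "coprime (fst R1) (snd R1)" "0 < rat_deg R1"
    and R2: "coprime (fst R2) (snd R2)" "0 < rat_deg R2"
    and comp: "\<forall>\<^sub>\<infinity>x. rat_fun R x = rat_fun R2 (rat_fun R1 x)"
    and v: "0 < rat_mult R1 v z" and w: "0 < rat_mult R2 w v"
  shows "0 < rat_mult R w z"
proof -
  obtain w' where w': "0 < rat_mult R w' z" using rat_mult_value_exists[OF R] by blast
  have lim: "filterlim (\<lambda>t. cochart w (rat_fun R2 (chart v (cochart v (rat_fun R1 (chart z t)))))) (at 0) (at 0)"
    by (rule filterlim_compose[OF rat_mult_filterlim[OF R2 w] rat_mult_filterlim[OF R1 v]])
  have ev: "\<forall>\<^sub>F t in at 0. cochart w (rat_fun R2 (chart v (cochart v (rat_fun R1 (chart z t))))) =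
      cochart w (rat_fun R (chart z t))"
    using eventually_chart_cofinite[OF comp, of z] by eventually_elim simp
  have "filterlim (\<lambda>t. cochart w (rat_fun R (chart z t))) (at 0) (at 0)"
    using lim by (rule filterlim_cong[OF refl refl ev, THEN iffD1])
  from filterlim_cochart_unique[OF this rat_mult_filterlim[OF R w']] w' show ?thesis by simp
qed

text \<open>A fibre polynomial of a quadratic map, read as a binary quadratic form, has a multiple zero
  if and only if its discriminant vanishes.\<close>

lemma quadratic_critical_value_iff:
  assumes R: "coprime (fst R) (snd R)" "rat_deg R = 2"
  shows "w \<in> critical_values R \<longleftrightarrow>
    (coeff (fibre_poly R w) 1)\<^sup>2 = 4 * coeff (fibre_poly R w) 2 * coeff (fibre_poly R w) 0"
proof -
  let ?f = "fibre_poly R w"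
  have nz: "?f \<noteq> 0" using fibre_poly_nz[OF R(1)] R(2) by simp
  have deg: "degree ?f \<le> 2" using degree_fibre_poly[of R w] R(2) by simp
  then have f: "?f = [:coeff ?f 0, coeff ?f 1, coeff ?f 2:]"
    by (intro poly_eqI) (auto simp: coeff_pCons numeral_2_eq_2 coeff_eq_0 split: nat.splits)
  show ?thesis
  proof
    assume "w \<in> critical_values R"
    then obtain z where z: "2 \<le> rat_mult R w z" by (auto simp: critical_values_def)
    show "(coeff ?f 1)\<^sup>2 = 4 * coeff ?f 2 * coeff ?f 0"
    proof (cases z)
      case (Pt x)
      then have "[:- x, 1:] ^ 2 dvd ?f" using z order_divides by auto
      then obtain k where k: "?f = [:- x, 1:] ^ 2 * k" by (auto simp: dvd_def)
      then have "k \<noteq> 0" using nz by auto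
      then have "degree ?f = 2 + degree k" using k by (simp add: degree_mult_eq degree_power_eq)
      then have "degree k = 0" using deg by simp
      then obtain k0 where "k = [:k0:]" using degree_eq_zeroE by blast
      then have "?f = [:k0 * x\<^sup>2, - 2 * k0 * x, k0:]"
        using k by (simp add: power2_eq_square algebra_simps)
      then show ?thesis by (simp add: power2_eq_square numeral_2_eq_2)
    next
      case Infinity
      then have "degree ?f = 0" using z R(2) by simp
      then show ?thesis by (simp add: coeff_eq_0)
    qed
  next
    assume disc: "(coeff ?f 1)\<^sup>2 = 4 * coeff ?f 2 * coeff ?f 0"
    show "w \<in> critical_values R"
    proof (cases "coeff ?f 2 = 0")
      case True
      then have "?f = [:coeff ?f 0:]" using f disc by simp
      then have "degree ?f = 0" by (metis degree_pCons_0)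
      then have "2 \<le> rat_mult R w Infinity" using R(2) by simp
      then show ?thesis unfolding critical_values_def by blast
    next
      case False
      define x where "x = - coeff ?f 1 / (2 * coeff ?f 2)"
      have "coeff ?f 0 = coeff ?f 2 * x\<^sup>2"
        using False disc by (simp add: x_def power2_eq_square field_simps)
      moreover have "coeff ?f 1 = - 2 * coeff ?f 2 * x" using False by (simp add: x_def)
      ultimately have "?f = [:- x, 1:] ^ 2 * [:coeff ?f 2:]"
        using f by (simp add: power2_eq_square algebra_simps)
      then have "[:- x, 1:] ^ 2 dvd ?f" by (metis dvd_triv_left)
      then have "2 \<le> rat_mult R w (Pt x)" using nz by (simp add: order_divides)
      then show ?thesis unfolding critical_values_def by blast
    qed
  qed
qed

text \<open>The discriminant of \<open>N - c D\<close> is a quadratic polynomial in \<open>c\<close>, with leading coefficient the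
  discriminant of \<open>D\<close>; a drop of its degree makes room for the critical value \<open>\<infinity>\<close>. It does not
  vanish identically, since otherwise there would be infinitely many critical values.\<close>

lemma card_quadratic_critical_values:
  assumes R: "coprime (fst R) (snd R)" "rat_deg R = 2" and fin: "finite (critical_values R)"
  shows "card (critical_values R) \<le> 2"
proof -
  let ?N = "fst R" and ?D = "snd R"
  define q where "q = [:(coeff ?N 1)\<^sup>2 - 4 * coeff ?N 2 * coeff ?N 0,
    4 * (coeff ?N 2 * coeff ?D 0 + coeff ?D 2 * coeff ?N 0) - 2 * coeff ?N 1 * coeff ?D 1,
    (coeff ?D 1)\<^sup>2 - 4 * coeff ?D 2 * coeff ?D 0:]"
  have root: "Pt c \<in> critical_values R \<longleftrightarrow> poly q c = 0" for c
    unfolding quadratic_critical_value_iff[OF R] q_def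
    by (simp add: power2_eq_square algebra_simps)
  have inf: "Infinity \<in> critical_values R \<longleftrightarrow> coeff q 2 = 0"
    unfolding quadratic_critical_value_iff[OF R] q_def by (simp add: numeral_2_eq_2)
  have "q \<noteq> 0"
  proof
    assume "q = 0"
    then have "range Pt \<subseteq> critical_values R" using root by auto
    then have "finite (range Pt)" using fin finite_subset by blast
    then have "finite (UNIV :: complex set)" by (rule finite_imageD) (auto intro: injI)
    then show False using infinite_UNIV_char_0 by blast
  qed
  then have card: "card {c. poly q c = 0} \<le> degree q" by (rule card_poly_roots_bound)
  have deg: "degree q \<le> 2" unfolding q_def by (simp add: degree_pCons_eq_if)
  have sub: "critical_values R \<subseteq> Pt ` {c. poly q c = 0} \<union> (if coeff q 2 = 0 then {Infinity} else {})"
  proof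
    fix w assume "w \<in> critical_values R"
    then show "w \<in> Pt ` {c. poly q c = 0} \<union> (if coeff q 2 = 0 then {Infinity} else {})"
      using root inf by (cases w) auto
  qed
  have fin': "finite {c. poly q c = 0}" using \<open>q \<noteq> 0\<close> by (rule poly_roots_finite)
  have "card (critical_values R) \<le>
      card (Pt ` {c. poly q c = 0} \<union> (if coeff q 2 = 0 then {Infinity} else {}))"
    by (rule card_mono[OF _ sub]) (use fin' in auto)
  also have "\<dots> \<le> card (Pt ` {c. poly q c = 0}) + card (if coeff q 2 = 0 then {Infinity} else {})"
    by (rule card_Un_le)
  also have "\<dots> \<le> degree q + (if coeff q 2 = 0 then 1 else 0)"
    using card_image_le[OF fin', of Pt] card by simp
  also have "\<dots> \<le> 2"
  proof (cases "coeff q 2 = 0")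
    case True
    then have "degree q \<noteq> 2" using \<open>q \<noteq> 0\<close> leading_coeff_0_iff by metis
    then show ?thesis using deg by simp
  qed (use deg in simp)
  finally show ?thesis .
qed

section \<open>Lifts between Heun equations\<close>

lemma finite_heun_points [simp]: "finite (heun_points p)" by (simp add: heun_points_def)

lemma card_heun_points:
  assumes "par_a p \<noteq> 0" "par_a p \<noteq> 1"
  shows "card (heun_points p) = 4"
  using assms by (auto simp: heun_points_def card_insert_if)

locale heun_lifting =
  fixes R :: ratmap and p p' :: heun and \<eta> :: "complex \<Rightarrow> complex"
  assumes lift: "rat_lift (heun_ode p) \<eta> R (heun_ode p')"
    and heun: "heun_equation p" "heun_equation p'"
    and critical: "critical_values R \<subseteq> heun_points p'"
begin

lemma R: "coprime (fst R) (snd R)" "0 < rat_deg R"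
  using lift by (auto simp: rat_lift_def)

lemma par_a: "par_a p \<noteq> 0" "par_a p \<noteq> 1" "par_a p' \<noteq> 0" "par_a p' \<noteq> 1"
  using heun by (auto simp: heun_equation_def)

lemma simple_preimage:
  assumes "w \<in> heun_points p'" "rat_mult R w z = 1"
  shows "z \<in> heun_points p"
  using singular_point_lift[OF lift assms(2) par_a] heun assms(1)
    heun_points_if_singular[OF par_a(1,2)] by (auto simp: heun_equation_iff)

lemma exponent_diff_sq:
  assumes "0 < rat_mult R w z"
  shows "exponent_diff_sq p z = (of_nat (rat_mult R w z))\<^sup>2 * exponent_diff_sq p' w"
  using exponent_diff_sq_lift[OF lift assms par_a] .

lemma fibre_noncritical:
  assumes "w \<notin> critical_values R"
  shows "fibre R w = mset_set (set_mset (fibre R w))" "card (set_mset (fibre R w)) = rat_deg R"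
    "z \<in># fibre R w \<Longrightarrow> rat_mult R w z = 1"
proof -
  have m: "rat_mult R w z \<le> 1" for z
    using assms not_less_eq_eq by (fastforce simp: critical_values_def)
  have *: "count (fibre R w) z = (if z \<in># fibre R w then 1 else 0)" for z
    using m[of z] count_fibre[OF R, of w z] set_mset_fibre[OF R, of z w] by auto
  show eq: "fibre R w = mset_set (set_mset (fibre R w))"
    by (rule multiset_eqI) (simp add: * count_mset_set')
  show "card (set_mset (fibre R w)) = rat_deg R"
    using size_fibre[of R w] arg_cong[OF eq, of size] by simp
  show "z \<in># fibre R w \<Longrightarrow> rat_mult R w z = 1"
    using *[of z] count_fibre[OF R, of w z] by simp
qed

lemma fibre_noncritical_subset:
  assumes "w \<in> heun_points p'" "w \<notin> critical_values R"
  shows "set_mset (fibre R w) \<subseteq> heun_points p"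
  using fibre_noncritical(3)[OF assms(2)] simple_preimage[OF assms(1)] by blast

lemma fibre_disjoint: "w \<noteq> w' \<Longrightarrow> set_mset (fibre R w) \<inter> set_mset (fibre R w') = {}"
  using rat_mult_value_unique[OF R] set_mset_fibre[OF R] by blast

text \<open>Each noncritical singular point has two singular points above it, so at most two singular points are
noncritical, and at least two are critical values. As a quadratic map has at most two critical values, both
counts are exact, and the noncritical fibres exhaust the singular points upstairs. The point over a
critical value is then ordinary, with exponent difference \<open>1\<close>, which makes the one below it \<open>1/2\<close>.\<close>

lemma quadratic_lift_structure:
  assumes deg: "rat_deg R = 2"
  obtains c1 c2 c3 c4 where "heun_points p' = {c1, c2, c3, c4}" "distinct [c1, c2, c3, c4]"
    "exponent_diff_sq p' c1 = 1/4" "exponent_diff_sq p' c2 = 1/4"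
    "card (set_mset (fibre R c3)) = 2" "card (set_mset (fibre R c4)) = 2"
    "set_mset (fibre R c3) \<inter> set_mset (fibre R c4) = {}"
    "heun_points p = set_mset (fibre R c3) \<union> set_mset (fibre R c4)"
    "\<And>c z. c \<in> {c3, c4} \<Longrightarrow> z \<in># fibre R c \<Longrightarrow> rat_mult R c z = 1"
proof -
  let ?K = "critical_values R"
  have card4: "card (heun_points p) = 4" "card (heun_points p') = 4"
    using card_heun_points par_a by auto
  have fin: "finite ?K" using critical finite_subset finite_heun_points by blast
  have K2: "card ?K \<le> 2" by (rule card_quadratic_critical_values[OF R(1) deg fin])
  let ?N = "heun_points p' - ?K"
  have N: "card ?N = 4 - card ?K" using card_Diff_subset[OF fin critical] card4 by simp
  have sub: "(\<Union>w\<in>?N. set_mset (fibre R w)) \<subseteq> heun_points p"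
    using fibre_noncritical_subset by blast
  have "card (\<Union>w\<in>?N. set_mset (fibre R w)) = (\<Sum>w\<in>?N. card (set_mset (fibre R w)))"
    by (rule card_UN_disjoint) (auto simp: fibre_disjoint)
  also have "\<dots> = (\<Sum>w\<in>?N. 2)" using fibre_noncritical(2) deg by (intro sum.cong) auto
  finally have U: "card (\<Union>w\<in>?N. set_mset (fibre R w)) = 2 * card ?N" by simp
  then have "2 * card ?N \<le> 4" using card_mono[OF _ sub] card4 by simp
  then have K: "card ?K = 2" "card ?N = 2" using K2 N by auto
  obtain c1 c2 where c12: "?K = {c1, c2}" "c1 \<noteq> c2" using K(1) by (auto simp: card_2_iff)
  obtain c3 c4 where c34: "?N = {c3, c4}" "c3 \<noteq> c4" using K(2) by (auto simp: card_2_iff)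
  have "(\<Union>w\<in>?N. set_mset (fibre R w)) = heun_points p"
    by (rule card_subset_eq[OF _ sub]) (use U K card4 in auto)
  then have all: "heun_points p = set_mset (fibre R c3) \<union> set_mset (fibre R c4)" using c34 by auto
  have D: "exponent_diff_sq p' c = 1/4" if "c \<in> ?K" for c
  proof -
    obtain z where z: "2 \<le> rat_mult R c z" using \<open>c \<in> ?K\<close> by (auto simp: critical_values_def)
    have "count (fibre R c) z \<le> size (fibre R c)" by (rule count_le_size)
    then have m: "rat_mult R c z = 2" using z by (simp add: count_fibre[OF R] size_fibre deg)
    have "z \<notin> heun_points p"
    proof
      assume "z \<in> heun_points p"
      then obtain c' where "c' \<in> ?N" "z \<in># fibre R c'" using all c34 by blast
      then show False
        using rat_mult_value_unique[OF R, of c z c'] m set_mset_fibre[OF R] \<open>c \<in> ?K\<close> by auto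
    qed
    then show ?thesis
      using exponent_diff_sq[of c z] exponent_diff_sq_ordinary[of z p] m by (simp add: mult.commute)
  qed
  show thesis
  proof (rule that)
    show "heun_points p' = {c1, c2, c3, c4}" using c12 c34 critical by auto
    show "distinct [c1, c2, c3, c4]" using c12 c34 by auto
    show "heun_points p = set_mset (fibre R c3) \<union> set_mset (fibre R c4)" by (rule all)
    show "set_mset (fibre R c3) \<inter> set_mset (fibre R c4) = {}" using fibre_disjoint c34(2) by blast
    have "c3 \<notin> ?K" "c4 \<notin> ?K" using c34 by auto
    then show "card (set_mset (fibre R c3)) = 2" "card (set_mset (fibre R c4)) = 2"
      "\<And>c z. c \<in> {c3, c4} \<Longrightarrow> z \<in># fibre R c \<Longrightarrow> rat_mult R c z = 1"
      using fibre_noncritical deg by auto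
  qed (use D c12 in auto)
qed

end

lemma heun_lifting_intro:
  assumes "heun_lift R p p' (\<lambda>x. \<Sum>c\<in>C. \<kappa> c / (x - c))" "finite C" "0 < rat_deg R"
  shows "heun_lifting R p p' (\<lambda>x. \<Sum>c\<in>C. \<kappa> c / (x - c))"
proof
  show "rat_lift (heun_ode p) (\<lambda>x. \<Sum>c\<in>C. \<kappa> c / (x - c)) R (heun_ode p')"
    using assms by (intro rat_lift_sum) (auto simp: heun_lift_def ode_at_def)
qed (use assms in \<open>auto simp: heun_lift_def\<close>)

text \<open>The singular points of the intermediate equation form two pairs in two ways: the two fibres of the second
map, and the critical values \<open>v1, v2\<close> versus the noncritical ones \<open>u1, u2\<close> of the first map. If the two
partitions agree, then, as \<open>0\<close> lies over \<open>u1\<close> or \<open>u2\<close>, the pair \<open>u1, u2\<close> lies over \<open>0\<close>, and with it all singular points upstairs. Otherwise each fibre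
contains some \<open>v1\<close> or \<open>v2\<close>, where the exponent difference is \<open>1/2\<close>, and passes this value down.\<close>

lemma biquadratic_fibre:
  assumes "biquadratic R p p'" "0 < rat_mult R (Pt 0) (Pt 0)"
  shows "(\<forall>z \<in> heun_points p. 0 < rat_mult R (Pt 0) z) \<or>
    (\<forall>w \<in> heun_points p'. exponent_diff_sq p' w = 1/4)"
proof -
  obtain C \<kappa> R1 R2 p1 C1 \<kappa>1 C2 \<kappa>2 where d: "rat_deg R = 4" "rat_deg R1 = 2" "rat_deg R2 = 2"
    and C: "finite C" "finite C1" "finite C2"
    and L: "heun_lift R p p' (\<lambda>x. \<Sum>c\<in>C. \<kappa> c / (x - c))"
      "heun_lift R1 p p1 (\<lambda>x. \<Sum>c\<in>C1. \<kappa>1 c / (x - c))"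
      "heun_lift R2 p1 p' (\<lambda>x. \<Sum>c\<in>C2. \<kappa>2 c / (x - c))"
    and comp: "\<forall>\<^sub>\<infinity>x. rat_fun R x = rat_fun R2 (rat_fun R1 x)"
    using assms(1) unfolding biquadratic_def heun_transformation_def by blast
  interpret L: heun_lifting R p p' "\<lambda>x. \<Sum>c\<in>C. \<kappa> c / (x - c)"
    by (rule heun_lifting_intro) (use L C d in auto)
  interpret L1: heun_lifting R1 p p1 "\<lambda>x. \<Sum>c\<in>C1. \<kappa>1 c / (x - c)"
    by (rule heun_lifting_intro) (use L C d in auto)
  interpret L2: heun_lifting R2 p1 p' "\<lambda>x. \<Sum>c\<in>C2. \<kappa>2 c / (x - c)"
    by (rule heun_lifting_intro) (use L C d in auto)
  obtain c1 c2 c3 c4 where c: "heun_points p' = {c1, c2, c3, c4}" "distinct [c1, c2, c3, c4]"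
    "exponent_diff_sq p' c1 = 1/4" "exponent_diff_sq p' c2 = 1/4"
    and c34: "card (set_mset (fibre R2 c3)) = 2" "card (set_mset (fibre R2 c4)) = 2"
      "set_mset (fibre R2 c3) \<inter> set_mset (fibre R2 c4) = {}"
      "heun_points p1 = set_mset (fibre R2 c3) \<union> set_mset (fibre R2 c4)"
      "\<And>c z. c \<in> {c3, c4} \<Longrightarrow> z \<in># fibre R2 c \<Longrightarrow> rat_mult R2 c z = 1"
    using L2.quadratic_lift_structure[OF d(3)] by metis
  obtain v1 v2 u1 u2 where v: "heun_points p1 = {v1, v2, u1, u2}" "distinct [v1, v2, u1, u2]"
    "exponent_diff_sq p1 v1 = 1/4" "exponent_diff_sq p1 v2 = 1/4"
    and u: "heun_points p = set_mset (fibre R1 u1) \<union> set_mset (fibre R1 u2)"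
    using L1.quadratic_lift_structure[OF d(2)] by metis
  have over: "0 < rat_mult R c z" if "z \<in># fibre R1 v" "v \<in># fibre R2 c" for z v c
    using rat_mult_compose[OF L.R L1.R L2.R comp] that set_mset_fibre[OF L1.R] set_mset_fibre[OF L2.R]
    by blast
  have down: "exponent_diff_sq p' c = 1/4" if "c \<in> {c3, c4}" "x \<in># fibre R2 c" "x = v1 \<or> x = v2" for c x
    using L2.exponent_diff_sq[of c x] c34(5)[OF that(1,2)] that(3) v(3,4) by auto
  have "Pt 0 \<in> heun_points p" by (simp add: heun_points_def)
  then obtain y where y: "y = u1 \<or> y = u2" "Pt 0 \<in># fibre R1 y" using u by auto
  then have "y \<in> heun_points p1" using v(1) by auto
  then obtain c0 where c0: "c0 \<in> {c3, c4}" "y \<in># fibre R2 c0" using c34(4) by auto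
  have "c0 = Pt 0"
    using over[OF y(2) c0(2)] rat_mult_value_unique[OF L.R _ assms(2)] by blast
  show ?thesis
  proof (cases "u1 \<in># fibre R2 c0 \<and> u2 \<in># fibre R2 c0")
    case True
    then have "\<forall>z \<in> heun_points p. 0 < rat_mult R (Pt 0) z"
      using u over \<open>c0 = Pt 0\<close> by blast
    then show ?thesis ..
  next
    case False
    have half: "exponent_diff_sq p' c' = 1/4" if c': "c' \<in> {c3, c4}" for c'
    proof -
      obtain a b where ab: "set_mset (fibre R2 c') = {a, b}" "a \<noteq> b"
        using c' c34(1,2) by (auto simp: card_2_iff)
      have "\<not> {a, b} \<subseteq> {u1, u2}"
      proof
        assume "{a, b} \<subseteq> {u1, u2}"
        then have "set_mset (fibre R2 c') = {u1, u2}" using ab by auto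
        moreover from this have "c' = c0"
          using y(1) c0 rat_mult_value_unique[OF L2.R] set_mset_fibre[OF L2.R] by blast
        ultimately show False using False by auto
      qed
      moreover have "{a, b} \<subseteq> {v1, v2, u1, u2}" using ab c34(4) c' v(1) by auto
      ultimately obtain x where "x \<in> {a, b}" "x = v1 \<or> x = v2" by auto
      then show ?thesis using down[OF c', of x] ab(1) by auto
    qed
    then show ?thesis using c by auto
  qed
qed

lemma all_exponent_differences_half_iff:
  assumes "par_a p \<noteq> 0" "par_a p \<noteq> 1"
  shows "all_exponent_differences_half p \<longleftrightarrow> (\<forall>w \<in> heun_points p. exponent_diff_sq p w = 1/4)"
proof -
  have "d = 1/2 \<or> d = - 1/2 \<longleftrightarrow> d\<^sup>2 = 1/4" for d :: complex
    using power2_eq_iff[of d "1/2"] by (simp add: power2_eq_square)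
  then show ?thesis
    unfolding all_exponent_differences_half_def heun_points_def using assms by simp
qed

text \<open>The fibre over \<open>0\<close> has at most four points, and it contains all singular points upstairs, or consists of
four singular points; in either case it is the set of singular points. A point over another singular
value is thus ordinary, so it must be ramified, and \<open>1\<close> is its multiplicity times the exponent difference
below.\<close>

lemma (in heun_lifting) quartic_fibres:
  assumes deg: "rat_deg R = 4"
    and "(\<forall>z \<in> heun_points p. 0 < rat_mult R (Pt 0) z) \<or> Pt 0 \<notin> critical_values R"
  shows "\<And>z. 0 < rat_mult R (Pt 0) z \<longleftrightarrow> z \<in> heun_points p"
    "\<And>z. z \<in> heun_points p \<Longrightarrow> rat_mult R (Pt 0) z = 1"
    "\<And>z w. w \<in> heun_points p' \<Longrightarrow> w \<noteq> Pt 0 \<Longrightarrow> 0 < rat_mult R w z \<Longrightarrow>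
       2 \<le> rat_mult R w z \<and> z \<notin> heun_points p \<and> (of_nat (rat_mult R w z))\<^sup>2 * exponent_diff_sq p' w = 1"
proof -
  have card4: "card (heun_points p) = 4" using card_heun_points par_a by auto
  have 0: "Pt 0 \<in> heun_points p'" by (simp add: heun_points_def)
  have size: "size (fibre R (Pt 0)) = 4" by (simp add: size_fibre deg)
  have set: "set_mset (fibre R (Pt 0)) = heun_points p"
  proof (cases "Pt 0 \<in> critical_values R")
    case True
    then have "heun_points p \<subseteq> set_mset (fibre R (Pt 0))"
      using assms(2) set_mset_fibre[OF R] by auto
    moreover have "card (set_mset (fibre R (Pt 0))) \<le> 4"
      using size size_mset_mono[OF mset_set_set_mset_msubset, of "fibre R (Pt 0)"] by simp
    ultimately show ?thesis using card4 by (metis card_seteq finite_set_mset)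
  next
    case False
    then show ?thesis
      using fibre_noncritical_subset[OF 0] fibre_noncritical(2) deg card4
      by (metis card_subset_eq finite_heun_points)
  qed
  have eq: "mset_set (heun_points p) = fibre R (Pt 0)"
  proof (rule ccontr)
    assume "mset_set (heun_points p) \<noteq> fibre R (Pt 0)"
    then have "mset_set (heun_points p) \<subset># fibre R (Pt 0)"
      using mset_set_set_mset_msubset[of "fibre R (Pt 0)"] set by (simp add: subset_mset.less_le)
    then show False using mset_subset_size size card4 by fastforce
  qed
  show pos: "0 < rat_mult R (Pt 0) z \<longleftrightarrow> z \<in> heun_points p" for z
    using set set_mset_fibre[OF R, of z "Pt 0"] by simp
  show "rat_mult R (Pt 0) z = 1" if "z \<in> heun_points p" for z
    using that by (simp flip: eq count_fibre[OF R])
  show "2 \<le> rat_mult R w z \<and> z \<notin> heun_points p \<and> (of_nat (rat_mult R w z))\<^sup>2 * exponent_diff_sq p' w = 1"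
    if w: "w \<in> heun_points p'" "w \<noteq> Pt 0" and z: "0 < rat_mult R w z" for w z
  proof -
    have nz: "z \<notin> heun_points p" using rat_mult_value_unique[OF R z, of "Pt 0"] pos[of z] w(2) by auto
    then have "rat_mult R w z \<noteq> 1" using simple_preimage[OF w(1)] by blast
    then show ?thesis
      using z nz exponent_diff_sq[OF z] exponent_diff_sq_ordinary[OF nz] by simp
  qed
qed

section \<open>Normal form of the quartic map\<close>

lemma poly_eq_pointwise: "(\<And>x. poly p x = poly q x) \<Longrightarrow> p = q" for p q :: "complex poly"
  by (metis ext poly_eq_poly_eq_iff)

lemma poly_linear_factor: "poly [:- c, 1:] x = x - c" for c :: complex
  by simp

text \<open>Order \<open>3\<close> would leave a simple root.\<close>

lemma quartic_poly_square:
  fixes f :: "complex poly"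
  assumes deg: "degree f = 4" and roots: "\<And>x. poly f x = 0 \<Longrightarrow> 2 \<le> order x f"
  obtains g where "f = g\<^sup>2" "degree g = 2"
proof -
  have nz: "f \<noteq> 0" using deg by auto
  have size: "size (proots f) = 4" using deg by (simp add: size_proots_complex)
  have ord: "order x f \<in> {2, 4}" if "poly f x = 0" for x
  proof -
    have "order x f \<noteq> 3"
    proof
      assume 3: "order x f = 3"
      then have sub: "replicate_mset 3 x \<subseteq># proots f"
        using nz by (simp flip: count_le_replicate_mset_subset_eq)
      then have "size (proots f - replicate_mset 3 x) = 1"
        using size by (simp add: size_Diff_submset)
      then obtain y where y: "proots f - replicate_mset 3 x = {#y#}"
        using size_1_singleton_mset by blast
      have eq: "proots f = add_mset y (replicate_mset 3 x)"
        using subset_mset.add_diff_inverse[OF sub] y by simp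
      have "count (proots f) x = 3" using 3 nz by simp
      then have "y \<noteq> x" using eq by auto
      then have "count (proots f) y = 1" using eq by simp
      then have "order y f = 1" using nz by simp
      moreover from this have "poly f y = 0" using order_root by force
      ultimately show False using roots[of y] by simp
    qed
    moreover have "order x f \<le> 4" using order_degree[OF nz, of x] deg by simp
    ultimately show ?thesis using roots[OF that] by auto
  qed
  define g where "g = smult (csqrt (lead_coeff f)) (\<Prod>x | poly f x = 0. [:- x, 1:] ^ (order x f div 2))"
  have "g\<^sup>2 = smult (lead_coeff f) (\<Prod>x | poly f x = 0. ([:- x, 1:] ^ (order x f div 2))\<^sup>2)"
    by (simp add: g_def smult_power prod_power_distrib)
  also have "(\<Prod>x | poly f x = 0. ([:- x, 1:] ^ (order x f div 2))\<^sup>2) =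
      (\<Prod>x | poly f x = 0. [:- x, 1:] ^ order x f)"
  proof (rule prod.cong)
    fix x assume "x \<in> {x. poly f x = 0}"
    then have "order x f div 2 * 2 = order x f" using ord[of x] by auto
    then show "([:- x, 1:] ^ (order x f div 2))\<^sup>2 = [:- x, 1:] ^ order x f" by (simp flip: power_mult)
  qed simp
  finally have "f = g\<^sup>2" using complex_poly_decompose[of f] by simp
  moreover from this have "degree g = 2" using deg by (cases "g = 0") (auto simp: degree_power_eq)
  ultimately show thesis using that by blast
qed

lemma order_square_of_quadratic:
  fixes c b k :: complex
  assumes f: "f = smult k ([:c, b, 1:]\<^sup>2)" and "k \<noteq> 0" "b\<^sup>2 \<noteq> 4 * c" and z: "poly f z = 0"
  shows "order z f = 2"
proof -
  let ?g = "[:c, b, 1:]"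
  have root: "poly ?g z = 0" using z assms(2) by (simp add: f)
  have "b + 2 * z \<noteq> 0"
  proof
    assume "b + 2 * z = 0"
    then have "b = - 2 * z" by (simp add: eq_neg_iff_add_eq_0)
    then show False using root assms(3) by (simp add: power2_eq_square algebra_simps)
  qed
  then have "poly (pderiv ?g) z \<noteq> 0" by (simp add: pderiv_pCons algebra_simps)
  then have "order z ?g = 1"
    using rsquarefree_root_order[of ?g z] root order_pderiv[of ?g z]
    by (metis One_nat_def order_0I order_root pCons_eq_0_iff zero_neq_one)
  moreover have "order z (?g\<^sup>2) = order z ?g + order z ?g"
    unfolding power2_eq_square by (rule order_mult) simp
  ultimately have "order z (?g\<^sup>2) = 2" by linarith
  then show ?thesis unfolding f order_smult[OF assms(2)] .
qed

text \<open>The ways to write \<open>{0, 1, a}\<close> as \<open>{r, s, t}\<close>.\<close>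

definition finite_points_perm :: "complex \<Rightarrow> complex \<Rightarrow> complex \<Rightarrow> complex \<Rightarrow> bool" where
  "finite_points_perm a r s t \<longleftrightarrow>
     (r, s, t) \<in> {(0, 1, a), (0, a, 1), (1, 0, a), (1, a, 0), (a, 0, 1), (a, 1, 0)}"

lemma finite_points_perm_swap: "finite_points_perm a r s t \<Longrightarrow> finite_points_perm a r t s"
  by (auto simp: finite_points_perm_def)

lemma finite_points_perm_distinct:
  assumes "finite_points_perm a r s t" "a \<noteq> 0" "a \<noteq> 1"
  shows "r \<noteq> s" "r \<noteq> t" "s \<noteq> t"
  using assms by (auto simp: finite_points_perm_def)

lemma finite_points_perm_prod:
  "finite_points_perm a r s t \<Longrightarrow> (x - r) * (x - s) * (x - t) = x * (x - 1) * (x - a)"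
  by (auto simp: finite_points_perm_def)

lemma factor_cubic:
  fixes A B :: "complex poly"
  assumes AB: "\<And>x. poly A x * poly B x = n * (x * (x - 1) * (x - a))" and n: "n \<noteq> 0"
    and deg: "degree A = 1"
  obtains r s t u v where "finite_points_perm a r s t" "n = u * v" "u \<noteq> 0" "v \<noteq> 0"
    "\<And>x. poly A x = u * (x - r)" "\<And>x. poly B x = v * ((x - s) * (x - t))"
proof -
  have A: "A = [:coeff A 0, coeff A 1:]"
    by (rule poly_eqI) (use deg in \<open>auto simp: coeff_pCons coeff_eq_0 split: nat.splits\<close>)
  define u where "u = coeff A 1"
  have u: "u \<noteq> 0" using deg leading_coeff_0_iff[of A] by (auto simp: u_def)
  define r where "r = - coeff A 0 / u"
  have Ax: "poly A x = u * (x - r)" for x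
    by (subst A) (use u in \<open>simp add: r_def u_def field_simps\<close>)
  have "n * (r * (r - 1) * (r - a)) = 0" using AB[of r] Ax[of r] by simp
  then have "r = 0 \<or> r = 1 \<or> r = a" using n by auto
  then obtain s t where st: "finite_points_perm a r s t"
    unfolding finite_points_perm_def by blast
  have eq: "[:- r, 1:] * B = [:- r, 1:] * smult (n / u) ([:- s, 1:] * [:- t, 1:])"
  proof (rule poly_eq_pointwise)
    fix x
    have "u * ((x - r) * poly B x) = n * ((x - r) * (x - s) * (x - t))"
      using AB[of x] Ax[of x] finite_points_perm_prod[OF st, of x] by (simp add: mult.assoc)
    then have "(x - r) * poly B x = n * ((x - r) * (x - s) * (x - t)) / u"
      using u by (simp add: eq_divide_eq mult.commute)
    also have "\<dots> = (x - r) * (n / u * ((x - s) * (x - t)))" by simp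
    finally show "poly ([:- r, 1:] * B) x = poly ([:- r, 1:] * smult (n / u) ([:- s, 1:] * [:- t, 1:])) x"
      by (simp only: poly_mult poly_smult poly_linear_factor)
  qed
  have "[:- r, 1:] \<noteq> 0" by simp
  then have "B = smult (n / u) ([:- s, 1:] * [:- t, 1:])" using eq mult_left_cancel by blast
  then have "poly B x = n / u * ((x - s) * (x - t))" for x
    by (simp only: poly_mult poly_smult poly_linear_factor)
  then show thesis using that[of r s t u "n / u"] st u n Ax by simp
qed

text \<open>The factors \<open>D - F\<close> and \<open>D + F\<close> have degree at most \<open>2\<close> and a cubic product, so one of them is linear.\<close>

lemma quadratic_sum_of_factors:
  fixes D F :: "complex poly"
  assumes sq: "\<And>x. (poly D x)\<^sup>2 - (poly F x)\<^sup>2 = n * (x * (x - 1) * (x - a))" and n: "n \<noteq> 0"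
    and deg: "degree D = 2"
  obtains r s t u v where "finite_points_perm a r s t" "n = u * v" "u \<noteq> 0" "v \<noteq> 0"
    "\<And>x. 2 * poly D x = u * (x - r) + v * ((x - s) * (x - t))"
proof -
  let ?A = "D - F" and ?B = "D + F"
  have AB: "poly ?A x * poly ?B x = n * (x * (x - 1) * (x - a))" for x
    using sq[of x] by (simp add: power2_eq_square algebra_simps)
  have "?A * ?B = smult n [:0, a, - (1 + a), 1:]"
    by (rule poly_eq_pointwise) (simp only: poly_mult AB, simp add: algebra_simps power2_eq_square)
  then have "degree (?A * ?B) = 3" using n by simp
  moreover from this have "?A \<noteq> 0" "?B \<noteq> 0" by auto
  ultimately have sum: "degree ?A + degree ?B = 3" using degree_mult_eq by metis
  have F: "degree F \<le> 2"
  proof (rule ccontr)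
    assume "\<not> degree F \<le> 2"
    then have "degree ?A = degree F" "degree ?B = degree F"
      using deg degree_add_eq_right[of D "- F"] degree_add_eq_right[of D F] by auto
    then show False using sum by presburger
  qed
  have "degree ?A \<le> 2" "degree ?B \<le> 2"
    using deg F by (auto intro: degree_diff_le degree_add_le)
  then consider "degree ?A = 1" | "degree ?B = 1" using sum by linarith
  then show thesis
  proof cases
    case 1
    from factor_cubic[OF AB n 1] obtain r s t u v where f: "finite_points_perm a r s t" "n = u * v"
      "u \<noteq> 0" "v \<noteq> 0" "\<And>x. poly ?A x = u * (x - r)" "\<And>x. poly ?B x = v * ((x - s) * (x - t))" by metis
    have "2 * poly D x = u * (x - r) + v * ((x - s) * (x - t))" for x
      using f(5,6)[of x] by (simp flip: f(5,6))
    then show thesis using that f by blast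
  next
    case 2
    have BA: "poly ?B x * poly ?A x = n * (x * (x - 1) * (x - a))" for x
      using AB[of x] by (simp only: mult.commute)
    from factor_cubic[OF BA n 2] obtain r s t u v where f: "finite_points_perm a r s t" "n = u * v"
      "u \<noteq> 0" "v \<noteq> 0" "\<And>x. poly ?B x = u * (x - r)" "\<And>x. poly ?A x = v * ((x - s) * (x - t))" by metis
    have "2 * poly D x = u * (x - r) + v * ((x - s) * (x - t))" for x
      by (simp flip: f(5,6))
    then show thesis using that f by blast
  qed
qed

text \<open>If \<open>D\<^sup>2\<close>, \<open>D\<^sup>2 - N\<close> and \<open>a' D\<^sup>2 - N\<close> are squares with \<open>N\<close> a multiple of \<open>x (x - 1) (x - a)\<close>, then
  \<open>N = (D - F) (D + F)\<close> splits as a linear times a quadratic factor with sum \<open>2 D\<close>, and likewise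
  for the third square. The two expressions for \<open>2 D\<close> have different linear factors, and comparing
  their values at the roots of these leaves one solution, up to a scalar, for each ordering of
  \<open>{0, 1, a}\<close>.\<close>

lemma three_squares:
  fixes D F G :: "complex poly"
  assumes a: "a \<noteq> 0" "a \<noteq> 1" and a': "a' \<noteq> 0" "a' \<noteq> 1" and n: "n \<noteq> 0" and deg: "degree D = 2"
    and F: "\<And>x. (poly D x)\<^sup>2 - (poly F x)\<^sup>2 = n * (x * (x - 1) * (x - a))"
    and G: "\<And>x. (poly D x)\<^sup>2 - (poly G x)\<^sup>2 = n / a' * (x * (x - 1) * (x - a))"
  obtains r s t v where "finite_points_perm a r s t" "v \<noteq> 0" "n = v\<^sup>2 * (s - t)" "a' = (s - t) / (r - t)"
    "\<And>x. 2 * poly D x = v * (x\<^sup>2 - 2 * t * x + (r * t - r * s + s * t))"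
proof -
  obtain r s t u v where f: "finite_points_perm a r s t" "n = u * v" "u \<noteq> 0" "v \<noteq> 0"
    "\<And>x. 2 * poly D x = u * (x - r) + v * ((x - s) * (x - t))"
    using quadratic_sum_of_factors[OF F n deg] by metis
  obtain r' s' t' u' v' where g: "finite_points_perm a r' s' t'" "n / a' = u' * v'" "u' \<noteq> 0" "v' \<noteq> 0"
    "\<And>x. 2 * poly D x = u' * (x - r') + v' * ((x - s') * (x - t'))"
    using quadratic_sum_of_factors[OF G _ deg] n a' by (metis divide_eq_0_iff)
  have eq: "u * (x - r) + v * ((x - s) * (x - t)) = u' * (x - r') + v' * ((x - s') * (x - t'))" for x
    using f(5) g(5) by metis
  have "v = v'"
  proof -
    have "2 * v = 2 * v'" using eq[of 0] eq[of 1] eq[of "- 1"] by algebra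
    then show ?thesis by simp
  qed
  have "r \<noteq> r'"
  proof
    assume "r = r'"
    then have "(s' = s \<and> t' = t) \<or> (s' = t \<and> t' = s)"
      using f(1) g(1) a by (auto simp: finite_points_perm_def)
    then have "u * (x - r) = u' * (x - r)" for x
      using eq[of x] \<open>v = v'\<close> \<open>r = r'\<close> by auto
    from this[of "r + 1"] have "u = u'" by simp
    then have "n / a' = n" using f(2) g(2) \<open>v = v'\<close> by simp
    then show False using n a' by (simp add: field_simps)
  qed
  note result = that
  have fin: thesis if P: "finite_points_perm a r s t"
    and D: "\<And>x. 2 * poly D x = u * (x - r) + v * ((x - s) * (x - t))"
    and e: "\<And>x. u * (x - r) + v * ((x - s) * (x - t)) = u' * (x - s) + v * ((x - r) * (x - t))" for s t
  proof -
    have ne: "r \<noteq> s" "r \<noteq> t" "s \<noteq> t" using finite_points_perm_distinct[OF P a] .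
    have "v * ((r - t) * (r - s)) = u' * (r - s)" using e[of r] by (simp add: algebra_simps)
    then have u': "u' = v * (r - t)" using ne by (metis mult.assoc mult_right_cancel right_minus_eq)
    have "u * (s - r) = v * ((s - r) * (s - t))" using e[of s] by simp
    then have "u * (s - r) = v * (s - t) * (s - r)" by (simp add: algebra_simps)
    then have u: "u = v * (s - t)" using ne by simp
    have "n = v\<^sup>2 * (s - t)" using f(2) u by (simp add: power2_eq_square)
    moreover have "n / a' = v\<^sup>2 * (r - t)" using g(2) u' \<open>v = v'\<close> by (simp add: power2_eq_square)
    moreover have "n = n / a' * a'" using a' by simp
    ultimately have "v\<^sup>2 * (s - t) = v\<^sup>2 * (a' * (r - t))" by (metis mult.assoc mult.commute)
    then have "s - t = a' * (r - t)" using f(4) by simp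
    then have "a' = (s - t) / (r - t)" using ne by simp
    moreover have "2 * poly D x = v * (x\<^sup>2 - 2 * t * x + (r * t - r * s + s * t))" for x
      unfolding D u by (simp add: power2_eq_square algebra_simps)
    ultimately show thesis using result P f(4) \<open>n = v\<^sup>2 * (s - t)\<close> by simp
  qed
  have "(r' = s \<and> {s', t'} = {r, t}) \<or> (r' = t \<and> {s', t'} = {r, s})"
    using f(1) g(1) a \<open>r \<noteq> r'\<close> by (auto simp: finite_points_perm_def)
  then show thesis
  proof
    assume h: "r' = s \<and> {s', t'} = {r, t}"
    have "(x - s') * (x - t') = (x - r) * (x - t)" for x
      using h by (auto simp: doubleton_eq_iff)
    then show thesis using fin[OF f(1,5)] eq h \<open>v = v'\<close> by simp
  next
    assume h: "r' = t \<and> {s', t'} = {r, s}"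
    have "(x - s') * (x - t') = (x - r) * (x - s)" for x
      using h by (auto simp: doubleton_eq_iff)
    then show thesis
      using fin[OF finite_points_perm_swap[OF f(1)]] f(5) eq h \<open>v = v'\<close> by (simp add: mult.commute)
  qed
qed

text \<open>The fibre polynomials over \<open>1\<close>, \<open>a'\<close> and \<open>\<infinity>\<close> have only multiple roots, hence are squares, which
\<open>three_squares\<close> solves. That the multiplicities are \<open>2\<close> rather than \<open>4\<close>, and the exponent differences
\<open>1/2\<close> rather than \<open>1/4\<close>, is seen afterwards from the discriminants of the three quadratic
square roots.\<close>

lemma (in heun_lifting) quartic_normal_form:
  assumes deg: "rat_deg R = 4"
    and unram: "(\<forall>z \<in> heun_points p. 0 < rat_mult R (Pt 0) z) \<or> Pt 0 \<notin> critical_values R"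
  obtains r s t v where "finite_points_perm (par_a p) r s t" "v \<noteq> 0" "par_a p' = (s - t) / (r - t)"
    "\<And>x. poly (fst R) x = v\<^sup>2 * (s - t) * (x * (x - 1) * (x - par_a p))"
    "snd R = smult (v\<^sup>2 / 4) ([:r * t - r * s + s * t, - 2 * t, 1:]\<^sup>2)"
    "\<And>w. w \<in> heun_points p' \<Longrightarrow> w \<noteq> Pt 0 \<Longrightarrow> exponent_diff_sq p' w = 1/4"
    "\<And>z. z \<in> heun_points p \<Longrightarrow> exponent_diff_sq p z = exponent_diff_sq p' (Pt 0)"
proof -
  let ?a = "par_a p" and ?a' = "par_a p'"
  note fib = quartic_fibres[OF deg unram]
  have root0: "poly (fst R) x = 0" if "x \<in> {0, 1, ?a}" for x
    using fib(1)[of "Pt x"] rat_mult_pos_Pt[OF R, of "Pt 0" x] that by (auto simp: heun_points_def)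
  have N: "degree (fst R) < 4"
    using fib(1)[of Infinity] deg by (auto simp: heun_points_def)
  obtain k1 where k1: "fst R = [:- 0, 1:] * k1" using root0[of 0] by (metis dvdE insertCI poly_eq_0_iff_dvd)
  have "poly k1 1 = 0" using root0[of 1] k1 by simp
  then obtain k2 where k2: "k1 = [:- 1, 1:] * k2" by (metis dvdE poly_eq_0_iff_dvd)
  have "poly k2 ?a = 0" using root0[of ?a] k1 k2 par_a by simp
  then obtain k3 where k3: "k2 = [:- ?a, 1:] * k3" by (metis dvdE poly_eq_0_iff_dvd)
  have nzN: "fst R \<noteq> 0" using fibre_poly_nz[OF R, of "Pt 0"] by simp
  have nz1: "k1 \<noteq> 0" using nzN unfolding k1 by (metis mult_zero_right)
  have nz2: "k2 \<noteq> 0" using nz1 unfolding k2 by (metis mult_zero_right)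
  have nz3: "k3 \<noteq> 0" using nz2 unfolding k3 by (metis mult_zero_right)
  have "degree ([:- c, 1:] * q) = 1 + degree q" if "q \<noteq> 0" for c and q :: "complex poly"
    using that by (subst degree_mult_eq) auto
  note d = this
  have "degree (fst R) = 3 + degree k3"
    unfolding k1 d[OF nz1] unfolding k2 d[OF nz2] unfolding k3 d[OF nz3] by simp
  then have "degree k3 = 0" using N by simp
  then obtain n where n: "k3 = [:n:]" using degree_eq_zeroE by blast
  have n0: "n \<noteq> 0" using n nz3 by auto
  have fstR: "poly (fst R) x = n * (x * (x - 1) * (x - ?a))" for x
    unfolding k1 k2 k3 n by (simp add: algebra_simps)
  have sq: "\<exists>g. fibre_poly R w = g\<^sup>2 \<and> degree g = 2" if w: "w \<in> heun_points p'" "w \<noteq> Pt 0" for w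
  proof -
    have "\<not> 0 < rat_mult R w Infinity" using fib(3)[OF w, of Infinity] by (auto simp: heun_points_def)
    then have "degree (fibre_poly R w) = 4" using degree_fibre_poly[of R w] deg by simp
    moreover have "2 \<le> order x (fibre_poly R w)" if "poly (fibre_poly R w) x = 0" for x
      using fib(3)[OF w, of "Pt x"] rat_mult_pos_Pt[OF R, of w x] that by simp
    ultimately show ?thesis using quartic_poly_square by metis
  qed
  obtain D F0 G0 where D: "snd R = D\<^sup>2" "degree D = 2"
    and F0: "fst R - snd R = F0\<^sup>2" and G0: "fst R - smult ?a' (snd R) = G0\<^sup>2"
    using sq[of Infinity] sq[of "Pt 1"] sq[of "Pt ?a'"] par_a by (auto simp: heun_points_def)
  \<comment> \<open>the square roots absorb a sign and the factor \<open>a'\<close>\<close>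
  let ?F = "smult \<i> F0" and ?G = "smult (\<i> / csqrt ?a') G0"
  have F: "(poly D x)\<^sup>2 - (poly ?F x)\<^sup>2 = n * (x * (x - 1) * (x - ?a))" for x
  proof -
    have "(poly F0 x)\<^sup>2 = n * (x * (x - 1) * (x - ?a)) - (poly D x)\<^sup>2"
      using arg_cong[OF F0, of "\<lambda>p. poly p x"] fstR[of x] by (simp add: D(1))
    then show ?thesis by (simp add: power_mult_distrib)
  qed
  have G: "(poly D x)\<^sup>2 - (poly ?G x)\<^sup>2 = n / ?a' * (x * (x - 1) * (x - ?a))" for x
  proof -
    have "(poly ?G x)\<^sup>2 = - ((poly G0 x)\<^sup>2 / ?a')"
      by (simp add: power_mult_distrib power_divide)
    also have "(poly G0 x)\<^sup>2 = n * (x * (x - 1) * (x - ?a)) - ?a' * (poly D x)\<^sup>2"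
      using arg_cong[OF G0, of "\<lambda>p. poly p x"] fstR[of x] by (simp add: D(1))
    finally show ?thesis using par_a by (simp add: diff_divide_distrib)
  qed
  obtain r s t v where rst: "finite_points_perm ?a r s t" "v \<noteq> 0" "n = v\<^sup>2 * (s - t)"
    "?a' = (s - t) / (r - t)" and Dx: "\<And>x. 2 * poly D x = v * (x\<^sup>2 - 2 * t * x + (r * t - r * s + s * t))"
    using three_squares[OF par_a n0 D(2) F G] by metis
  have ne: "r \<noteq> s" "r \<noteq> t" "s \<noteq> t" using finite_points_perm_distinct[OF rst(1) par_a(1,2)] .
  have D2: "(poly D x)\<^sup>2 = v\<^sup>2 / 4 * (x\<^sup>2 - 2 * t * x + (r * t - r * s + s * t))\<^sup>2" for x
  proof -
    have e: "poly D x = v * (x\<^sup>2 - 2 * t * x + (r * t - r * s + s * t)) / 2"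
      by (simp flip: Dx)
    show ?thesis unfolding e by (simp add: power_mult_distrib power_divide)
  qed
  have Nx: "poly (fst R) x = v\<^sup>2 * (s - t) * ((x - r) * (x - s) * (x - t))" for x
    using fstR[of x] finite_points_perm_prod[OF rst(1), of x] rst(3) by simp
  have sndR: "snd R = smult (v\<^sup>2 / 4) ([:r * t - r * s + s * t, - 2 * t, 1:]\<^sup>2)"
  proof (rule poly_eq_pointwise)
    fix x
    have "poly (snd R) x = v\<^sup>2 / 4 * (x\<^sup>2 - 2 * t * x + (r * t - r * s + s * t))\<^sup>2"
      using D2[of x] by (simp add: D(1))
    then show "poly (snd R) x = poly (smult (v\<^sup>2 / 4) ([:r * t - r * s + s * t, - 2 * t, 1:]\<^sup>2)) x"
      by (simp add: power2_eq_square algebra_simps)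
  qed
  have sndx: "poly (snd R) x = v\<^sup>2 / 4 * (x\<^sup>2 - 2 * t * x + (r * t - r * s + s * t))\<^sup>2" for x
    using D2[of x] by (simp add: D(1))
  \<comment> \<open>the other two fibre polynomials arise from that over \<open>\<infinity>\<close> by exchanging \<open>t\<close> with \<open>s\<close> and with \<open>r\<close>\<close>
  have scale: "k * A * M - k / 4 * P = - (k / 4) * W" if "4 * A * M - P = - W" for k A M P W :: complex
  proof -
    have "k * A * M - k / 4 * P = k / 4 * (4 * A * M - P)" by (simp add: right_diff_distrib)
    then show ?thesis using that by simp
  qed
  have f1: "fst R - snd R = smult (- (v\<^sup>2 / 4)) ([:r * s - r * t + s * t, - 2 * s, 1:]\<^sup>2)"
  proof (rule poly_eq_pointwise)
    fix x
    have "4 * (s - t) * ((x - r) * (x - s) * (x - t)) - (x\<^sup>2 - 2 * t * x + (r * t - r * s + s * t))\<^sup>2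
        = - (r * s - r * t + s * t - 2 * s * x + x\<^sup>2)\<^sup>2"
      by algebra
    from scale[OF this, of "v\<^sup>2"]
    have "poly (fst R - snd R) x = - (v\<^sup>2 / 4) * (r * s - r * t + s * t - 2 * s * x + x\<^sup>2)\<^sup>2"
      by (simp only: poly_diff Nx sndx)
    then show "poly (fst R - snd R) x = poly (smult (- (v\<^sup>2 / 4)) ([:r * s - r * t + s * t, - 2 * s, 1:]\<^sup>2)) x"
      by (simp add: power2_eq_square algebra_simps)
  qed
  have fa: "fst R - smult ?a' (snd R) = smult (- (?a' * v\<^sup>2 / 4)) ([:s * r - s * t + r * t, - 2 * r, 1:]\<^sup>2)"
  proof (rule poly_eq_pointwise)
    fix x
    have "4 * (r - t) * ((x - r) * (x - s) * (x - t)) - (x\<^sup>2 - 2 * t * x + (r * t - r * s + s * t))\<^sup>2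
        = - (s * r - s * t + r * t - 2 * r * x + x\<^sup>2)\<^sup>2"
      by algebra
    from scale[OF this, of "?a' * v\<^sup>2"]
    have "?a' * v\<^sup>2 * (r - t) * ((x - r) * (x - s) * (x - t)) -
        ?a' * v\<^sup>2 / 4 * (x\<^sup>2 - 2 * t * x + (r * t - r * s + s * t))\<^sup>2
        = - (?a' * v\<^sup>2 / 4) * (s * r - s * t + r * t - 2 * r * x + x\<^sup>2)\<^sup>2" .
    moreover have "?a' * v\<^sup>2 * (r - t) = v\<^sup>2 * (s - t)" using rst(4) ne by simp
    ultimately have "poly (fst R - smult ?a' (snd R)) x =
        - (?a' * v\<^sup>2 / 4) * (s * r - s * t + r * t - 2 * r * x + x\<^sup>2)\<^sup>2"
      by (simp only: poly_diff poly_smult Nx sndx) (simp add: mult.assoc)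
    then show "poly (fst R - smult ?a' (snd R)) x =
        poly (smult (- (?a' * v\<^sup>2 / 4)) ([:s * r - s * t + r * t, - 2 * r, 1:]\<^sup>2)) x"
      by (simp add: power2_eq_square algebra_simps)
  qed
  have half: "exponent_diff_sq p' w = 1/4"
    if w: "w \<in> heun_points p'" "w \<noteq> Pt 0"
      and f: "fibre_poly R w = smult k ([:c, b, 1:]\<^sup>2)" "k \<noteq> 0" "b\<^sup>2 \<noteq> 4 * c" for w k b c
  proof -
    obtain g where g: "fibre_poly R w = g\<^sup>2" "degree g = 2" using sq[OF w] by blast
    then have "g \<noteq> 0" by auto
    then have "degree (fibre_poly R w) \<noteq> 0" using g by (simp add: degree_power_eq)
    then obtain x where x: "poly (fibre_poly R w) x = 0"
      using fundamental_theorem_of_algebra[of "fibre_poly R w"] constant_degree[of "fibre_poly R w"]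
      by auto
    then have "order x (fibre_poly R w) = 2" using order_square_of_quadratic[OF f] by simp
    then show ?thesis using fib(3)[OF w, of "Pt x"] by (simp add: field_simps)
  qed
  have "exponent_diff_sq p' w = 1/4" if w: "w \<in> heun_points p'" "w \<noteq> Pt 0" for w
  proof -
    have disc: "(- 2 * y)\<^sup>2 \<noteq> 4 * (x * y - x * z + z * y)" if "y \<noteq> x" "y \<noteq> z" for x y z :: complex
    proof
      assume "(- 2 * y)\<^sup>2 = 4 * (x * y - x * z + z * y)"
      then have "(y - x) * (y - z) = 0" by algebra
      then show False using that by simp
    qed
    consider "w = Pt 1" | "w = Pt ?a'" | "w = Infinity" using w by (auto simp: heun_points_def)
    then show ?thesis
    proof cases
      case 1
      show ?thesis
        by (rule half[OF w, of "- (v\<^sup>2 / 4)" _ "- 2 * s"])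
           (use f1 1 rst(2) disc[of s r t] ne in \<open>auto simp: mult.commute\<close>)
    next
      case 2
      show ?thesis
        by (rule half[OF w, of "- (?a' * v\<^sup>2 / 4)" _ "- 2 * r"])
           (use fa 2 rst(2) disc[of r s t] ne par_a in \<open>auto simp: mult.commute\<close>)
    next
      case 3
      show ?thesis
        by (rule half[OF w, of "v\<^sup>2 / 4" _ "- 2 * t"])
           (use sndR 3 rst(2) disc[of t r s] ne in \<open>auto simp: mult.commute\<close>)
    qed
  qed
  moreover have "exponent_diff_sq p z = exponent_diff_sq p' (Pt 0)" if "z \<in> heun_points p" for z
    using exponent_diff_sq[of "Pt 0" z] fib(2)[OF that] by simp
  ultimately show thesis using that rst fstR sndR by simp
qed

section \<open>Normalized lifts of germs\<close>

text \<open>A transformation of \<open>Hl\<close> on the level of equations. In this form transformations compose, and the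
prefactor and \<open>q\<close> can be recovered from the coefficients.\<close>

definition normalized_lift ::
  "heun \<Rightarrow> (complex \<Rightarrow> complex) \<Rightarrow> (complex \<Rightarrow> complex) \<Rightarrow> heun \<Rightarrow> bool" where
  "normalized_lift p h \<phi> p' \<longleftrightarrow> \<phi> analytic_on {0} \<and> \<phi> 0 = 0 \<and> deriv \<phi> 0 \<noteq> 0 \<and>
     h analytic_on {0} \<and> h 0 = 1 \<and> germ_lift (heun_ode p) (\<lambda>x. deriv h x / h x) \<phi> (heun_ode p')"

lemma germ_lift_cong:
  assumes "germ_lift E \<eta> r E'" "\<forall>\<^sub>F t in at 0. \<eta> t = \<theta> t" "\<forall>\<^sub>F t in at 0. r t = s t"
  shows "germ_lift E \<theta> s E'"
  unfolding germ_lift_def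
  using assms(1)[unfolded germ_lift_def] eventually_at_imp_eventually_nhds[OF assms(2)]
    eventually_at_imp_eventually_nhds[OF assms(3)]
proof eventually_elim
  case (elim t)
  have "r t = s t" using eventually_nhds_x_imp_x[OF elim(3)] .
  then have "ode_at (ode_rescale \<eta> (ode_pullback r E')) t = ode_at (ode_rescale \<theta> (ode_pullback s E')) t"
    by (intro ode_at_rescale_cong ode_at_pullback_cong elim(2,3)) (simp add: ode_at_def)
  then show ?case using elim(1) by simp
qed

lemma analytic_eventually_nz:
  assumes "h analytic_on {0::complex}" "h 0 = (1::complex)"
  shows "\<forall>\<^sub>F t in nhds 0. h t \<noteq> 0"
proof -
  have "(h \<longlongrightarrow> 1) (nhds 0)"
    using analytic_at_imp_isCont[OF assms(1)] assms(2) by (simp add: isCont_def tendsto_nhds_iff)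
  then show ?thesis by (rule tendsto_imp_eventually_ne) simp
qed

lemma normalized_lift_cong:
  assumes "normalized_lift p h \<phi> p'" and h: "\<forall>\<^sub>F x in nhds 0. h x = k x" and \<phi>: "\<forall>\<^sub>F x in nhds 0. \<phi> x = \<psi> x"
  shows "normalized_lift p k \<psi> p'"
proof -
  have "\<forall>\<^sub>F x in nhds 0. deriv h x / h x = deriv k x / k x"
  proof -
    have "\<forall>\<^sub>F x in nhds 0. \<forall>\<^sub>F y in nhds x. h y = k y" using h by (simp only: eventually_eventually)
    then show ?thesis using h
    proof eventually_elim
      case (elim x)
      show ?case using deriv_cong_ev[OF elim(1) refl] elim(2) by simp
    qed
  qed
  then have log: "\<forall>\<^sub>F x in at 0. deriv h x / h x = deriv k x / k x"
    by (simp add: eventually_nhds_conv_at)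
  have \<phi>': "\<forall>\<^sub>F x in at 0. \<phi> x = \<psi> x" using \<phi> by (simp add: eventually_nhds_conv_at)
  note L = assms(1)[unfolded normalized_lift_def]
  have "germ_lift (heun_ode p) (\<lambda>x. deriv k x / k x) \<psi> (heun_ode p')"
    by (rule germ_lift_cong[OF _ log \<phi>']) (use L in blast)
  moreover have "k analytic_on {0}" "\<psi> analytic_on {0}"
    using L analytic_at_cong[OF h refl] analytic_at_cong[OF \<phi> refl] by blast+
  moreover have "k 0 = 1" "\<psi> 0 = 0" "deriv \<psi> 0 \<noteq> 0"
    using L eventually_nhds_x_imp_x[OF h] eventually_nhds_x_imp_x[OF \<phi>] deriv_cong_ev[OF \<phi> refl]
    by simp_all
  ultimately show ?thesis unfolding normalized_lift_def by blast
qed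

lemma germ_map_if_deriv_nz:
  assumes "\<phi> analytic_on {0}" "\<phi> 0 = 0" "deriv \<phi> 0 \<noteq> 0"
  shows "germ_map \<phi>" "((\<lambda>t. t * deriv \<phi> t / \<phi> t) \<longlongrightarrow> 1) (at 0)"
proof -
  have d0: "(deriv \<phi> \<longlongrightarrow> deriv \<phi> 0) (at 0)"
    using analytic_at_imp_isCont[OF analytic_deriv[OF assms(1)]] isContD by blast
  have q: "((\<lambda>t. \<phi> t / t) \<longlongrightarrow> deriv \<phi> 0) (at 0)"
    using analytic_at_imp_has_deriv[OF assms(1)] assms(2) by (simp add: has_field_derivative_def DERIV_def flip: has_field_derivative_def)
  have "\<forall>\<^sub>F t in at 0. \<phi> t / t \<noteq> 0" by (rule tendsto_imp_eventually_ne[OF q assms(3)])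
  then have nz: "\<forall>\<^sub>F t in at 0. \<phi> t \<noteq> 0" by eventually_elim auto
  have "(\<phi> \<longlongrightarrow> 0) (at 0)" using analytic_at_imp_isCont[OF assms(1)] isContD assms(2) by metis
  then show "germ_map \<phi>"
    using nz assms(1) tendsto_imp_eventually_ne[OF d0 assms(3)] by (simp add: germ_map_def filterlim_at)
  have "((\<lambda>t. deriv \<phi> t / (\<phi> t / t)) \<longlongrightarrow> deriv \<phi> 0 / deriv \<phi> 0) (at 0)"
    by (intro tendsto_intros d0 q assms(3))
  then show "((\<lambda>t. t * deriv \<phi> t / \<phi> t) \<longlongrightarrow> 1) (at 0)"
    using assms(3) by (simp add: mult.commute)
qed

lemma normalized_lift_compose:
  assumes 1: "normalized_lift p h \<phi> p1" and 2: "normalized_lift p1 k \<psi> p2"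
  shows "normalized_lift p (\<lambda>x. h x * k (\<phi> x)) (\<lambda>x. \<psi> (\<phi> x)) p2"
proof -
  have \<phi>: "\<phi> analytic_on {0}" "\<phi> 0 = 0" "deriv \<phi> 0 \<noteq> 0" and h: "h analytic_on {0}" "h 0 = 1"
    and E1: "germ_lift (heun_ode p) (\<lambda>x. deriv h x / h x) \<phi> (heun_ode p1)"
    and \<psi>: "\<psi> analytic_on {0}" "\<psi> 0 = 0" "deriv \<psi> 0 \<noteq> 0" and k: "k analytic_on {0}" "k 0 = 1"
    and E2: "germ_lift (heun_ode p1) (\<lambda>x. deriv k x / k x) \<psi> (heun_ode p2)"
    using assms by (auto simp: normalized_lift_def)
  have \<psi>': "\<psi> analytic_on {\<phi> 0}" and k': "k analytic_on {\<phi> 0}" using \<psi> k \<phi> by auto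
  have an: "(\<lambda>x. h x * k (\<phi> x)) analytic_on {0}" "(\<lambda>x. \<psi> (\<phi> x)) analytic_on {0}"
    using h \<phi> analytic_at_compose[OF \<phi>(1) k'] analytic_at_compose[OF \<phi>(1) \<psi>'] by (auto intro: analytic_intros)
  have log_an: "\<forall>\<^sub>F t in at 0. (\<lambda>x. deriv g x / g x) analytic_on {t}"
    if "g analytic_on {0}" "g 0 = 1" for g
  proof (rule eventually_at_analytic_at)
    show "(\<lambda>x. deriv g x / g x) analytic_on {0}"
      using that by (intro analytic_intros) auto
  qed
  have "germ_lift (heun_ode p) (\<lambda>t. deriv h t / h t + deriv k (\<phi> t) / k (\<phi> t) * deriv \<phi> t)
      (\<lambda>t. \<psi> (\<phi> t)) (heun_ode p2)"
    by (rule germ_lift_compose[OF E1 E2 germ_map_if_deriv_nz(1)[OF \<phi>] germ_map_if_deriv_nz(1)[OF \<psi>]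
          log_an[OF h] log_an[OF k]])
  moreover have "\<forall>\<^sub>F t in at 0. deriv h t / h t + deriv k (\<phi> t) / k (\<phi> t) * deriv \<phi> t =
      deriv (\<lambda>x. h x * k (\<phi> x)) t / (h t * k (\<phi> t))"
  proof -
    have "\<forall>\<^sub>F t in nhds 0. k (\<phi> t) \<noteq> 0"
      by (rule analytic_eventually_nz[of "\<lambda>t. k (\<phi> t)"]) (use analytic_at_compose[OF \<phi>(1) k'] \<phi> k in auto)
    then have "\<forall>\<^sub>F t in nhds 0. deriv h t / h t + deriv k (\<phi> t) / k (\<phi> t) * deriv \<phi> t =
        deriv (\<lambda>x. h x * k (\<phi> x)) t / (h t * k (\<phi> t))"
      using analytic_eventually_nz[OF h] eventually_nhds_analytic_at[OF h(1)]
        eventually_deriv_compose[OF \<phi>(1) k'] eventually_nhds_analytic_at[OF analytic_at_compose[OF \<phi>(1) k']]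
    proof eventually_elim
      case (elim t)
      show ?case unfolding complex_derivative_mult_at[OF elim(3,5)] elim(4)
        using elim(1,2) by (simp add: add_divide_distrib)
    qed
    then show ?thesis by (simp add: eventually_nhds_conv_at)
  qed
  ultimately have "germ_lift (heun_ode p) (\<lambda>t. deriv (\<lambda>x. h x * k (\<phi> x)) t / (h t * k (\<phi> t)))
      (\<lambda>t. \<psi> (\<phi> t)) (heun_ode p2)"
    by (rule germ_lift_cong) simp
  moreover have "deriv (\<lambda>x. \<psi> (\<phi> x)) 0 \<noteq> 0"
    using deriv_compose_at[OF \<phi>(1) \<psi>'] \<phi> \<psi> by simp
  ultimately show ?thesis using an h k \<phi> \<psi> by (simp add: normalized_lift_def)
qed

lemma log_deriv_unique:
  assumes h: "h analytic_on {0}" "h 0 = 1" and k: "k analytic_on {0}" "k 0 = 1"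
    and eq: "\<forall>\<^sub>F t in at 0. deriv h t / h t = deriv k t / k (t::complex)"
  shows "\<forall>\<^sub>F t in nhds 0. h t = k t"
proof -
  let ?g = "\<lambda>t. h t / k t"
  have g: "?g analytic_on {0}" using h k by (intro analytic_intros) auto
  have zero: "\<forall>\<^sub>F t in at 0. deriv ?g t = 0"
    using eq eventually_at_analytic_at[OF h(1)] eventually_at_analytic_at[OF k(1)]
      analytic_eventually_nz[OF h, unfolded eventually_nhds_conv_at, THEN conjunct1]
      analytic_eventually_nz[OF k, unfolded eventually_nhds_conv_at, THEN conjunct1]
  proof eventually_elim
    case (elim t)
    have "(?g has_field_derivative (deriv h t * k t - h t * deriv k t) / (k t * k t)) (at t)"
      by (rule DERIV_divide[OF analytic_at_imp_has_deriv[OF elim(2)] analytic_at_imp_has_deriv[OF elim(3)] elim(5)])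
    moreover have "deriv h t * k t = h t * deriv k t" using elim(1,4,5) by (simp add: field_simps)
    ultimately show ?case by (simp add: DERIV_imp_deriv)
  qed
  have lim: "(deriv ?g \<longlongrightarrow> deriv ?g 0) (at 0)"
    using analytic_at_imp_isCont[OF analytic_deriv[OF g]] isContD by blast
  have "((\<lambda>t::complex. 0::complex) \<longlongrightarrow> deriv ?g 0) (at 0)"
    by (rule Lim_transform_eventually[OF lim zero])
  then have "deriv ?g 0 = 0" by (simp add: tendsto_const_iff)
  with zero have "\<forall>\<^sub>F t in nhds 0. deriv ?g t = 0"
    by (simp add: eventually_nhds_conv_at)
  then have "\<forall>\<^sub>F t in nhds 0. ?g analytic_on {t} \<and> deriv ?g t = 0 \<and> k t \<noteq> 0"
    using eventually_nhds_analytic_at[OF g] analytic_eventually_nz[OF k]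
    by eventually_elim simp
  then obtain e where e: "e > 0" "\<And>t. dist t 0 < e \<Longrightarrow> ?g analytic_on {t} \<and> deriv ?g t = 0 \<and> k t \<noteq> 0"
    unfolding eventually_nhds_metric by blast
  have "\<exists>c. \<forall>t \<in> ball 0 e. ?g t = c"
  proof (rule has_field_derivative_zero_constant)
    fix x :: complex assume "x \<in> ball 0 e"
    then have "?g analytic_on {x}" "deriv ?g x = 0" using e(2)[of x] by (auto simp: dist_commute)
    then show "(?g has_field_derivative 0) (at x within ball 0 e)"
      using analytic_at_imp_has_deriv[of ?g x] by (simp add: has_field_derivative_at_within)
  qed simp
  then obtain c where c: "\<And>t. t \<in> ball 0 e \<Longrightarrow> ?g t = c" by blast
  have "c = 1" using c[of 0] e(1) h k by simp
  then have "h t = k t" if "dist t 0 < e" for t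
    using that e(2)[OF that] c[of t] \<open>c = 1\<close> by (simp add: dist_commute)
  then show ?thesis using e(1) by (auto simp: eventually_nhds_metric)
qed

text \<open>The first coefficients determine the prefactor, and then the second ones determine \<open>q\<close>.\<close>

lemma normalized_lift_unique:
  assumes 1: "normalized_lift (Heun a q \<alpha> \<beta> \<gamma> \<delta>) h \<phi> p'"
    and 2: "normalized_lift (Heun a q' \<alpha> \<beta> \<gamma> \<delta>) k \<phi> p'" and a: "a \<noteq> 0" "a \<noteq> 1"
  shows "q = q'" "\<forall>\<^sub>F x in nhds 0. h x = k x"
proof -
  let ?p = "Heun a q \<alpha> \<beta> \<gamma> \<delta>" and ?p' = "Heun a q' \<alpha> \<beta> \<gamma> \<delta>"
  let ?\<eta> = "\<lambda>x. deriv h x / h x" and ?\<theta> = "\<lambda>x. deriv k x / k x"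
  have E: "\<forall>\<^sub>F t in at 0. ode_at (ode_rescale ?\<eta> (ode_pullback \<phi> (heun_ode p'))) t = ode_at (heun_ode ?p) t"
    and E': "\<forall>\<^sub>F t in at 0. ode_at (ode_rescale ?\<theta> (ode_pullback \<phi> (heun_ode p'))) t = ode_at (heun_ode ?p') t"
    using assms by (auto simp: normalized_lift_def germ_lift_def)
  have eq: "\<forall>\<^sub>F t in at 0. ?\<eta> t = ?\<theta> t"
    using E E'
  proof eventually_elim
    case (elim t)
    have "fst (heun_ode ?p) t = fst (heun_ode ?p') t" by (simp add: heun_ode_def par_epsilon_def)
    have cancel: "u = v" if "X - 2 * u = X - 2 * v" for X u v :: complex using that by simp
    have "fst (ode_pullback \<phi> (heun_ode p')) t - 2 * ?\<eta> t = fst (ode_pullback \<phi> (heun_ode p')) t - 2 * ?\<theta> t"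
      using elim \<open>fst (heun_ode ?p) t = fst (heun_ode ?p') t\<close>
      by (simp only: ode_at_eq_iff ode_rescale_def fst_conv)
    then show ?case by (rule cancel)
  qed
  then show "\<forall>\<^sub>F x in nhds 0. h x = k x"
    using 1 2 by (intro log_deriv_unique) (auto simp: normalized_lift_def)
  have "\<forall>\<^sub>F t in at 0. t \<noteq> 0 \<and> t \<noteq> 1 \<and> t \<noteq> a"
    using eventually_neq_at_within[of 0 0] eventually_neq_at_within[of 1 0] eventually_neq_at_within[of a 0]
    by eventually_elim auto
  then have "\<forall>\<^sub>F t in at (0::complex). q = q'"
    using E E' eventually_at_imp_eventually_nhds[OF eq]
  proof eventually_elim
    case (elim t)
    have "ode_at (heun_ode ?p) t = ode_at (heun_ode ?p') t"
      using ode_at_rescale_cong[OF refl elim(4), of "ode_pullback \<phi> (heun_ode p')"] elim(2,3) by simp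
    then show ?case using elim(1) by (auto simp: ode_at_eq_iff heun_ode_def)
  qed
  then show "q = q'" by (simp add: eventually_False trivial_limit_at)
qed

text \<open>Comparison of the residues at \<open>0\<close> of the first coefficients.\<close>

lemma normalized_lift_gamma:
  assumes L: "normalized_lift p h \<phi> p'" and a: "par_a p \<noteq> 0" "par_a p' \<noteq> 0"
  shows "par_gamma p = par_gamma p'"
proof -
  have \<phi>: "\<phi> analytic_on {0}" "\<phi> 0 = 0" "deriv \<phi> 0 \<noteq> 0" and h: "h analytic_on {0}" "h 0 = 1"
    and E: "germ_lift (heun_ode p) (\<lambda>x. deriv h x / h x) \<phi> (heun_ode p')"
    using L by (auto simp: normalized_lift_def)
  have res: "((\<lambda>t. t * fst (heun_ode p) t) \<longlongrightarrow> par_gamma p) (at 0)" if "par_a p \<noteq> 0" for p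
  proof (rule Lim_transform_eventually)
    show "((\<lambda>t. par_gamma p + t * (par_delta p / (t - 1) + par_epsilon p / (t - par_a p)))
        \<longlongrightarrow> par_gamma p) (at 0)"
      using that by (auto intro!: tendsto_eq_intros)
    show "\<forall>\<^sub>F t in at 0. par_gamma p + t * (par_delta p / (t - 1) + par_epsilon p / (t - par_a p)) =
        t * fst (heun_ode p) t"
      using eventually_neq_at_within[of 0 0]
      by eventually_elim (simp add: heun_ode_def distrib_left)
  qed
  have "filterlim \<phi> (at 0) (at 0)" using germ_map_if_deriv_nz(1)[OF \<phi>] by (simp add: germ_map_def)
  from filterlim_compose[OF res[OF a(2)] this]
  have 1: "((\<lambda>t. \<phi> t * fst (heun_ode p') (\<phi> t)) \<longlongrightarrow> par_gamma p') (at 0)" .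
  have c: "(f \<longlongrightarrow> f 0) (at 0)" if "f analytic_on {0}" for f :: "complex \<Rightarrow> complex"
    using analytic_at_imp_isCont[OF that] isContD by blast
  have 2: "((\<lambda>t. (\<phi> t * fst (heun_ode p') (\<phi> t)) * (t * deriv \<phi> t / \<phi> t) -
      t * (deriv (deriv \<phi>) t / deriv \<phi> t) - 2 * (t * (deriv h t / h t))) \<longlongrightarrow>
      par_gamma p' * 1 - 0 * (deriv (deriv \<phi>) 0 / deriv \<phi> 0) - 2 * (0 * (deriv h 0 / h 0))) (at 0)"
    using h \<phi> by (intro tendsto_intros 1 germ_map_if_deriv_nz(2)[OF \<phi>] c analytic_deriv) auto
  have "\<forall>\<^sub>F t in at 0. (\<phi> t * fst (heun_ode p') (\<phi> t)) * (t * deriv \<phi> t / \<phi> t) -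
      t * (deriv (deriv \<phi>) t / deriv \<phi> t) - 2 * (t * (deriv h t / h t)) = t * fst (heun_ode p) t"
  proof -
    have "\<forall>\<^sub>F t in at 0. \<phi> t \<noteq> 0"
      using germ_map_if_deriv_nz(1)[OF \<phi>] by (simp add: germ_map_def filterlim_at)
    then show ?thesis using E[unfolded germ_lift_def]
    proof eventually_elim
      case (elim t)
      have "fst (heun_ode p) t = fst (heun_ode p') (\<phi> t) * deriv \<phi> t -
          deriv (deriv \<phi>) t / deriv \<phi> t - 2 * (deriv h t / h t)"
        using elim(2) by (simp add: ode_at_eq_iff ode_rescale_def ode_pullback_def)
      then show ?case using elim(1) by (simp add: right_diff_distrib)
    qed
  qed
  from Lim_transform_eventually[OF 2 this] tendsto_unique[OF _ res[OF a(1)]]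
  show ?thesis by fastforce
qed

section \<open>Moebius and F-homotopic transformations\<close>

lemma log_deriv_powr:
  "(\<lambda>x. (1 - x) powr c) analytic_on {0}" "(1 - 0) powr c = (1::complex)"
  "\<forall>\<^sub>F x in at 0. deriv (\<lambda>x. (1 - x) powr c) x / (1 - x) powr c = c / (x - (1::complex))"
proof -
  show "(\<lambda>x. (1 - x) powr c) analytic_on {0}" by (auto intro!: analytic_intros)
  have "\<forall>\<^sub>F x in nhds 0. 1 - x \<in> ball (1::complex) 1"
    by (rule eventually_nhds_in_open[of "ball 0 1", THEN eventually_mono]) (auto simp: dist_norm)
  then have "\<forall>\<^sub>F x in nhds 0. deriv (\<lambda>x. (1 - x) powr c) x / (1 - x) powr c = c / (x - (1::complex))"
  proof eventually_elim
    case (elim x)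
    have slit: "1 - x \<notin> \<real>\<^sub>\<le>\<^sub>0"
    proof
      assume "1 - x \<in> \<real>\<^sub>\<le>\<^sub>0"
      then have "Re (1 - x) \<le> 0" by (simp add: complex_nonpos_Reals_iff)
      moreover have "Re x \<le> norm x" by (rule complex_Re_le_cmod)
      ultimately show False using elim by (simp add: dist_norm)
    qed
    then have nz: "1 - x \<noteq> 0" by auto
    have "((\<lambda>x. (1 - x) powr c) has_field_derivative - (c * (1 - x) powr (c - 1))) (at x)"
      using slit by (auto intro!: derivative_eq_intros)
    then have "deriv (\<lambda>x. (1 - x) powr c) x = - (c * ((1 - x) powr c / (1 - x)))"
      using nz by (simp add: DERIV_imp_deriv powr_diff)
    then show ?case using nz by (simp add: field_simps)
  qed
  then show "\<forall>\<^sub>F x in at 0. deriv (\<lambda>x. (1 - x) powr c) x / (1 - x) powr c = c / (x - (1::complex))"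
    by (simp add: eventually_nhds_conv_at)
qed simp

lemma deriv_pole: "x \<noteq> b \<Longrightarrow> deriv (\<lambda>x. c / (x - b)) x = - (c / (x - b)\<^sup>2)" for x b c :: complex
  by (rule DERIV_imp_deriv) (auto intro!: derivative_eq_intros simp: power2_eq_square)

lemma eventually_at_0_regular:
  "\<forall>\<^sub>F x in at 0. x \<noteq> 0 \<and> x \<noteq> 1 \<and> x \<noteq> (a::complex)"
  using eventually_neq_at_within[of 0 0] eventually_neq_at_within[of 1 0] eventually_neq_at_within[of a 0]
  by eventually_elim auto

lemma normalized_lift_ident: "normalized_lift p (\<lambda>x. 1) (\<lambda>x. x) p"
  by (auto simp: normalized_lift_def germ_lift_def ode_at_def ode_rescale_def ode_pullback_def
      intro!: analytic_intros)

lemma normalized_lift_swap: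
  "normalized_lift (Heun a q \<alpha> \<beta> \<gamma> \<delta>) (\<lambda>x. 1) (\<lambda>x. x) (Heun a q \<beta> \<alpha> \<gamma> \<delta>)"
proof -
  have "heun_ode (Heun a q \<alpha> \<beta> \<gamma> \<delta>) = heun_ode (Heun a q \<beta> \<alpha> \<gamma> \<delta>)"
    unfolding heun_ode_def par_epsilon_def heun.sel add.commute[of \<alpha> \<beta>] mult.commute[of \<alpha> \<beta>] ..
  then show ?thesis using normalized_lift_ident by (simp add: normalized_lift_def)
qed

text \<open>The generators are verified by comparing coefficients in partial fractions. The prefactors \<open>(1 - x) powr c\<close>
enter through their logarithmic derivative \<open>c / (x - 1)\<close>.\<close>

lemma normalized_lift_moebius2:
  assumes "a \<noteq> 0"
  shows "normalized_lift (Heun a q \<alpha> \<beta> \<gamma> \<delta>) (\<lambda>x. 1) (\<lambda>x. x / a)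
    (Heun (1 / a) (q / a) \<alpha> \<beta> \<gamma> (\<alpha> + \<beta> - \<gamma> - \<delta> + 1))"
proof -
  have d: "deriv (\<lambda>x. x / a) = (\<lambda>x. 1 / a)"
    by (rule ext, rule DERIV_imp_deriv) (use assms in \<open>auto intro!: derivative_eq_intros\<close>)
  have "germ_lift (heun_ode (Heun a q \<alpha> \<beta> \<gamma> \<delta>)) (\<lambda>x. deriv (\<lambda>x. 1) x / 1) (\<lambda>x. x / a)
    (heun_ode (Heun (1 / a) (q / a) \<alpha> \<beta> \<gamma> (\<alpha> + \<beta> - \<gamma> - \<delta> + 1)))"
    unfolding germ_lift_def using eventually_at_0_regular[of a]
  proof eventually_elim
    case (elim x)
    have "x / a - 1 = (x - a) / a" "x / a - 1 / a = (x - 1) / a"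
      "\<alpha> * \<beta> * (x / a) - q / a = (\<alpha> * \<beta> * x - q) / a"
      using assms by (auto simp: diff_divide_distrib)
    note e = this
    have P: "\<gamma> / (x / a) * (1 / a) = \<gamma> / x" "\<delta>' / ((x - a) / a) * (1 / a) = \<delta>' / (x - a)"
      "\<epsilon>' / ((x - 1) / a) * (1 / a) = \<epsilon>' / (x - 1)" for \<delta>' \<epsilon>'
      using assms by auto
    have Q: "y / a / (x / a * ((x - a) / a) * ((x - 1) / a)) * (1 / a)\<^sup>2 = y / (x * (x - 1) * (x - a))" for y
      using assms by (simp add: power2_eq_square mult.commute mult.left_commute)
    show ?case
      unfolding ode_at_eq_iff ode_rescale_def ode_pullback_def heun_ode_def fst_conv snd_conv d
        heun.sel par_epsilon_def e distrib_right P Q by (simp add: algebra_simps)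
  qed
  then show ?thesis using assms d by (auto simp: normalized_lift_def intro!: analytic_intros)
qed

lemma normalized_lift_F_homotopic:
  assumes "a \<noteq> 0" "a \<noteq> 1"
  shows "normalized_lift (Heun a q \<alpha> \<beta> \<gamma> \<delta>) (\<lambda>x. (1 - x) powr (1 - \<delta>)) (\<lambda>x. x)
    (Heun a (q - (\<delta> - 1) * \<gamma> * a) (\<beta> - \<delta> + 1) (\<alpha> - \<delta> + 1) \<gamma> (2 - \<delta>))" (is "normalized_lift ?p _ _ ?p'")
proof -
  have "germ_lift (heun_ode ?p) (\<lambda>x. (1 - \<delta>) / (x - 1)) (\<lambda>x. x) (heun_ode ?p')"
    unfolding germ_lift_def using eventually_at_0_regular[of a]
  proof eventually_elim
    case (elim x)
    then have nz: "x \<noteq> 0" "x - 1 \<noteq> 0" "x - a \<noteq> 0" by auto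
    define \<epsilon> where "\<epsilon> = \<alpha> + \<beta> - \<gamma> - \<delta> + 1"
    have "\<gamma> / x + (2 - \<delta>) / (x - 1) + \<epsilon> / (x - a) - 2 * ((1 - \<delta>) / (x - 1)) =
        \<gamma> / x + \<delta> / (x - 1) + \<epsilon> / (x - a)"
      by (simp add: diff_divide_distrib)
    moreover have "((\<beta> - \<delta> + 1) * (\<alpha> - \<delta> + 1) * x - (q - (\<delta> - 1) * \<gamma> * a)) / (x * (x - 1) * (x - a))
        - (\<gamma> / x + (2 - \<delta>) / (x - 1) + \<epsilon> / (x - a)) * ((1 - \<delta>) / (x - 1))
        + ((1 - \<delta>) / (x - 1))\<^sup>2 - - ((1 - \<delta>) / (x - 1)\<^sup>2) =
        (\<alpha> * \<beta> * x - q) / (x * (x - 1) * (x - a))"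
      unfolding \<epsilon>_def using nz by (simp add: divide_simps) algebra
    moreover have "par_epsilon ?p = \<epsilon>" "par_epsilon ?p' = \<epsilon>" by (auto simp: par_epsilon_def \<epsilon>_def)
    moreover have "x \<noteq> 1" using elim by simp
    ultimately show ?case
      unfolding ode_at_eq_iff ode_rescale_def ode_pullback_def heun_ode_def fst_conv snd_conv heun.sel
        deriv_pole[OF \<open>x \<noteq> 1\<close>] by simp
  qed
  moreover have "\<forall>\<^sub>F x in at 0. (1 - \<delta>) / (x - 1) = deriv (\<lambda>x. (1 - x) powr (1 - \<delta>)) x / (1 - x) powr (1 - \<delta>)"
    using log_deriv_powr(3)[of "1 - \<delta>"] by eventually_elim simp
  ultimately have "germ_lift (heun_ode ?p)
      (\<lambda>x. deriv (\<lambda>x. (1 - x) powr (1 - \<delta>)) x / (1 - x) powr (1 - \<delta>)) (\<lambda>x. x) (heun_ode ?p')"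
    by (rule germ_lift_cong) simp
  then show ?thesis using log_deriv_powr(1)[of "1 - \<delta>"] by (auto simp: normalized_lift_def intro!: analytic_intros)
qed

lemma normalized_lift_moebius1:
  assumes "a \<noteq> 0" "a \<noteq> 1"
  shows "normalized_lift (Heun a q \<alpha> \<beta> \<gamma> \<delta>) (\<lambda>x. (1 - x) powr (- \<alpha>)) (\<lambda>x. x / (x - 1))
    (Heun (a / (a - 1)) ((- q + \<gamma> * \<alpha> * a) / (a - 1)) \<alpha> (\<alpha> - \<delta> + 1) \<gamma> (\<alpha> - \<beta> + 1))"
    (is "normalized_lift ?p _ _ ?p'")
proof -
  have d: "deriv (\<lambda>x. x / (x - 1)) x = - (1 / (x - 1)\<^sup>2)" if "x \<noteq> 1" for x :: complex
    by (rule DERIV_imp_deriv) (use that in \<open>auto intro!: derivative_eq_intros simp: field_simps power2_eq_square\<close>)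
  have d2: "deriv (deriv (\<lambda>x. x / (x - 1))) x = 2 / (x - 1) ^ 3" if "x \<noteq> 1" for x :: complex
  proof -
    have "\<forall>\<^sub>F x in nhds x. x \<noteq> 1" using that t1_space_nhds by blast
    then have "\<forall>\<^sub>F x in nhds x. deriv (\<lambda>x. x / (x - 1)) x = - (1 / (x - 1) * (1 / (x - 1)))"
      by eventually_elim (simp add: d power2_eq_square)
    moreover have "((\<lambda>x. - (1 / (x - 1) * (1 / (x - 1)))) has_field_derivative 2 / (x - 1) ^ 3) (at x)"
    proof -
      have base: "((\<lambda>x. 1 / (x - 1)) has_field_derivative - (1 / (x - 1)\<^sup>2)) (at x)"
        using that by (auto intro!: derivative_eq_intros simp: power2_eq_square)
      have "((\<lambda>x. - (1 / (x - 1) * (1 / (x - 1)))) has_field_derivative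
          - (- (1 / (x - 1)\<^sup>2) * (1 / (x - 1)) + - (1 / (x - 1)\<^sup>2) * (1 / (x - 1)))) (at x)"
        by (intro DERIV_minus DERIV_mult base)
      then show ?thesis by (simp add: power2_eq_square power3_eq_cube mult.assoc)
    qed
    ultimately show ?thesis using deriv_cong_ev DERIV_imp_deriv by metis
  qed
  have a1: "a - 1 \<noteq> 0" using assms by simp
  have "germ_lift (heun_ode ?p) (\<lambda>x. - \<alpha> / (x - 1)) (\<lambda>x. x / (x - 1)) (heun_ode ?p')"
    unfolding germ_lift_def using eventually_at_0_regular[of a]
  proof eventually_elim
    case (elim x)
    then have nz: "x \<noteq> 0" "x - 1 \<noteq> 0" "x - a \<noteq> 0" by auto
    define \<epsilon> where "\<epsilon> = \<alpha> + \<beta> - \<gamma> - \<delta> + 1"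
    have "x / (x - 1) - a / (a - 1) = (x * (a - 1) - a * (x - 1)) / ((x - 1) * (a - 1))"
      using nz(2) a1 by (rule diff_frac_eq)
    also have "x * (a - 1) - a * (x - 1) = - (x - a)" by (simp add: algebra_simps)
    finally have e2: "x / (x - 1) - a / (a - 1) = - ((x - a) / ((x - 1) * (a - 1)))"
      by (simp only: minus_divide_left)
    have e1: "x / (x - 1) - 1 = 1 / (x - 1)" using nz by (simp add: field_simps)
    note e = e1 e2
    have x1: "x \<noteq> 1" using elim by simp
    have P: "\<gamma> / (x / (x - 1)) * - (1 / (x - 1)\<^sup>2) = \<gamma> / x - \<gamma> / (x - 1)"
      "c / (1 / (x - 1)) * - (1 / (x - 1)\<^sup>2) = - (c / (x - 1))"
      "\<epsilon> / - ((x - a) / ((x - 1) * (a - 1))) * - (1 / (x - 1)\<^sup>2) = \<epsilon> / (x - a) - \<epsilon> / (x - 1)"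
      "2 / (x - 1) ^ 3 / - (1 / (x - 1)\<^sup>2) = - (2 / (x - 1))" for c
      using nz a1 by (simp_all add: divide_simps power2_eq_square power3_eq_cube) (simp_all add: algebra_simps)
    have Q: "y / (x / (x - 1) * (1 / (x - 1)) * - ((x - a) / ((x - 1) * (a - 1)))) * (- (1 / (x - 1)\<^sup>2))\<^sup>2
        = - (y * (a - 1) / (x * (x - 1) * (x - a)))" for y
      using nz a1 by (simp add: divide_simps power2_eq_square)
    have ep: "par_epsilon ?p' = \<epsilon>" by (simp add: par_epsilon_def \<epsilon>_def)
    have fst': "fst (ode_pullback (\<lambda>x. x / (x - 1)) (heun_ode ?p')) x =
        \<gamma> / x + \<delta> / (x - 1) + \<epsilon> / (x - a) - 2 * (\<alpha> / (x - 1))"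
      unfolding ode_pullback_def heun_ode_def fst_conv snd_conv heun.sel ep d[OF x1] d2[OF x1] e distrib_right P
      by (simp add: \<epsilon>_def diff_divide_distrib add_divide_distrib)
    have snd': "snd (ode_pullback (\<lambda>x. x / (x - 1)) (heun_ode ?p')) x =
        - ((\<alpha> * (\<alpha> - \<delta> + 1) * (x / (x - 1)) * (a - 1) + q - \<gamma> * \<alpha> * a) / (x * (x - 1) * (x - a)))"
    proof -
      have "snd (ode_pullback (\<lambda>x. x / (x - 1)) (heun_ode ?p')) x =
        - ((\<alpha> * (\<alpha> - \<delta> + 1) * (x / (x - 1)) - (- q + \<gamma> * \<alpha> * a) / (a - 1)) * (a - 1) / (x * (x - 1) * (x - a)))"
        unfolding ode_pullback_def heun_ode_def fst_conv snd_conv heun.sel d[OF x1] e Q ..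
      also have "(\<alpha> * (\<alpha> - \<delta> + 1) * (x / (x - 1)) - (- q + \<gamma> * \<alpha> * a) / (a - 1)) * (a - 1) =
        \<alpha> * (\<alpha> - \<delta> + 1) * (x / (x - 1)) * (a - 1) + q - \<gamma> * \<alpha> * a"
      proof -
        have "(X - y / (a - 1)) * (a - 1) = X * (a - 1) - y" for X y
          using a1 by (simp only: left_diff_distrib nonzero_divide_eq_eq[symmetric]) simp
        from this[of _ "- q + \<gamma> * \<alpha> * a"] show ?thesis by (simp only:) simp
      qed
      finally show ?thesis .
    qed
    have key: "- ((\<alpha> * (\<alpha> - \<delta> + 1) * (x / (x - 1)) * (a - 1) + q - \<gamma> * \<alpha> * a) / (x * (x - 1) * (x - a)))
        - (\<gamma> / x + \<delta> / (x - 1) + \<epsilon> / (x - a) - 2 * (\<alpha> / (x - 1))) * (- \<alpha> / (x - 1))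
        + (- \<alpha> / (x - 1))\<^sup>2 - - (- \<alpha> / (x - 1)\<^sup>2) = (\<alpha> * \<beta> * x - q) / (x * (x - 1) * (x - a))"
      unfolding \<epsilon>_def using nz by (simp add: divide_simps) algebra
    have p: "fst (heun_ode ?p) x = \<gamma> / x + \<delta> / (x - 1) + \<epsilon> / (x - a)"
      "snd (heun_ode ?p) x = (\<alpha> * \<beta> * x - q) / (x * (x - 1) * (x - a))"
      by (simp_all add: heun_ode_def par_epsilon_def \<epsilon>_def)
    show ?case
      unfolding ode_at_eq_iff ode_rescale_def fst_conv snd_conv fst' snd' deriv_pole[OF x1] key p by simp
  qed
  moreover have "\<forall>\<^sub>F x in at 0. - \<alpha> / (x - 1) = deriv (\<lambda>x. (1 - x) powr (- \<alpha>)) x / (1 - x) powr (- \<alpha>)"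
    using log_deriv_powr(3)[of "- \<alpha>"] by eventually_elim simp
  ultimately have "germ_lift (heun_ode ?p)
      (\<lambda>x. deriv (\<lambda>x. (1 - x) powr (- \<alpha>)) x / (1 - x) powr (- \<alpha>)) (\<lambda>x. x / (x - 1)) (heun_ode ?p')"
    by (rule germ_lift_cong) simp
  then show ?thesis using log_deriv_powr(1)[of "- \<alpha>"] d[of 0] by (auto simp: normalized_lift_def intro!: analytic_intros)
qed

lemma moebius_F_normalized_lift:
  assumes "moebius_F p h \<phi> p'" "par_a p \<noteq> 0" "par_a p \<noteq> 1"
  shows "normalized_lift p h \<phi> p' \<and> par_a p' \<noteq> 0 \<and> par_a p' \<noteq> 1"
  using assms
proof (induction rule: moebius_F.induct)
  case (moebius1 a q \<alpha> \<beta> \<gamma> \<delta>)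
  then have "a / (a - 1) \<noteq> 1" by (simp add: field_simps)
  then show ?case using moebius1 normalized_lift_moebius1[of a q \<alpha> \<beta> \<gamma> \<delta>] by simp
next
  case (compose p h \<phi> p1 k \<psi> p2)
  then show ?case using normalized_lift_compose by blast
qed (simp_all add: normalized_lift_ident normalized_lift_swap normalized_lift_moebius2
    normalized_lift_F_homotopic)

text \<open>The F-homotopic transformation changes the sign of the exponent difference at \<open>1\<close>; conjugated by
\<open>x \<mapsto> x / a\<close> it does so at \<open>a\<close>, and the interchange of \<open>\<alpha>\<close> and \<open>\<beta>\<close> does so at \<open>\<infinity>\<close>. Given these three
differences and \<open>\<gamma>\<close>, the exponents are determined. The accessory parameter is translated by an amount
that does not depend on it.\<close>

lemma moebius_F_exponent_signs:
  assumes a: "a \<noteq> 0" and sq: "(1 - \<delta>')\<^sup>2 = (1 - \<delta>)\<^sup>2"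
    "(1 - (\<alpha>' + \<beta>' - \<gamma> - \<delta>' + 1))\<^sup>2 = (1 - (\<alpha> + \<beta> - \<gamma> - \<delta> + 1))\<^sup>2" "(\<alpha>' - \<beta>')\<^sup>2 = (\<alpha> - \<beta>)\<^sup>2"
  shows "\<exists>k s. \<forall>q. moebius_F (Heun a q \<alpha> \<beta> \<gamma> \<delta>) k (\<lambda>x. x) (Heun a (q + s) \<alpha>' \<beta>' \<gamma> \<delta>')"
proof -
  define reach where "reach \<alpha> \<beta> \<delta> \<alpha>' \<beta>' \<delta>' \<longleftrightarrow>
    (\<exists>k s. \<forall>q. moebius_F (Heun a q \<alpha> \<beta> \<gamma> \<delta>) k (\<lambda>x. x) (Heun a (q + s) \<alpha>' \<beta>' \<gamma> \<delta>'))" for \<alpha> \<beta> \<delta> \<alpha>' \<beta>' \<delta>'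
  have trans: "reach \<alpha> \<beta> \<delta> \<alpha>2 \<beta>2 \<delta>2" if r: "reach \<alpha> \<beta> \<delta> \<alpha>1 \<beta>1 \<delta>1" "reach \<alpha>1 \<beta>1 \<delta>1 \<alpha>2 \<beta>2 \<delta>2"
    for \<alpha> \<beta> \<delta> \<alpha>1 \<beta>1 \<delta>1 \<alpha>2 \<beta>2 \<delta>2
  proof -
    obtain k s where 1: "\<forall>q. moebius_F (Heun a q \<alpha> \<beta> \<gamma> \<delta>) k (\<lambda>x. x) (Heun a (q + s) \<alpha>1 \<beta>1 \<gamma> \<delta>1)"
      using r(1) unfolding reach_def by blast
    obtain k' s' where 2: "\<forall>q. moebius_F (Heun a q \<alpha>1 \<beta>1 \<gamma> \<delta>1) k' (\<lambda>x. x) (Heun a (q + s') \<alpha>2 \<beta>2 \<gamma> \<delta>2)"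
      using r(2) unfolding reach_def by blast
    from compose[OF 1[rule_format] 2[rule_format]]
    have "moebius_F (Heun a q \<alpha> \<beta> \<gamma> \<delta>) (\<lambda>x. k x * k' x) (\<lambda>x. x) (Heun a (q + (s + s')) \<alpha>2 \<beta>2 \<gamma> \<delta>2)" for q
      by (simp add: add.assoc)
    then show ?thesis unfolding reach_def by blast
  qed
  have refl: "reach \<alpha> \<beta> \<delta> \<alpha> \<beta> \<delta>" for \<alpha> \<beta> \<delta>
    unfolding reach_def by (rule exI[of _ "\<lambda>x. 1"], rule exI[of _ 0]) (simp add: ident)
  have swap: "reach \<alpha> \<beta> \<delta> \<beta> \<alpha> \<delta>" for \<alpha> \<beta> \<delta>
    unfolding reach_def by (rule exI[of _ "\<lambda>x. 1"], rule exI[of _ 0]) (simp add: moebius_F.swap)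
  have one: "reach \<alpha> \<beta> \<delta> (\<beta> - \<delta> + 1) (\<alpha> - \<delta> + 1) (2 - \<delta>)" for \<alpha> \<beta> \<delta>
    unfolding reach_def
    by (rule exI[of _ "\<lambda>x. (1 - x) powr (1 - \<delta>)"], rule exI[of _ "- ((\<delta> - 1) * \<gamma> * a)"])
       (use F_homotopic in simp)
  have a_: "reach \<alpha> \<beta> \<delta> (\<beta> - \<epsilon> + 1) (\<alpha> - \<epsilon> + 1) \<delta>" if \<epsilon>: "\<epsilon> = \<alpha> + \<beta> - \<gamma> - \<delta> + 1" for \<alpha> \<beta> \<delta> \<epsilon>
  proof -
    have "moebius_F (Heun a q \<alpha> \<beta> \<gamma> \<delta>) (\<lambda>x. 1 * ((1 - x / a) powr (1 - \<epsilon>) * 1)) (\<lambda>x. x / a / (1 / a))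
        (Heun (1 / (1 / a)) ((q / a - (\<epsilon> - 1) * \<gamma> * (1 / a)) / (1 / a)) (\<beta> - \<epsilon> + 1) (\<alpha> - \<epsilon> + 1) \<gamma>
          ((\<beta> - \<epsilon> + 1) + (\<alpha> - \<epsilon> + 1) - \<gamma> - (2 - \<epsilon>) + 1))" for q
      unfolding \<epsilon> by (rule compose[OF moebius2 compose[OF F_homotopic moebius2]])
    moreover have "(\<lambda>x. x / a / (1 / a)) = (\<lambda>x. x)" "1 / (1 / a) = a"
      "(q / a - (\<epsilon> - 1) * \<gamma> * (1 / a)) / (1 / a) = q + - ((\<epsilon> - 1) * \<gamma>)"
      "(\<beta> - \<epsilon> + 1) + (\<alpha> - \<epsilon> + 1) - \<gamma> - (2 - \<epsilon>) + 1 = \<delta>" for q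
      using a by (auto simp: field_simps \<epsilon>)
    ultimately show ?thesis unfolding reach_def by metis
  qed
  have final: "reach \<alpha> \<beta> \<delta> \<alpha>' \<beta>' \<delta>'" if "\<delta> = \<delta>'" "\<alpha> + \<beta> = \<alpha>' + \<beta>'" "(\<alpha>' - \<beta>')\<^sup>2 = (\<alpha> - \<beta>)\<^sup>2" for \<alpha> \<beta> \<delta>
  proof -
    have "\<alpha>' - \<beta>' = \<alpha> - \<beta> \<or> \<alpha>' - \<beta>' = - (\<alpha> - \<beta>)" using that(3) by (simp add: power2_eq_iff)
    then have "(\<alpha>' = \<alpha> \<and> \<beta>' = \<beta>) \<or> (\<alpha>' = \<beta> \<and> \<beta>' = \<alpha>)"
    proof
      assume h: "\<alpha>' - \<beta>' = \<alpha> - \<beta>"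
      have "2 * \<alpha>' = 2 * \<alpha>" using h that(2) by algebra
      then show ?thesis using that(2) by simp
    next
      assume h: "\<alpha>' - \<beta>' = - (\<alpha> - \<beta>)"
      have "2 * \<alpha>' = 2 * \<beta>" using h that(2) by algebra
      then show ?thesis using that(2) by simp
    qed
    then show ?thesis using refl swap that(1) by auto
  qed
  have second: "reach \<alpha> \<beta> \<delta> \<alpha>' \<beta>' \<delta>'"
    if "\<delta> = \<delta>'" "(1 - (\<alpha>' + \<beta>' - \<gamma> - \<delta>' + 1))\<^sup>2 = (1 - (\<alpha> + \<beta> - \<gamma> - \<delta> + 1))\<^sup>2" "(\<alpha>' - \<beta>')\<^sup>2 = (\<alpha> - \<beta>)\<^sup>2"
    for \<alpha> \<beta> \<delta>
  proof -
    define \<epsilon> where "\<epsilon> = \<alpha> + \<beta> - \<gamma> - \<delta> + 1"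
    have "1 - (\<alpha>' + \<beta>' - \<gamma> - \<delta>' + 1) = 1 - \<epsilon> \<or> 1 - (\<alpha>' + \<beta>' - \<gamma> - \<delta>' + 1) = - (1 - \<epsilon>)"
      using that(2) by (simp only: power2_eq_iff \<epsilon>_def)
    then show ?thesis
    proof
      assume "1 - (\<alpha>' + \<beta>' - \<gamma> - \<delta>' + 1) = 1 - \<epsilon>"
      then have "\<alpha> + \<beta> = \<alpha>' + \<beta>'" using that(1) unfolding \<epsilon>_def by algebra
      then show ?thesis using final that by blast
    next
      assume h: "1 - (\<alpha>' + \<beta>' - \<gamma> - \<delta>' + 1) = - (1 - \<epsilon>)"
      have "reach (\<beta> - \<epsilon> + 1) (\<alpha> - \<epsilon> + 1) \<delta> \<alpha>' \<beta>' \<delta>'"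
      proof (rule final)
        show "(\<beta> - \<epsilon> + 1) + (\<alpha> - \<epsilon> + 1) = \<alpha>' + \<beta>'" using h that(1) unfolding \<epsilon>_def by algebra
        show "(\<alpha>' - \<beta>')\<^sup>2 = (\<beta> - \<epsilon> + 1 - (\<alpha> - \<epsilon> + 1))\<^sup>2" using that(3) by (simp add: power2_commute)
      qed (rule that(1))
      then show ?thesis using trans[OF a_[OF \<epsilon>_def]] by blast
    qed
  qed
  have "reach \<alpha> \<beta> \<delta> \<alpha>' \<beta>' \<delta>'"
  proof -
    have "1 - \<delta>' = 1 - \<delta> \<or> 1 - \<delta>' = - (1 - \<delta>)" using sq(1) by (simp only: power2_eq_iff)
    then show ?thesis
    proof
      assume "1 - \<delta>' = 1 - \<delta>"
      then show ?thesis using second sq by simp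
    next
      assume h: "1 - \<delta>' = - (1 - \<delta>)"
      then have \<delta>': "\<delta>' = 2 - \<delta>" by algebra
      have "reach (\<beta> - \<delta> + 1) (\<alpha> - \<delta> + 1) (2 - \<delta>) \<alpha>' \<beta>' \<delta>'"
      proof (rule second)
        have "\<beta> - \<delta> + 1 + (\<alpha> - \<delta> + 1) - \<gamma> - (2 - \<delta>) + 1 = \<alpha> + \<beta> - \<gamma> - \<delta> + 1" by simp
        then show "(1 - (\<alpha>' + \<beta>' - \<gamma> - \<delta>' + 1))\<^sup>2 =
            (1 - (\<beta> - \<delta> + 1 + (\<alpha> - \<delta> + 1) - \<gamma> - (2 - \<delta>) + 1))\<^sup>2" using sq(2) by (simp only:)
        show "(\<alpha>' - \<beta>')\<^sup>2 = (\<beta> - \<delta> + 1 - (\<alpha> - \<delta> + 1))\<^sup>2" using sq(3) by (simp add: power2_commute)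
      qed (simp add: \<delta>')
      then show ?thesis using trans[OF one] by blast
    qed
  qed
  then show ?thesis unfolding reach_def .
qed

definition half_differences :: "complex \<Rightarrow> complex \<Rightarrow> complex \<Rightarrow> complex \<Rightarrow> bool" where
  "half_differences \<alpha> \<beta> \<gamma> \<delta> \<longleftrightarrow>
     (1 - \<delta>)\<^sup>2 = 1/4 \<and> (1 - (\<alpha> + \<beta> - \<gamma> - \<delta> + 1))\<^sup>2 = 1/4 \<and> (\<alpha> - \<beta>)\<^sup>2 = 1/4"

text \<open>The Moebius transformations permute the exponent differences at \<open>1\<close>, \<open>a\<close> and \<open>\<infinity>\<close>. The new
  exponents do not depend on \<open>q\<close>, and every \<open>q'\<close> is attained, so that \<open>q\<close> can be adjusted at the
  end.\<close>

definition moebius_moves :: "complex \<Rightarrow> complex \<Rightarrow> (complex \<Rightarrow> complex) \<Rightarrow> complex \<Rightarrow> bool" where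
  "moebius_moves \<gamma> a \<psi> a' \<longleftrightarrow> (\<forall>\<alpha> \<beta> \<delta>. half_differences \<alpha> \<beta> \<gamma> \<delta> \<longrightarrow>
     (\<exists>\<alpha>' \<beta>' \<delta>'. half_differences \<alpha>' \<beta>' \<gamma> \<delta>' \<and>
       (\<forall>q'. \<exists>q l. moebius_F (Heun a q \<alpha> \<beta> \<gamma> \<delta>) l \<psi> (Heun a' q' \<alpha>' \<beta>' \<gamma> \<delta>'))))"

lemma moebius_moves_ident: "moebius_moves \<gamma> a (\<lambda>x. x) a"
  unfolding moebius_moves_def using ident by blast

lemma moebius_moves_compose:
  assumes "moebius_moves \<gamma> a \<psi> a1" "moebius_moves \<gamma> a1 \<rho> a2"
  shows "moebius_moves \<gamma> a (\<lambda>x. \<rho> (\<psi> x)) a2"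
  unfolding moebius_moves_def
proof (intro allI impI)
  fix \<alpha> \<beta> \<delta> assume "half_differences \<alpha> \<beta> \<gamma> \<delta>"
  then obtain \<alpha>1 \<beta>1 \<delta>1 where 1: "half_differences \<alpha>1 \<beta>1 \<gamma> \<delta>1"
    "\<And>q'. \<exists>q l. moebius_F (Heun a q \<alpha> \<beta> \<gamma> \<delta>) l \<psi> (Heun a1 q' \<alpha>1 \<beta>1 \<gamma> \<delta>1)"
    using assms(1) unfolding moebius_moves_def by blast
  then obtain \<alpha>2 \<beta>2 \<delta>2 where 2: "half_differences \<alpha>2 \<beta>2 \<gamma> \<delta>2"
    "\<And>q'. \<exists>q l. moebius_F (Heun a1 q \<alpha>1 \<beta>1 \<gamma> \<delta>1) l \<rho> (Heun a2 q' \<alpha>2 \<beta>2 \<gamma> \<delta>2)"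
    using assms(2) unfolding moebius_moves_def by blast
  have "\<exists>q l. moebius_F (Heun a q \<alpha> \<beta> \<gamma> \<delta>) l (\<lambda>x. \<rho> (\<psi> x)) (Heun a2 q' \<alpha>2 \<beta>2 \<gamma> \<delta>2)" for q'
    using 1(2) 2(2)[of q'] compose by metis
  then show "\<exists>\<alpha>' \<beta>' \<delta>'. half_differences \<alpha>' \<beta>' \<gamma> \<delta>' \<and>
      (\<forall>q'. \<exists>q l. moebius_F (Heun a q \<alpha> \<beta> \<gamma> \<delta>) l (\<lambda>x. \<rho> (\<psi> x)) (Heun a2 q' \<alpha>' \<beta>' \<gamma> \<delta>'))"
    using 2(1) by blast
qed

lemma moebius_moves_1:
  assumes "a \<noteq> 1"
  shows "moebius_moves \<gamma> a (\<lambda>x. x / (x - 1)) (a / (a - 1))"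
  unfolding moebius_moves_def
proof (intro allI impI)
  fix \<alpha> \<beta> \<delta> assume h: "half_differences \<alpha> \<beta> \<gamma> \<delta>"
  have "half_differences \<alpha> (\<alpha> - \<delta> + 1) \<gamma> (\<alpha> - \<beta> + 1)"
  proof -
    have "1 - (\<alpha> - \<beta> + 1) = - (\<alpha> - \<beta>)" "\<alpha> - (\<alpha> - \<delta> + 1) = - (1 - \<delta>)"
      "\<alpha> + (\<alpha> - \<delta> + 1) - \<gamma> - (\<alpha> - \<beta> + 1) + 1 = \<alpha> + \<beta> - \<gamma> - \<delta> + 1" by auto
    then show ?thesis using h unfolding half_differences_def by (simp only: power2_minus)
  qed
  moreover have "\<exists>q l. moebius_F (Heun a q \<alpha> \<beta> \<gamma> \<delta>) l (\<lambda>x. x / (x - 1))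
      (Heun (a / (a - 1)) q' \<alpha> (\<alpha> - \<delta> + 1) \<gamma> (\<alpha> - \<beta> + 1))" for q'
  proof -
    have "(- (\<gamma> * \<alpha> * a - q' * (a - 1)) + \<gamma> * \<alpha> * a) / (a - 1) = q'" using assms by simp
    then show ?thesis using moebius1[of a "\<gamma> * \<alpha> * a - q' * (a - 1)" \<alpha> \<beta> \<gamma> \<delta>] by metis
  qed
  ultimately show "\<exists>\<alpha>' \<beta>' \<delta>'. half_differences \<alpha>' \<beta>' \<gamma> \<delta>' \<and>
      (\<forall>q'. \<exists>q l. moebius_F (Heun a q \<alpha> \<beta> \<gamma> \<delta>) l (\<lambda>x. x / (x - 1)) (Heun (a / (a - 1)) q' \<alpha>' \<beta>' \<gamma> \<delta>'))"
    by blast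
qed

lemma moebius_moves_2:
  assumes "a \<noteq> 0"
  shows "moebius_moves \<gamma> a (\<lambda>x. x / a) (1 / a)"
  unfolding moebius_moves_def
proof (intro allI impI)
  fix \<alpha> \<beta> \<delta> assume h: "half_differences \<alpha> \<beta> \<gamma> \<delta>"
  have 1: "half_differences \<alpha> \<beta> \<gamma> (\<alpha> + \<beta> - \<gamma> - \<delta> + 1)"
  proof -
    have "\<alpha> + \<beta> - \<gamma> - (\<alpha> + \<beta> - \<gamma> - \<delta> + 1) + 1 = \<delta>" by auto
    then show ?thesis using h unfolding half_differences_def by (simp only:)
  qed
  have 2: "\<exists>q l. moebius_F (Heun a q \<alpha> \<beta> \<gamma> \<delta>) l (\<lambda>x. x / a)
      (Heun (1 / a) q' \<alpha> \<beta> \<gamma> (\<alpha> + \<beta> - \<gamma> - \<delta> + 1))" for q'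
  proof -
    have "q' * a / a = q'" using assms by simp
    then show ?thesis using moebius2[of a "q' * a" \<alpha> \<beta> \<gamma> \<delta>] by metis
  qed
  show "\<exists>\<alpha>' \<beta>' \<delta>'. half_differences \<alpha>' \<beta>' \<gamma> \<delta>' \<and>
      (\<forall>q'. \<exists>q l. moebius_F (Heun a q \<alpha> \<beta> \<gamma> \<delta>) l (\<lambda>x. x / a) (Heun (1 / a) q' \<alpha>' \<beta>' \<gamma> \<delta>'))"
    by (intro exI[of _ \<alpha>] exI[of _ \<beta>] exI[of _ "\<alpha> + \<beta> - \<gamma> - \<delta> + 1"] conjI allI 1 2)
qed

section \<open>The maps of the biquadratic transformation\<close>

lemma deriv2_open:
  fixes f :: "complex \<Rightarrow> complex"
  assumes "open U" "x \<in> U" "\<And>y. y \<in> U \<Longrightarrow> (f has_field_derivative f' y) (at y)"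
    "(f' has_field_derivative f'') (at x)"
  shows "deriv f x = f' x" "deriv (deriv f) x = f''"
proof -
  have "\<forall>\<^sub>F y in nhds x. y \<in> U" using assms(1,2) by (rule eventually_nhds_in_open)
  then have "\<forall>\<^sub>F y in nhds x. deriv f y = f' y"
    by eventually_elim (rule DERIV_imp_deriv[OF assms(3)])
  then have "deriv (deriv f) x = deriv f' x" by (rule deriv_cong_ev) simp
  then show "deriv (deriv f) x = f''" using DERIV_imp_deriv[OF assms(4)] by simp
  show "deriv f x = f' x" by (rule DERIV_imp_deriv[OF assms(3)[OF assms(2)]])
qed

text \<open>A lift of a Heun equation needs the map only through the logarithmic derivatives of \<open>R\<close>, \<open>R - 1\<close>, \<open>R - a\<close>
and \<open>R'\<close>, and through one quotient for the second coefficient.\<close>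

lemma ode_at_lift_heun:
  assumes "deriv R x / R x = L0" "deriv R x / (R x - 1) = L1" "deriv R x / (R x - par_a p) = La"
    "deriv (deriv R) x / deriv R x = \<rho>" "(deriv R x)\<^sup>2 / (R x * (R x - 1) * (R x - par_a p)) = M"
    "deriv \<eta> x = \<eta>'"
    and P: "par_gamma p * L0 + par_delta p * L1 + par_epsilon p * La - \<rho> - 2 * \<eta> x = fst E x"
    and Q: "(par_alpha p * par_beta p * R x - par_q p) * M - (fst E x + 2 * \<eta> x) * \<eta> x + (\<eta> x)\<^sup>2 - \<eta>' = snd E x"
  shows "ode_at (ode_rescale \<eta> (ode_pullback R (heun_ode p))) x = ode_at E x"
proof -
  let ?F = "ode_pullback R (heun_ode p)"
  have 1: "fst ?F x = par_gamma p * L0 + par_delta p * L1 + par_epsilon p * La - \<rho>"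
    unfolding assms(1-4)[symmetric] by (simp add: ode_pullback_def heun_ode_def distrib_right)
  have 2: "snd ?F x = (par_alpha p * par_beta p * R x - par_q p) * M"
    unfolding assms(5)[symmetric] by (simp add: ode_pullback_def heun_ode_def)
  have "fst ?F x = fst E x + 2 * \<eta> x" using 1 P by (simp add: algebra_simps)
  then show ?thesis unfolding ode_at_eq_iff ode_rescale_def fst_conv snd_conv using 2 Q assms(6) by simp
qed

lemma rat_fun_quartic_map:
  "rat_fun (quartic_map a) x = 4 * a * x * (1 - x) * (a - x) / (a - x\<^sup>2)\<^sup>2"
proof -
  have "poly (fst (quartic_map a)) x = 4 * a * x * (1 - x) * (a - x)"
    unfolding quartic_map_def fst_conv poly_mult by simp
  moreover have "poly (snd (quartic_map a)) x = (a - x\<^sup>2)\<^sup>2"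
    unfolding quartic_map_def snd_conv poly_power by (simp add: power2_eq_square)
  ultimately show ?thesis by (simp add: rat_fun_def)
qed

lemma quartic_map_minus_1:
  assumes "x\<^sup>2 \<noteq> a"
  shows "rat_fun (quartic_map a) x = 1 - (a - 2 * a * x + x\<^sup>2)\<^sup>2 / (a - x\<^sup>2)\<^sup>2"
proof -
  have "4 * a * x * (1 - x) * (a - x) = (a - x\<^sup>2)\<^sup>2 - (a - 2 * a * x + x\<^sup>2)\<^sup>2" by algebra
  then show ?thesis using assms by (simp add: rat_fun_quartic_map diff_divide_distrib)
qed

lemma quartic_map_minus_a:
  assumes "x\<^sup>2 \<noteq> a"
  shows "rat_fun (quartic_map a) x = a - a * (a - 2 * x + x\<^sup>2)\<^sup>2 / (a - x\<^sup>2)\<^sup>2"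
proof -
  have "4 * a * x * (1 - x) * (a - x) = a * (a - x\<^sup>2)\<^sup>2 - a * (a - 2 * x + x\<^sup>2)\<^sup>2" by algebra
  then show ?thesis using assms by (simp add: rat_fun_quartic_map diff_divide_distrib)
qed

lemma deriv_quartic_map:
  assumes "x\<^sup>2 \<noteq> a"
  shows "rat_fun (quartic_map a) analytic_on {x}"
    "deriv (rat_fun (quartic_map a)) x = 4 * a * (a - 2 * a * x + x\<^sup>2) * (a - 2 * x + x\<^sup>2) / (a - x\<^sup>2) ^ 3"
    "deriv (deriv (rat_fun (quartic_map a))) x =
      (4 * a * ((2 * x - 2 * a) * (a - 2 * x + x\<^sup>2) + (a - 2 * a * x + x\<^sup>2) * (2 * x - 2)) * (a - x\<^sup>2)
       + 24 * a * x * (a - 2 * a * x + x\<^sup>2) * (a - 2 * x + x\<^sup>2)) / (a - x\<^sup>2) ^ 4"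
proof -
  let ?S = "rat_fun (quartic_map a)"
  let ?S' = "\<lambda>x. 4 * a * (a - 2 * a * x + x\<^sup>2) * (a - 2 * x + x\<^sup>2) / (a - x\<^sup>2) ^ 3"
  let ?U = "{x. a - x\<^sup>2 \<noteq> 0}"
  have S: "?S = (\<lambda>x. 4 * a * x * (1 - x) * (a - x) / (a - x\<^sup>2)\<^sup>2)"
    by (rule ext) (rule rat_fun_quartic_map)
  have U: "open ?U" "x \<in> ?U"
    using assms by (auto intro!: open_Collect_neq continuous_intros)
  have 1: "(?S has_field_derivative ?S' y) (at y)" if "y \<in> ?U" for y
  proof -
    define D where "D = a - y\<^sup>2"
    have D: "D \<noteq> 0" using that by (simp add: D_def)
    have N: "((\<lambda>x. 4 * a * x * (1 - x) * (a - x)) has_field_derivative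
        4 * a * ((1 - y) * (a - y) - y * (a - y) - y * (1 - y))) (at y)"
      by (auto intro!: derivative_eq_intros simp: algebra_simps)
    have Dd: "((\<lambda>x. (a - x\<^sup>2)\<^sup>2) has_field_derivative - 4 * y * D) (at y)"
      by (auto intro!: derivative_eq_intros simp: D_def)
    have "(?S has_field_derivative
        (4 * a * ((1 - y) * (a - y) - y * (a - y) - y * (1 - y)) * D\<^sup>2 -
         4 * a * y * (1 - y) * (a - y) * (- 4 * y * D)) / (D\<^sup>2 * D\<^sup>2)) (at y)"
      unfolding S using DERIV_divide[OF N Dd] D unfolding D_def by simp
    also have "(4 * a * ((1 - y) * (a - y) - y * (a - y) - y * (1 - y)) * D\<^sup>2 -
         4 * a * y * (1 - y) * (a - y) * (- 4 * y * D)) / (D\<^sup>2 * D\<^sup>2) =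
        (4 * a * (((1 - y) * (a - y) - y * (a - y) - y * (1 - y)) * D + 4 * y * y * (1 - y) * (a - y))) / D ^ 3"
      using D by (simp add: divide_simps power2_eq_square power3_eq_cube) (simp add: algebra_simps)
    also have "((1 - y) * (a - y) - y * (a - y) - y * (1 - y)) * D + 4 * y * y * (1 - y) * (a - y) =
        (a - 2 * a * y + y\<^sup>2) * (a - 2 * y + y\<^sup>2)"
      unfolding D_def by algebra
    finally show ?thesis unfolding D_def by (simp add: mult.assoc)
  qed
  have 2: "(?S' has_field_derivative
      (4 * a * ((2 * x - 2 * a) * (a - 2 * x + x\<^sup>2) + (a - 2 * a * x + x\<^sup>2) * (2 * x - 2)) * (a - x\<^sup>2)
       + 24 * a * x * (a - 2 * a * x + x\<^sup>2) * (a - 2 * x + x\<^sup>2)) / (a - x\<^sup>2) ^ 4) (at x)"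
  proof -
    define D F G where defs: "D = a - x\<^sup>2" "F = a - 2 * a * x + x\<^sup>2" "G = a - 2 * x + x\<^sup>2"
    have D: "D \<noteq> 0" using assms by (simp add: defs)
    have N: "((\<lambda>x. 4 * a * (a - 2 * a * x + x\<^sup>2) * (a - 2 * x + x\<^sup>2)) has_field_derivative
        4 * a * ((2 * x - 2 * a) * G + F * (2 * x - 2))) (at x)"
      unfolding defs by (auto intro!: derivative_eq_intros simp: algebra_simps eval_nat_numeral)
    have Dd: "((\<lambda>x. (a - x\<^sup>2) ^ 3) has_field_derivative - 6 * x * D\<^sup>2) (at x)"
      unfolding defs by (auto intro!: derivative_eq_intros)
    have "(?S' has_field_derivative (4 * a * ((2 * x - 2 * a) * G + F * (2 * x - 2)) * D ^ 3 -
        4 * a * F * G * (- 6 * x * D\<^sup>2)) / (D ^ 3 * D ^ 3)) (at x)"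
      using DERIV_divide[OF N Dd] D unfolding defs by simp
    also have "(4 * a * ((2 * x - 2 * a) * G + F * (2 * x - 2)) * D ^ 3 -
        4 * a * F * G * (- 6 * x * D\<^sup>2)) / (D ^ 3 * D ^ 3) =
        (4 * a * ((2 * x - 2 * a) * G + F * (2 * x - 2)) * D + 24 * a * x * F * G) / D ^ 4"
      using D by (simp add: divide_simps eval_nat_numeral) (simp add: algebra_simps)
    finally show ?thesis unfolding defs .
  qed
  show "deriv ?S x = ?S' x" "deriv (deriv ?S) x =
      (4 * a * ((2 * x - 2 * a) * (a - 2 * x + x\<^sup>2) + (a - 2 * a * x + x\<^sup>2) * (2 * x - 2)) * (a - x\<^sup>2)
       + 24 * a * x * (a - 2 * a * x + x\<^sup>2) * (a - 2 * x + x\<^sup>2)) / (a - x\<^sup>2) ^ 4"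
    using deriv2_open[OF U 1 2] by auto
  show "?S analytic_on {x}" unfolding S using assms by (auto intro!: analytic_intros)
qed

text \<open>As \<open>S\<close>, \<open>S - 1\<close> and \<open>S - a\<close> are, up to constants, \<open>x (1 - x) (a - x) / D\<^sup>2\<close>, \<open>F\<^sup>2 / D\<^sup>2\<close> and \<open>G\<^sup>2 / D\<^sup>2\<close>, their
logarithmic derivatives are sums of logarithmic derivatives of polynomials. The poles at the zeros of \<open>F\<close>
and \<open>G\<close> cancel against those of \<open>S'' / S'\<close>, because the exponent differences below are \<open>1/2\<close>; those
at the zeros of \<open>D\<close> are removed by the prefactor.\<close>

lemma ode_at_quartic_lift:
  assumes a: "a \<noteq> 0" and x: "x \<noteq> 0" "x \<noteq> 1" "x \<noteq> a" "x\<^sup>2 \<noteq> a"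
    "a - 2 * a * x + x\<^sup>2 \<noteq> 0" "a - 2 * x + x\<^sup>2 \<noteq> 0"
  shows "ode_at (ode_rescale (\<lambda>x. (2 * \<gamma> - 1) * x / (a - x\<^sup>2))
      (ode_pullback (rat_fun (quartic_map a)) (heun_ode (quartic_target a q \<gamma>)))) x =
    ode_at (heun_ode (quartic_source a q \<gamma>)) x"
proof -
  let ?S = "rat_fun (quartic_map a)"
  define D F G where defs: "D = a - x\<^sup>2" "F = a - 2 * a * x + x\<^sup>2" "G = a - 2 * x + x\<^sup>2"
  have nz: "D \<noteq> 0" "F \<noteq> 0" "G \<noteq> 0" "1 - x \<noteq> 0" "a - x \<noteq> 0" "x - 1 \<noteq> 0" "x - a \<noteq> 0"
    using x by (auto simp: defs)
  have S: "?S x = 4 * a * x * (1 - x) * (a - x) / D\<^sup>2"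
    by (simp add: rat_fun_quartic_map defs)
  have S1: "?S x - 1 = - (F\<^sup>2 / D\<^sup>2)" using quartic_map_minus_1[OF x(4)] by (simp add: defs)
  have Sa: "?S x - a = - (a * G\<^sup>2 / D\<^sup>2)" using quartic_map_minus_a[OF x(4)] by (simp add: defs)
  have S': "deriv ?S x = 4 * a * F * G / D ^ 3"
    using deriv_quartic_map(2)[OF x(4)] by (simp add: defs)
  have S'': "deriv (deriv ?S) x =
      (4 * a * ((2 * x - 2 * a) * G + F * (2 * x - 2)) * D + 24 * a * x * F * G) / D ^ 4"
    using deriv_quartic_map(3)[OF x(4)] by (simp add: defs)
  have L0: "deriv ?S x / ?S x = 1 / x + 1 / (x - 1) + 1 / (x - a) + 4 * x / D"
  proof -
    have "deriv ?S x / ?S x = F * G / (x * (1 - x) * (a - x) * D)"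
      unfolding S S' using a x(1) nz by (simp add: divide_simps power2_eq_square power3_eq_cube)
    also have "F * G = (x - 1) * (x - a) * D + x * (x - a) * D + x * (x - 1) * D + 4 * x * (x * (x - 1) * (x - a))"
      unfolding defs by algebra
    also have "x * (1 - x) * (a - x) * D = x * (x - 1) * (x - a) * D" by algebra
    finally show ?thesis using nz x(1) by (simp add: add_divide_distrib)
  qed
  have L1: "deriv ?S x / (?S x - 1) = 2 * (2 * x - 2 * a) / F + 4 * x / D"
  proof -
    have "deriv ?S x / (?S x - 1) = - (4 * a * G) / (F * D)"
      unfolding S1 S' using a nz by (simp add: divide_simps power2_eq_square power3_eq_cube)
    also have "- (4 * a * G) = 2 * (2 * x - 2 * a) * D + 4 * x * F" unfolding defs by algebra
    finally show ?thesis using nz by (simp add: add_divide_distrib)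
  qed
  have La: "deriv ?S x / (?S x - par_a (quartic_target a q \<gamma>)) = 2 * (2 * x - 2) / G + 4 * x / D"
  proof -
    have "deriv ?S x / (?S x - a) = - (4 * F) / (G * D)"
      unfolding Sa S' using a nz by (simp add: divide_simps power2_eq_square power3_eq_cube)
    also have "- (4 * F) = 2 * (2 * x - 2) * D + 4 * x * G" unfolding defs by algebra
    finally show ?thesis using nz by (simp add: add_divide_distrib quartic_target_def)
  qed
  have \<rho>: "deriv (deriv ?S) x / deriv ?S x = (2 * x - 2 * a) / F + (2 * x - 2) / G + 6 * x / D"
    unfolding S' S'' using a nz by (simp add: divide_simps eval_nat_numeral) (simp add: algebra_simps)
  have M: "(deriv ?S x)\<^sup>2 / (?S x * (?S x - 1) * (?S x - par_a (quartic_target a q \<gamma>))) =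
      4 / (x * (x - 1) * (x - a))"
  proof -
    have "(deriv ?S x)\<^sup>2 / (?S x * (?S x - 1) * (?S x - a)) = 4 / (x * (1 - x) * (a - x))"
      unfolding S1 Sa S' unfolding S using a x(1) nz by (simp add: divide_simps eval_nat_numeral)
    also have "x * (1 - x) * (a - x) = x * (x - 1) * (x - a)" by algebra
    finally show ?thesis by (simp add: quartic_target_def)
  qed
  have \<eta>': "deriv (\<lambda>x. (2 * \<gamma> - 1) * x / (a - x\<^sup>2)) x = (2 * \<gamma> - 1) * (a + x\<^sup>2) / D\<^sup>2"
  proof (rule DERIV_imp_deriv)
    show "((\<lambda>x. (2 * \<gamma> - 1) * x / (a - x\<^sup>2)) has_field_derivative (2 * \<gamma> - 1) * (a + x\<^sup>2) / D\<^sup>2) (at x)"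
      using x(4) unfolding defs
      by (auto intro!: derivative_eq_intros simp: power2_eq_square algebra_simps)
  qed
  define T where "T = 1 / x + 1 / (x - 1) + 1 / (x - a)"
  have src: "fst (heun_ode (quartic_source a q \<gamma>)) x = \<gamma> * T"
    "snd (heun_ode (quartic_source a q \<gamma>)) x = ((2 * \<gamma> - 1) * \<gamma> * x - q) / (x * (x - 1) * (x - a))"
    by (simp_all add: quartic_source_def heun_ode_def par_epsilon_def T_def distrib_left)
  show ?thesis
  proof (rule ode_at_lift_heun[OF L0 L1 La \<rho> M \<eta>'], goal_cases)
    case 1
    have "\<gamma> * (T + 4 * X) + 1 / 2 * (2 * Y + 4 * X) + 1 / 2 * (2 * Z + 4 * X) - (Y + Z + 6 * X)
        - 2 * ((2 * \<gamma> - 1) * X) = \<gamma> * T" for X Y Z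
      by (simp add: algebra_simps)
    from this[of "x / D" "(2 * x - 2 * a) / F" "(2 * x - 2) / G"]
    show ?case unfolding src by (simp add: quartic_target_def par_epsilon_def T_def flip: defs)
  next
    case 2
    have "x * T = 1 + x / (x - 1) + x / (x - a)" unfolding T_def using x(1) by (simp add: distrib_left)
    also have "\<dots> = 2 - D / ((x - 1) * (x - a))"
      unfolding defs using nz by (simp add: divide_simps) algebra
    finally have xT: "x * T = 2 - D / ((x - 1) * (x - a))" .
    have "((\<gamma> / 2 - 1 / 4) * (\<gamma> / 2 + 1 / 4) * ?S x - q / 4) * (4 / (x * (x - 1) * (x - a))) =
        (4 * \<gamma>\<^sup>2 - 1) * a / D\<^sup>2 - q / (x * (x - 1) * (x - a))"
    proof -
      have "(1 - x) * (a - x) = (x - 1) * (x - a)" by algebra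
      then have "?S x = 4 * a * (x * (x - 1) * (x - a)) / D\<^sup>2" unfolding S by (simp add: mult.assoc)
      note Sx = this
      have e: "(\<gamma> / 2 - 1 / 4) * (\<gamma> / 2 + 1 / 4) = (4 * \<gamma>\<^sup>2 - 1) / 16"
        by (simp add: power2_eq_square algebra_simps)
      have W: "x * (x - 1) * (x - a) \<noteq> 0" using x(1) nz by simp
      have "(c / 16 * (4 * a * W / D\<^sup>2) - q / 4) * (4 / W) = c * a / D\<^sup>2 - q / W" if "W \<noteq> 0" for c W
        using that by (simp add: diff_divide_distrib mult.commute)
      from this[OF W] show ?thesis unfolding Sx e .
    qed
    moreover have "(4 * \<gamma>\<^sup>2 - 1) * a / D\<^sup>2 - (\<gamma> * T + 2 * ((2 * \<gamma> - 1) * x / D)) * ((2 * \<gamma> - 1) * x / D)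
        + ((2 * \<gamma> - 1) * x / D)\<^sup>2 - (2 * \<gamma> - 1) * (a + x\<^sup>2) / D\<^sup>2 = (2 * \<gamma> - 1) * \<gamma> / ((x - 1) * (x - a))"
    proof -
      have "(4 * \<gamma>\<^sup>2 - 1) * a / D\<^sup>2 - (\<gamma> * T + 2 * ((2 * \<gamma> - 1) * x / D)) * ((2 * \<gamma> - 1) * x / D)
        + ((2 * \<gamma> - 1) * x / D)\<^sup>2 - (2 * \<gamma> - 1) * (a + x\<^sup>2) / D\<^sup>2 =
        ((4 * \<gamma>\<^sup>2 - 1) * a - (2 * \<gamma> - 1)\<^sup>2 * x\<^sup>2 - (2 * \<gamma> - 1) * (a + x\<^sup>2)) / D\<^sup>2 - (2 * \<gamma> - 1) * \<gamma> * (x * T) / D"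
        by (simp add: power2_eq_square add_divide_distrib diff_divide_distrib algebra_simps)
      also have "(4 * \<gamma>\<^sup>2 - 1) * a - (2 * \<gamma> - 1)\<^sup>2 * x\<^sup>2 - (2 * \<gamma> - 1) * (a + x\<^sup>2) = 2 * \<gamma> * (2 * \<gamma> - 1) * D"
        unfolding defs by algebra
      also have "2 * \<gamma> * (2 * \<gamma> - 1) * D / D\<^sup>2 - (2 * \<gamma> - 1) * \<gamma> * (x * T) / D =
        (2 * \<gamma> - 1) * \<gamma> * (2 - x * T) / D"
        using nz by (simp add: power2_eq_square add_divide_distrib diff_divide_distrib algebra_simps)
      also have "\<dots> = (2 * \<gamma> - 1) * \<gamma> / ((x - 1) * (x - a))" unfolding xT using nz by simp
      finally show ?thesis .
    qed
    moreover have "(2 * \<gamma> - 1) * \<gamma> / ((x - 1) * (x - a)) - q / (x * (x - 1) * (x - a)) =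
        ((2 * \<gamma> - 1) * \<gamma> * x - q) / (x * (x - 1) * (x - a))"
      using x(1) by (simp add: diff_divide_distrib)
    ultimately show ?case unfolding src by (simp add: quartic_target_def flip: defs) algebra?
  qed
qed

lemma normalized_lift_quartic:
  assumes a: "a \<noteq> 0" "a \<noteq> 1"
  shows "normalized_lift (quartic_source a q \<gamma>) (quartic_prefactor a \<gamma>) (rat_fun (quartic_map a))
    (quartic_target a q \<gamma>)"
proof -
  let ?S = "rat_fun (quartic_map a)" and ?h = "quartic_prefactor a \<gamma>"
  let ?\<eta> = "\<lambda>x. (2 * \<gamma> - 1) * x / (a - x\<^sup>2)"
  have 0: "0\<^sup>2 \<noteq> a" using a by simp
  have h: "?h = (\<lambda>x. (1 - x\<^sup>2 / a) powr (- \<gamma> + 1/2))" by (rule ext) (simp add: quartic_prefactor_def)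
  have ne: "\<forall>\<^sub>F x in at 0. f x \<noteq> 0" if "isCont f 0" "f 0 \<noteq> 0" for f :: "complex \<Rightarrow> complex"
    using tendsto_imp_eventually_ne[OF isContD[OF that(1)] that(2)] .
  have "\<forall>\<^sub>F x in at 0. a - x\<^sup>2 \<noteq> 0" "\<forall>\<^sub>F x in at 0. a - 2 * a * x + x\<^sup>2 \<noteq> 0" "\<forall>\<^sub>F x in at 0. a - 2 * x + x\<^sup>2 \<noteq> 0"
    by (rule ne; use a in \<open>auto intro!: continuous_intros\<close>)+
  note ev = this
  have "germ_lift (heun_ode (quartic_source a q \<gamma>)) ?\<eta> ?S (heun_ode (quartic_target a q \<gamma>))"
    unfolding germ_lift_def using ev eventually_at_0_regular[of a]
    by eventually_elim (use a in \<open>auto intro!: ode_at_quartic_lift\<close>)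
  moreover have "\<forall>\<^sub>F x in at 0. ?\<eta> x = deriv ?h x / ?h x"
  proof -
    let ?g = "\<lambda>y. (1 - y) powr (- \<gamma> + 1/2)"
    have "filterlim (\<lambda>x. x\<^sup>2 / a) (at 0) (at 0)"
      using a eventually_neq_at_within[of "0::complex" 0]
      by (auto simp: filterlim_at intro!: tendsto_eq_intros elim!: eventually_mono)
    from eventually_compose_filterlim[OF log_deriv_powr(3)[of "- \<gamma> + 1/2"] this]
      eventually_compose_filterlim[OF eventually_at_analytic_at[OF log_deriv_powr(1)[of "- \<gamma> + 1/2"]] this]
    show ?thesis using ev(1)
    proof eventually_elim
      case (elim x)
      have "(\<lambda>x. x\<^sup>2 / a) analytic_on {x}" using a by (auto intro!: analytic_intros)
      from deriv_compose_at[OF this elim(2)]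
      have "deriv ?h x = deriv ?g (x\<^sup>2 / a) * deriv (\<lambda>x. x\<^sup>2 / a) x" unfolding h .
      also have "deriv (\<lambda>x. x\<^sup>2 / a) x = 2 * x / a"
        by (rule DERIV_imp_deriv) (use a in \<open>auto intro!: derivative_eq_intros\<close>)
      finally have "deriv ?h x / ?h x = deriv ?g (x\<^sup>2 / a) / ?g (x\<^sup>2 / a) * (2 * x / a)"
        by (simp add: h)
      also have "\<dots> = (- \<gamma> + 1/2) / (x\<^sup>2 / a - 1) * (2 * x / a)" unfolding elim(1) ..
      also have "x\<^sup>2 / a - 1 = - ((a - x\<^sup>2) / a)" using a by (simp add: field_simps)
      also have "(- \<gamma> + 1/2) / - ((a - x\<^sup>2) / a) * (2 * x / a) = ?\<eta> x"
        using a elim(3) by (simp add: divide_simps) (simp add: algebra_simps)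
      finally show ?case by simp
    qed
  qed
  ultimately have "germ_lift (heun_ode (quartic_source a q \<gamma>)) (\<lambda>x. deriv ?h x / ?h x) ?S
      (heun_ode (quartic_target a q \<gamma>))"
    by (rule germ_lift_cong) simp
  moreover have "?h analytic_on {0}" unfolding h using a by (auto intro!: analytic_intros)
  moreover have "deriv ?S 0 \<noteq> 0" using deriv_quartic_map(2)[OF 0] a by simp
  ultimately show ?thesis
    using deriv_quartic_map(1)[OF 0] a by (simp add: normalized_lift_def rat_fun_quartic_map h)
qed

text \<open>The denominator depends on \<open>t\<close> alone, and is that of \<open>S\<close>, \<open>S / (S - 1)\<close> or \<open>S / (S - a)\<close> for \<open>t = 0\<close>, \<open>a\<close> or
\<open>1\<close>. Exchanging \<open>r\<close> and \<open>s\<close> divides the map by its critical value \<open>a' = (s - t) / (r - t)\<close>.\<close>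

lemma quartic_map_moebius:
  assumes a: "a \<noteq> 0" "a \<noteq> 1" and P: "finite_points_perm a r s t"
  obtains \<psi> where "moebius_moves \<gamma> a \<psi> ((s - t) / (r - t))"
    "\<forall>\<^sub>F x in nhds 0. 4 * (s - t) * (x * (x - 1) * (x - a)) / (x\<^sup>2 - 2 * t * x + (r * t - r * s + s * t))\<^sup>2 =
       \<psi> (rat_fun (quartic_map a) x)"
proof -
  let ?S = "rat_fun (quartic_map a)"
  let ?R = "\<lambda>r s t x. 4 * (s - t) * (x * (x - 1) * (x - a)) / (x\<^sup>2 - 2 * t * x + (r * t - r * s + s * t))\<^sup>2"
  have ne: "\<forall>\<^sub>F x in nhds 0. f x \<noteq> 0" if "isCont f 0" "f 0 \<noteq> 0" for f :: "complex \<Rightarrow> complex"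
    using tendsto_imp_eventually_ne[of f "f 0" "nhds 0"] that by (simp add: isCont_def tendsto_nhds_iff)
  have "\<forall>\<^sub>F x in nhds 0. a - x\<^sup>2 \<noteq> 0" "\<forall>\<^sub>F x in nhds 0. a - 2 * a * x + x\<^sup>2 \<noteq> 0" "\<forall>\<^sub>F x in nhds 0. a - 2 * x + x\<^sup>2 \<noteq> 0"
    by (rule ne; use a in \<open>auto intro!: continuous_intros\<close>)+
  then have ev: "\<forall>\<^sub>F x in nhds 0. a - x\<^sup>2 \<noteq> 0 \<and> a - 2 * a * x + x\<^sup>2 \<noteq> 0 \<and> a - 2 * x + x\<^sup>2 \<noteq> 0"
    by eventually_elim auto
  define A where "A = (\<lambda>x. ?S x / (?S x - 1))"
  define B where "B = (\<lambda>x. ?S x / a / (?S x / a - 1))"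
  have id: "\<forall>\<^sub>F x in nhds 0. ?S x = ?R 1 a 0 x"
  proof -
    have "?S x = ?R 1 a 0 x" for x
    proof -
      have "4 * a * x * (1 - x) * (a - x) = 4 * (a - 0) * (x * (x - 1) * (x - a))"
        "(a - x\<^sup>2)\<^sup>2 = (x\<^sup>2 - 2 * 0 * x + (1 * 0 - 1 * a + a * 0))\<^sup>2" by algebra+
      then show ?thesis by (simp only: rat_fun_quartic_map)
    qed
    then show ?thesis by simp
  qed
  have A: "\<forall>\<^sub>F x in nhds 0. A x = ?R 1 0 a x"
    using ev
  proof eventually_elim
    case (elim x)
    have "?S x - 1 = - ((a - 2 * a * x + x\<^sup>2)\<^sup>2 / (a - x\<^sup>2)\<^sup>2)"
      using quartic_map_minus_1[of x a] elim by auto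
    then have "A x = (4 * a * x * (1 - x) * (a - x)) / (a - x\<^sup>2)\<^sup>2 / - ((a - 2 * a * x + x\<^sup>2)\<^sup>2 / (a - x\<^sup>2)\<^sup>2)"
      by (simp only: A_def) (simp only: rat_fun_quartic_map)
    also have "\<dots> = - (4 * a * x * (1 - x) * (a - x)) / (a - 2 * a * x + x\<^sup>2)\<^sup>2"
      using elim by simp
    also have "- (4 * a * x * (1 - x) * (a - x)) = 4 * (0 - a) * (x * (x - 1) * (x - a))" by algebra
    also have "a - 2 * a * x + x\<^sup>2 = x\<^sup>2 - 2 * a * x + (1 * a - 1 * 0 + 0 * a)" by simp
    finally show ?case .
  qed
  have B: "\<forall>\<^sub>F x in nhds 0. B x = ?R a 0 1 x"
    using ev
  proof eventually_elim
    case (elim x)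
    have "?S x / a / (?S x / a - 1) = ?S x / (?S x - a)"
      using a by (simp add: field_simps)
    moreover have "?S x - a = - (a * (a - 2 * x + x\<^sup>2)\<^sup>2 / (a - x\<^sup>2)\<^sup>2)"
      using quartic_map_minus_a[of x a] elim by auto
    ultimately have "B x = (4 * a * x * (1 - x) * (a - x)) / (a - x\<^sup>2)\<^sup>2 / - (a * (a - 2 * x + x\<^sup>2)\<^sup>2 / (a - x\<^sup>2)\<^sup>2)"
      by (simp only: B_def) (simp only: rat_fun_quartic_map)
    also have "\<dots> = - (4 * x * (1 - x) * (a - x)) / (a - 2 * x + x\<^sup>2)\<^sup>2"
      using elim a by simp
    also have "- (4 * x * (1 - x) * (a - x)) = 4 * (0 - 1) * (x * (x - 1) * (x - a))" by algebra
    also have "a - 2 * x + x\<^sup>2 = x\<^sup>2 - 2 * 1 * x + (a * 1 - a * 0 + 0 * 1)" by simp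
    finally show ?case .
  qed
  have a1: "a / (a - 1) \<noteq> 0" "1 / a \<noteq> 1" "1 - a \<noteq> 0" "a - 1 \<noteq> 0" using a by auto
  have mA: "moebius_moves \<gamma> a (\<lambda>x. x / (x - 1)) (a / (a - 1))" by (rule moebius_moves_1[OF a(2)])
  have mI: "moebius_moves \<gamma> a (\<lambda>x. x / a) (1 / a)" by (rule moebius_moves_2[OF a(1)])
  have mB: "moebius_moves \<gamma> a (\<lambda>x. x / a / (x / a - 1)) (1 / (1 - a))"
  proof -
    have "1 / a / (1 / a - 1) = 1 / (1 - a)" using a by (simp add: field_simps)
    then show ?thesis using moebius_moves_compose[OF mI moebius_moves_1[OF a1(2)]] by simp
  qed
  consider "(r, s, t) = (1, a, 0)" | "(r, s, t) = (a, 1, 0)" | "(r, s, t) = (1, 0, a)"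
    | "(r, s, t) = (0, 1, a)" | "(r, s, t) = (a, 0, 1)" | "(r, s, t) = (0, a, 1)"
    using P unfolding finite_points_perm_def by blast
  then show thesis
  proof cases
    case 1
    show thesis
    proof (rule that)
      show "moebius_moves \<gamma> a (\<lambda>x. x) ((s - t) / (r - t))" using 1 moebius_moves_ident by simp
    qed (use id 1 in \<open>auto elim: eventually_mono\<close>)
  next
    case 2
    show thesis
    proof (rule that)
      show "moebius_moves \<gamma> a (\<lambda>x. x / a) ((s - t) / (r - t))" using 2 mI by simp
      show "\<forall>\<^sub>F x in nhds 0. ?R r s t x = ?S x / a"
        using id 2 a by (auto elim!: eventually_mono simp: mult.commute)
    qed
  next
    case 3
    show thesis
    proof (rule that)
      show "moebius_moves \<gamma> a (\<lambda>x. x / (x - 1)) ((s - t) / (r - t))"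
        using mA 3 by (simp add: minus_divide_left[symmetric] minus_divide_right)
      show "\<forall>\<^sub>F x in nhds 0. ?R r s t x = ?S x / (?S x - 1)"
        using A 3 by (auto elim!: eventually_mono simp: A_def)
    qed
  next
    case 4
    show thesis
    proof (rule that)
      have "(1 - a) / - a = 1 / (a / (a - 1))" using a a1 by (simp add: field_simps)
      then show "moebius_moves \<gamma> a (\<lambda>x. x / (x - 1) / (a / (a - 1))) ((s - t) / (r - t))"
        using moebius_moves_compose[OF mA moebius_moves_2[OF a1(1)]] 4 by simp
      have "?R 0 1 a x = ?R 1 0 a x / (a / (a - 1))" for x
      proof -
        have "0 * a - 0 * 1 + 1 * a = 1 * a - 1 * 0 + 0 * a" "4 * (1 - a) = 4 * (0 - a) / (a / (a - 1))"
          using a a1 by (auto simp: field_simps)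
        then show ?thesis by (simp only:) simp
      qed
      note R = this
      show "\<forall>\<^sub>F x in nhds 0. ?R r s t x = ?S x / (?S x - 1) / (a / (a - 1))"
        using A
      proof eventually_elim
        case (elim x)
        have rst: "r = 0" "s = 1" "t = a" using 4 by auto
        have "?R r s t x = ?R 1 0 a x / (a / (a - 1))" unfolding rst by (rule R)
        also have "?R 1 0 a x = ?S x / (?S x - 1)" using elim unfolding A_def by (rule sym)
        finally show ?case .
      qed
    qed
  next
    case 5
    show thesis
    proof (rule that)
      have "(0 - 1) / (a - 1) = 1 / (1 - a)" using a1 by (simp add: field_simps)
      then show "moebius_moves \<gamma> a (\<lambda>x. x / a / (x / a - 1)) ((s - t) / (r - t))" using mB 5 by simp
      show "\<forall>\<^sub>F x in nhds 0. ?R r s t x = ?S x / a / (?S x / a - 1)"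
        using B 5 unfolding B_def by (auto elim!: eventually_mono)
    qed
  next
    case 6
    show thesis
    proof (rule that)
      have "(a - 1) / (0 - 1) = 1 / (1 / (1 - a))" by simp
      moreover have "1 / (1 - a) \<noteq> 0" using a1 by simp
      ultimately show "moebius_moves \<gamma> a (\<lambda>x. x / a / (x / a - 1) / (1 / (1 - a))) ((s - t) / (r - t))"
        using moebius_moves_compose[OF mB moebius_moves_2] 6 by simp
      have "?R 0 a 1 x = ?R a 0 1 x / (1 / (1 - a))" for x
      proof -
        have "0 * 1 - 0 * a + a * 1 = a * 1 - a * 0 + 0 * 1" "4 * (a - 1) = 4 * (0 - 1) * (1 - a)"
          by auto
        then show ?thesis
          by (simp only: divide_inverse inverse_mult_distrib inverse_inverse_eq inverse_1 mult_1_left mult_1_right mult_ac)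
      qed
      note R = this
      show "\<forall>\<^sub>F x in nhds 0. ?R r s t x = ?S x / a / (?S x / a - 1) / (1 / (1 - a))"
        using B
      proof eventually_elim
        case (elim x)
        have rst: "r = 0" "s = a" "t = 1" using 6 by auto
        have "?R r s t x = ?R a 0 1 x / (1 / (1 - a))" unfolding rst by (rule R)
        also have "?R a 0 1 x = ?S x / a / (?S x / a - 1)" using elim unfolding B_def by (rule sym)
        finally show ?case .
      qed
    qed
  qed
qed

section \<open>The decomposition into two quadratic maps\<close>

lemma coprime_if_no_common_root:
  fixes p q :: "complex poly"
  assumes "\<And>x. poly p x = 0 \<Longrightarrow> poly q x \<noteq> 0"
  shows "coprime p q"
proof (rule coprimeI)
  fix k assume k: "k dvd p" "k dvd q"
  have no: "poly k x \<noteq> 0" for x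
    using assms[of x] k by (metis dvdE mult_zero_left poly_mult)
  then have "degree k = 0"
    using fundamental_theorem_of_algebra[of k] constant_degree[of k] by auto
  moreover have "k \<noteq> 0" using no[of 0] by auto
  ultimately show "is_unit k" by (simp add: is_unit_iff_degree)
qed

lemma order_simple_root:
  fixes f :: "complex poly"
  assumes "poly f x = 0" "poly (pderiv f) x \<noteq> 0"
  shows "order x f = 1"
proof -
  have "f \<noteq> 0" using assms(2) by auto
  then show ?thesis using order_pderiv[of f x] order_0I[OF assms(2)] assms(1) by simp
qed

lemma double_root:
  fixes f :: "complex poly"
  assumes "2 \<le> order x f"
  shows "poly f x = 0" "poly (pderiv f) x = 0"
proof -
  show 1: "poly f x = 0" using assms order_root[of f x] by auto
  show "poly (pderiv f) x = 0" using assms order_simple_root[OF 1] by fastforce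
qed

lemma cofinite_poly_nz: "p \<noteq> 0 \<Longrightarrow> \<forall>\<^sub>\<infinity>x. poly p x \<noteq> (0::complex)"
  using poly_roots_finite[of p] by (simp add: eventually_cofinite)

lemma cofinite_neq: "\<forall>\<^sub>\<infinity>x. x \<noteq> (c::complex)"
  by (simp add: eventually_cofinite)

text \<open>The lifted equations are genuine Heun equations, as each of their four points is unramified over a
singular point.\<close>

lemma heun_equation_lift:
  assumes "rat_lift (heun_ode p) \<eta> R (heun_ode p')" "heun_equation p'" "par_a p \<noteq> 0" "par_a p \<noteq> 1"
    "\<And>z. z \<in> heun_points p \<Longrightarrow> \<exists>w \<in> heun_points p'. rat_mult R w z = 1"
  shows "heun_equation p"
proof -
  have "singular_point (heun_ode p) z" if z: "z \<in> heun_points p" for z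
  proof -
    obtain w where "w \<in> heun_points p'" "rat_mult R w z = 1" using assms(5)[OF z] by blast
    then show ?thesis
      using singular_point_lift[OF assms(1) _ assms(3,4)] assms(2) unfolding heun_equation_iff by blast
  qed
  then show ?thesis using assms(3,4) by (simp add: heun_equation_iff)
qed

lemma heun_lift_intro:
  assumes "rat_lift (heun_ode p) \<eta> R (heun_ode p')" "heun_equation p" "heun_equation p'"
    "critical_values R \<subseteq> heun_points p'"
  shows "heun_lift R p p' \<eta>"
  using assms unfolding heun_lift_def rat_lift_def ode_at_eq_iff by blast

text \<open>The quotient of the sphere by the involution \<open>x \<mapsto> s\<^sup>2 / x\<close>, which exchanges \<open>0\<close> with \<open>\<infinity>\<close> and \<open>1\<close> with \<open>s\<^sup>2\<close>;
its fixed points \<open>- s\<close> and \<open>s\<close> are sent to \<open>0\<close> and \<open>1\<close>.\<close>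

definition first_map :: "complex \<Rightarrow> ratmap" where
  "first_map s = ([:s\<^sup>2, 2 * s, 1:], [:0, 4 * s:])"

text \<open>The map that \<open>S\<close> induces on the quotient; its zeros are the images of the two exchanged pairs.\<close>

definition second_map :: "complex \<Rightarrow> ratmap" where
  "second_map s = ([:- ((1 + s)\<^sup>2 / 4), s:], [:0, -1, 1:])"

lemma rat_fun_first_map: "rat_fun (first_map s) x = (x + s)\<^sup>2 / (4 * s * x)"
  by (simp add: rat_fun_def first_map_def power2_eq_square algebra_simps)

lemma rat_fun_second_map: "rat_fun (second_map s) y = (s * y - (1 + s)\<^sup>2 / 4) / (y * (y - 1))"
  by (simp add: rat_fun_def second_map_def algebra_simps)

text \<open>The intermediate equation, with exponent differences \<open>1/2\<close> at the branch points \<open>0\<close> and \<open>1\<close> of the first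
map, and \<open>1 - \<gamma>\<close> at the images \<open>a\<close> and \<open>\<infinity>\<close> of the two exchanged pairs. The number \<open>\<kappa>\<close> is the exponent
of the prefactor \<open>(y (1 - y))\<^sup>\<kappa>\<close> of the second map, and the accessory parameter is what the lift
makes of \<open>q / 4\<close>.\<close>

definition middle :: "complex \<Rightarrow> complex \<Rightarrow> complex \<Rightarrow> heun" where
  "middle s q \<gamma> = (let a = (1 + s)\<^sup>2 / (4 * s); \<kappa> = 1/4 - \<gamma> / 2 in
     Heun a (q / (4 * s) - \<kappa> * (4 * \<kappa> * a + \<gamma>)) (1/2) (\<gamma> - 1/2) (1/2) (1/2))"

lemma ode_at_second_lift:
  assumes s: "s \<noteq> 0" and y: "y \<noteq> 0" "y \<noteq> 1" "s * y \<noteq> (1 + s)\<^sup>2 / 4"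
    "y \<noteq> (1 + s) / 2" "s * y \<noteq> (1 + s) / 2" and \<kappa>: "\<kappa> = 1/4 - \<gamma> / 2"
  shows "ode_at (ode_rescale (\<lambda>y. \<kappa> / y + \<kappa> / (y - 1))
      (ode_pullback (rat_fun (second_map s)) (heun_ode (quartic_target (s\<^sup>2) q \<gamma>)))) y =
    ode_at (heun_ode (middle s q \<gamma>)) y"
proof -
  let ?R = "rat_fun (second_map s)"
  define b where "b = (1 + s) / 2"
  define W f1 f2 Z where defs: "W = y * (y - 1)" "f1 = y - b" "f2 = s * y - b" "Z = s * y - b\<^sup>2"
  have b2: "b\<^sup>2 = (1 + s)\<^sup>2 / 4" by (simp add: b_def power_divide)
  have s_b: "s = 2 * b - 1" by (simp add: b_def add_divide_distrib)
  have nz: "W \<noteq> 0" "f1 \<noteq> 0" "f2 \<noteq> 0" "Z \<noteq> 0" "y - 1 \<noteq> 0"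
    using y by (auto simp: defs b_def power_divide)
  have Rf: "?R = (\<lambda>y. (s * y - b\<^sup>2) / (y * (y - 1)))" by (rule ext) (simp add: rat_fun_second_map b2)
  let ?U = "{y. y * (y - 1) \<noteq> (0::complex)}"
  have U: "open ?U" "y \<in> ?U"
    by (intro open_Collect_neq continuous_intros) (use y in simp)
  let ?R' = "\<lambda>y. - ((y - b) * (s * y - b)) / (y * (y - 1))\<^sup>2"
  have 1: "(?R has_field_derivative ?R' y) (at y)" if "y \<in> ?U" for y
  proof -
    have N: "((\<lambda>y. s * y - b\<^sup>2) has_field_derivative s) (at y)"
      by (auto intro!: derivative_eq_intros)
    have D: "((\<lambda>y. y * (y - 1)) has_field_derivative 2 * y - 1) (at y)"
      by (auto intro!: derivative_eq_intros)
    have "(?R has_field_derivative (s * (y * (y - 1)) - (s * y - b\<^sup>2) * (2 * y - 1)) /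
        (y * (y - 1) * (y * (y - 1)))) (at y)"
      unfolding Rf using DERIV_divide[OF N D] that by simp
    also have "s * (y * (y - 1)) - (s * y - b\<^sup>2) * (2 * y - 1) = - ((y - b) * (s * y - b))"
      unfolding s_b by algebra
    finally show ?thesis by (simp add: power2_eq_square)
  qed
  have 2: "(?R' has_field_derivative (2 * (2 * y - 1) * f1 * f2 - (f2 + s * f1) * W) / W ^ 3) (at y)"
  proof -
    have N: "((\<lambda>y. - ((y - b) * (s * y - b))) has_field_derivative - (f2 + s * f1)) (at y)"
      unfolding defs by (auto intro!: derivative_eq_intros simp: algebra_simps)
    have D: "((\<lambda>y. (y * (y - 1))\<^sup>2) has_field_derivative 2 * (2 * y - 1) * W) (at y)"
      unfolding defs by (auto intro!: derivative_eq_intros simp: algebra_simps)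
    have "(?R' has_field_derivative (- (f2 + s * f1) * W\<^sup>2 - - (f1 * f2) * (2 * (2 * y - 1) * W)) / (W\<^sup>2 * W\<^sup>2)) (at y)"
      using DERIV_divide[OF N D] nz unfolding defs by simp
    also have "(- (f2 + s * f1) * W\<^sup>2 - - (f1 * f2) * (2 * (2 * y - 1) * W)) / (W\<^sup>2 * W\<^sup>2) =
        (2 * (2 * y - 1) * f1 * f2 - (f2 + s * f1) * W) / W ^ 3"
      using nz by (simp add: divide_simps eval_nat_numeral) (simp add: algebra_simps)
    finally show ?thesis .
  qed
  have R: "?R y = Z / W" by (simp add: Rf defs)
  have R1: "?R y - 1 = - (f1\<^sup>2 / W)"
  proof -
    have e: "Z - W = - f1\<^sup>2" unfolding defs s_b by algebra
    have "Z / W - 1 = (Z - W) / W" using nz by (simp add: diff_divide_distrib)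
    then show ?thesis unfolding R e by simp
  qed
  have Ra: "?R y - s\<^sup>2 = - (f2\<^sup>2 / W)"
  proof -
    have e: "Z - s\<^sup>2 * W = - f2\<^sup>2" unfolding defs s_b by algebra
    have "Z / W - s\<^sup>2 = (Z - s\<^sup>2 * W) / W" using nz by (simp add: diff_divide_distrib)
    then show ?thesis unfolding R e by simp
  qed
  have R': "deriv ?R y = - (f1 * f2) / W\<^sup>2" "deriv (deriv ?R) y =
      (2 * (2 * y - 1) * f1 * f2 - (f2 + s * f1) * W) / W ^ 3"
    using deriv2_open[OF U 1 2] by (auto simp: defs)
  define V where "V = 1 / y + 1 / (y - 1)"
  have V: "V = (2 * y - 1) / W" unfolding V_def defs using y(1) nz(5) by (simp add: field_simps)
  define Y where "Y = s / Z"
  have L0: "deriv ?R y / ?R y = Y - V"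
  proof -
    have "- (f1 * f2) = s * W - (2 * y - 1) * Z" unfolding defs s_b by algebra
    then have "deriv ?R y / ?R y = (s * W - (2 * y - 1) * Z) / (Z * W)"
      unfolding R R' using nz by (simp add: power2_eq_square mult.commute)
    then show ?thesis unfolding Y_def V using nz by (simp add: diff_divide_distrib)
  qed
  have L1: "deriv ?R y / (?R y - 1) = 2 / f1 - V"
  proof -
    have "f2 = 2 * W - (2 * y - 1) * f1" unfolding defs s_b by algebra
    moreover have "deriv ?R y / (?R y - 1) = f2 / (f1 * W)"
      unfolding R1 R' using nz by (simp add: power2_eq_square)
    ultimately have "deriv ?R y / (?R y - 1) = (2 * W - (2 * y - 1) * f1) / (f1 * W)" by simp
    then show ?thesis unfolding V using nz by (simp add: diff_divide_distrib)
  qed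
  have La: "deriv ?R y / (?R y - par_a (quartic_target (s\<^sup>2) q \<gamma>)) = 2 * s / f2 - V"
  proof -
    have "f1 = 2 * s * W - (2 * y - 1) * f2" unfolding defs s_b by algebra
    moreover have "deriv ?R y / (?R y - s\<^sup>2) = f1 / (f2 * W)"
      unfolding Ra R' using nz by (simp add: power2_eq_square)
    ultimately have "deriv ?R y / (?R y - s\<^sup>2) = (2 * s * W - (2 * y - 1) * f2) / (f2 * W)" by simp
    then show ?thesis unfolding V quartic_target_def using nz by (simp add: diff_divide_distrib)
  qed
  have \<rho>: "deriv (deriv ?R) y / deriv ?R y = 1 / f1 + s / f2 - 2 * V"
    unfolding R' V using nz by (simp add: divide_simps eval_nat_numeral)
  have M: "(deriv ?R y)\<^sup>2 / (?R y * (?R y - 1) * (?R y - par_a (quartic_target (s\<^sup>2) q \<gamma>))) = 1 / (W * Z)"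
  proof -
    have "(deriv ?R y)\<^sup>2 / (?R y * (?R y - 1) * (?R y - s\<^sup>2)) = 1 / (W * Z)"
      unfolding R1 Ra R' unfolding R using nz by (simp add: divide_simps eval_nat_numeral)
    then show ?thesis by (simp add: quartic_target_def)
  qed
  have \<eta>': "deriv (\<lambda>y. \<kappa> / y + \<kappa> / (y - 1)) y = - (\<kappa> * (V\<^sup>2 - 2 / W))"
  proof (rule DERIV_imp_deriv)
    have "((\<lambda>y. \<kappa> / y + \<kappa> / (y - 1)) has_field_derivative - (\<kappa> / y\<^sup>2) - \<kappa> / (y - 1)\<^sup>2) (at y)"
      using y(1,2) by (auto intro!: derivative_eq_intros simp: power2_eq_square)
    also have "- (\<kappa> / y\<^sup>2) - \<kappa> / (y - 1)\<^sup>2 = - (\<kappa> * (1 / y\<^sup>2 + 1 / (y - 1)\<^sup>2))"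
      by (simp add: distrib_left)
    also have "1 / y\<^sup>2 + 1 / (y - 1)\<^sup>2 = V\<^sup>2 - 2 / W"
      unfolding V_def defs by (simp add: power2_sum power_divide)
    finally show "((\<lambda>y. \<kappa> / y + \<kappa> / (y - 1)) has_field_derivative - (\<kappa> * (V\<^sup>2 - 2 / W))) (at y)" .
  qed
  define a where "a = (1 + s)\<^sup>2 / (4 * s)"
  have Zs: "Z = s * (y - a)" unfolding defs a_def b2 using s by (simp add: field_simps)
  have Ya: "Y = 1 / (y - a)" unfolding Y_def Zs using s by simp
  have eps: "par_epsilon (middle s q \<gamma>) = \<gamma>" by (simp add: middle_def par_epsilon_def Let_def)
  have src: "fst (heun_ode (middle s q \<gamma>)) y = V / 2 + \<gamma> * Y"
    "snd (heun_ode (middle s q \<gamma>)) y =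
      ((\<gamma> / 2 - 1/4) * y - (q / (4 * s) - \<kappa> * (4 * \<kappa> * a + \<gamma>))) / (W * (y - a))"
  proof -
    have mid: "middle s q \<gamma> = Heun a (q / (4 * s) - \<kappa> * (4 * \<kappa> * a + \<gamma>)) (1/2) (\<gamma> - 1/2) (1/2) (1/2)"
      by (simp add: middle_def Let_def a_def \<kappa>)
    show "fst (heun_ode (middle s q \<gamma>)) y = V / 2 + \<gamma> * Y"
      unfolding heun_ode_def fst_conv eps by (simp add: mid V_def Ya add_divide_distrib mult.commute)
    have "1/2 * (\<gamma> - 1/2) = \<gamma> / 2 - 1/4" by simp
    then show "snd (heun_ode (middle s q \<gamma>)) y =
      ((\<gamma> / 2 - 1/4) * y - (q / (4 * s) - \<kappa> * (4 * \<kappa> * a + \<gamma>))) / (W * (y - a))"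
      unfolding heun_ode_def snd_conv mid heun.sel defs(1) by (simp only:)
  qed
  have \<eta>: "\<kappa> / y + \<kappa> / (y - 1) = \<kappa> * V" by (simp add: V_def distrib_left)
  show ?thesis
  proof (rule ode_at_lift_heun[OF L0 L1 La \<rho> M \<eta>'], goal_cases)
    case 1
    have \<kappa>2: "2 * \<kappa> = 1/2 - \<gamma>" unfolding \<kappa> right_diff_distrib by simp
    have "2 * (\<kappa> * V) = (2 * \<kappa>) * V" by (simp only: mult.assoc)
    then have k: "2 * (\<kappa> * V) = V / 2 - \<gamma> * V" unfolding \<kappa>2 by (simp add: left_diff_distrib)
    have e: "par_epsilon (quartic_target (s\<^sup>2) q \<gamma>) = 1/2" by (simp add: quartic_target_def par_epsilon_def)
    have g: "par_gamma (quartic_target (s\<^sup>2) q \<gamma>) = \<gamma>" "par_delta (quartic_target (s\<^sup>2) q \<gamma>) = 1/2"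
      by (simp_all add: quartic_target_def)
    show ?case unfolding src \<eta> k e g by (simp add: algebra_simps)
  next
    case 2
    have ya: "y - a \<noteq> 0" using nz(4) Zs by auto
    have "V\<^sup>2 = 4 / W + 1 / W\<^sup>2"
    proof -
      have "(2 * y - 1)\<^sup>2 = 4 * W + 1" unfolding defs by algebra
      then show ?thesis unfolding V using nz by (simp add: power_divide add_divide_distrib power2_eq_square)
    qed
    note V2 = this
    have ab: "(\<gamma> / 2 - 1/4) * (\<gamma> / 2 + 1/4) = \<kappa>\<^sup>2 - \<kappa> / 2"
      unfolding \<kappa> by (simp add: power2_eq_square algebra_simps diff_divide_distrib)
    have "((\<kappa>\<^sup>2 - \<kappa> / 2) * (Z / W) - q / 4) * (1 / (W * Z)) = (\<kappa>\<^sup>2 - \<kappa> / 2) / W\<^sup>2 - q / (4 * s) / (W * (y - a))"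
    proof -
      have "((\<kappa>\<^sup>2 - \<kappa> / 2) * (Z / W) - q / 4) * (1 / (W * Z)) = (\<kappa>\<^sup>2 - \<kappa> / 2) / W\<^sup>2 - q / 4 / (W * Z)"
        using nz by (simp add: left_diff_distrib diff_divide_distrib power2_eq_square)
      then show ?thesis unfolding Zs using s by (simp add: mult.commute mult.left_commute)
    qed
    moreover have "(\<kappa>\<^sup>2 - \<kappa> / 2) / W\<^sup>2 - (V / 2 + \<gamma> * Y + 2 * (\<kappa> * V)) * (\<kappa> * V) + (\<kappa> * V)\<^sup>2 + \<kappa> * (V\<^sup>2 - 2 / W) =
        - (4 * \<kappa>\<^sup>2) / W - \<gamma> * \<kappa> * (V * Y)"
    proof -
      have "(\<kappa>\<^sup>2 - \<kappa> / 2) / W\<^sup>2 - (V / 2 + \<gamma> * Y + 2 * (\<kappa> * V)) * (\<kappa> * V) + (\<kappa> * V)\<^sup>2 + \<kappa> * (V\<^sup>2 - 2 / W) =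
        (\<kappa>\<^sup>2 - \<kappa> / 2) / W\<^sup>2 - (\<kappa>\<^sup>2 - \<kappa> / 2) * V\<^sup>2 - 2 * \<kappa> / W - \<gamma> * \<kappa> * (V * Y)"
        by (simp add: power2_eq_square algebra_simps)
      also have "\<dots> = - (4 * \<kappa>\<^sup>2) / W - \<gamma> * \<kappa> * (V * Y)"
        unfolding V2 by (simp add: algebra_simps add_divide_distrib diff_divide_distrib)
      finally show ?thesis .
    qed
    moreover have "- (4 * \<kappa>\<^sup>2) / W - \<gamma> * \<kappa> * (V * Y) = ((\<gamma> / 2 - 1/4) * y + \<kappa> * (4 * \<kappa> * a + \<gamma>)) / (W * (y - a))"
    proof -
      have "- (4 * \<kappa>\<^sup>2) / W - \<gamma> * \<kappa> * (V * Y) = (- (4 * \<kappa>\<^sup>2) * (y - a) - \<gamma> * \<kappa> * (2 * y - 1)) / (W * (y - a))"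
      proof -
        have 1: "- (4 * \<kappa>\<^sup>2) / W = - (4 * \<kappa>\<^sup>2) * (y - a) / (W * (y - a))" using ya by simp
        have 2: "\<gamma> * \<kappa> * (V * Y) = \<gamma> * \<kappa> * (2 * y - 1) / (W * (y - a))" unfolding V Ya by simp
        show ?thesis by (simp only: 1 2 diff_divide_distrib)
      qed
      also have "- (4 * \<kappa>\<^sup>2) * (y - a) - \<gamma> * \<kappa> * (2 * y - 1) = (\<gamma> / 2 - 1/4) * y + \<kappa> * (4 * \<kappa> * a + \<gamma>)"
      proof -
        have g: "\<gamma> = 1/2 - 2 * \<kappa>" unfolding \<kappa> right_diff_distrib by simp
        show ?thesis unfolding g by (simp add: power2_eq_square algebra_simps diff_divide_distrib)
      qed
      finally show ?thesis .
    qed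
    moreover have "((\<gamma> / 2 - 1/4) * y + \<kappa> * (4 * \<kappa> * a + \<gamma>)) / (W * (y - a)) - q / (4 * s) / (W * (y - a)) =
        ((\<gamma> / 2 - 1/4) * y - (q / (4 * s) - \<kappa> * (4 * \<kappa> * a + \<gamma>))) / (W * (y - a))"
      by (simp only: diff_divide_distrib add_divide_distrib) simp
    ultimately have "((\<kappa>\<^sup>2 - \<kappa> / 2) * (Z / W) - q / 4) * (1 / (W * Z)) -
        (V / 2 + \<gamma> * Y + 2 * (\<kappa> * V)) * (\<kappa> * V) + (\<kappa> * V)\<^sup>2 - - (\<kappa> * (V\<^sup>2 - 2 / W)) =
        ((\<gamma> / 2 - 1/4) * y - (q / (4 * s) - \<kappa> * (4 * \<kappa> * a + \<gamma>))) / (W * (y - a))"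
      by algebra
    then show ?case unfolding src \<eta> R quartic_target_def heun.sel ab .
  qed
qed

lemma ode_at_first_lift:
  assumes s: "s \<noteq> 0" and x: "x \<noteq> 0" "x \<noteq> 1" "x \<noteq> s\<^sup>2" "x \<noteq> s" "x \<noteq> - s"
  shows "ode_at (ode_rescale (\<lambda>x. (1/2 - \<gamma>) / x)
      (ode_pullback (rat_fun (first_map s)) (heun_ode (middle s q \<gamma>)))) x =
    ode_at (heun_ode (quartic_source (s\<^sup>2) q \<gamma>)) x"
proof -
  let ?R = "rat_fun (first_map s)"
  define a where "a = (1 + s)\<^sup>2 / (4 * s)"
  have nz: "x + s \<noteq> 0" "x - s \<noteq> 0" "x - 1 \<noteq> 0" "x - s\<^sup>2 \<noteq> 0" "4 * s * x \<noteq> 0"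
    using x s by (auto simp: add_eq_0_iff)
  have Rf: "?R = (\<lambda>x. (x + s)\<^sup>2 / (4 * s * x))" by (rule ext) (rule rat_fun_first_map)
  have U: "open {x. x \<noteq> (0::complex)}" "x \<in> {x. x \<noteq> 0}"
    using x by (auto intro!: open_Collect_neq continuous_intros)
  have 1: "(?R has_field_derivative (y\<^sup>2 - s\<^sup>2) / (4 * s * y\<^sup>2)) (at y)" if "y \<in> {x. x \<noteq> 0}" for y
    unfolding Rf using that s
    by (auto intro!: derivative_eq_intros simp: divide_simps) (simp add: algebra_simps power2_eq_square)
  have 2: "((\<lambda>y. (y\<^sup>2 - s\<^sup>2) / (4 * s * y\<^sup>2)) has_field_derivative s / (2 * x ^ 3)) (at x)"
    using x(1) s
    by (auto intro!: derivative_eq_intros simp: divide_simps) (simp add: algebra_simps eval_nat_numeral)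
  have R: "?R x = (x + s)\<^sup>2 / (4 * s * x)" by (rule rat_fun_first_map)
  have R1: "?R x - 1 = (x - s)\<^sup>2 / (4 * s * x)"
  proof -
    have "(x + s)\<^sup>2 = 4 * s * x + (x - s)\<^sup>2" by algebra
    then show ?thesis unfolding R using x s by (simp add: add_divide_distrib)
  qed
  have Ra: "?R x - a = (x - 1) * (x - s\<^sup>2) / (4 * s * x)"
  proof -
    have "(x + s)\<^sup>2 = (1 + s)\<^sup>2 * x + (x - 1) * (x - s\<^sup>2)" by algebra
    then show ?thesis unfolding R a_def using x s by (simp add: add_divide_distrib)
  qed
  have R': "deriv ?R x = (x + s) * (x - s) / (4 * s * x\<^sup>2)" "deriv (deriv ?R) x = s / (2 * x ^ 3)"
    using deriv2_open[OF U 1 2] by (auto simp: power2_eq_square algebra_simps)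
  have L0: "deriv ?R x / ?R x = 2 / (x + s) - 1 / x"
    unfolding R R' using x s nz by (simp add: divide_simps power2_eq_square)
  have L1: "deriv ?R x / (?R x - 1) = 2 / (x - s) - 1 / x"
    unfolding R1 R' using x s nz by (simp add: divide_simps power2_eq_square)
  have pa: "par_a (middle s q \<gamma>) = a" by (simp add: middle_def a_def Let_def)
  have La: "deriv ?R x / (?R x - par_a (middle s q \<gamma>)) = 1 / (x - 1) + 1 / (x - s\<^sup>2) - 1 / x"
    unfolding pa Ra R' using x s nz by (simp add: divide_simps) algebra
  have \<rho>: "deriv (deriv ?R) x / deriv ?R x = 1 / (x + s) + 1 / (x - s) - 2 / x"
    unfolding R' using x s nz by (simp add: divide_simps) algebra
  have M: "(deriv ?R x)\<^sup>2 / (?R x * (?R x - 1) * (?R x - par_a (middle s q \<gamma>))) =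
      4 * s / (x * (x - 1) * (x - s\<^sup>2))"
    unfolding pa Ra R' R1 unfolding R using x s nz by (simp add: divide_simps eval_nat_numeral)
  have \<eta>': "deriv (\<lambda>x. (1/2 - \<gamma>) / x) x = - ((1/2 - \<gamma>) / x\<^sup>2)"
    using deriv_pole[of x 0 "1/2 - \<gamma>"] x(1) by simp
  define T where "T = 1 / x + 1 / (x - 1) + 1 / (x - s\<^sup>2)"
  have src: "fst (heun_ode (quartic_source (s\<^sup>2) q \<gamma>)) x = \<gamma> * T"
    "snd (heun_ode (quartic_source (s\<^sup>2) q \<gamma>)) x = ((2 * \<gamma> - 1) * \<gamma> * x - q) / (x * (x - 1) * (x - s\<^sup>2))"
    by (simp_all add: quartic_source_def heun_ode_def par_epsilon_def T_def distrib_left)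
  have eps: "par_epsilon (middle s q \<gamma>) = \<gamma>" by (simp add: middle_def par_epsilon_def Let_def)
  define \<kappa> where "\<kappa> = 1/4 - \<gamma> / 2"
  have mid: "par_gamma (middle s q \<gamma>) = 1/2" "par_delta (middle s q \<gamma>) = 1/2"
    "par_alpha (middle s q \<gamma>) * par_beta (middle s q \<gamma>) = - \<kappa>"
    "par_q (middle s q \<gamma>) = q / (4 * s) - \<kappa> * (4 * \<kappa> * a + \<gamma>)"
    by (simp_all add: middle_def Let_def a_def \<kappa>_def)
  have \<kappa>2: "1/2 - \<gamma> = 2 * \<kappa>" by (simp add: \<kappa>_def)
  show ?thesis
  proof (rule ode_at_lift_heun[OF L0 L1 La \<rho> M \<eta>'], goal_cases)
    case 1
    show ?case unfolding src mid eps T_def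
      by (simp add: algebra_simps add_divide_distrib diff_divide_distrib)
  next
    case 2
    define K where "K = x * (x - 1) * (x - s\<^sup>2)"
    have K: "K \<noteq> 0" using x(1) nz by (simp add: K_def)
    have T: "T = ((x - 1) * (x - s\<^sup>2) + x * (x - s\<^sup>2) + x * (x - 1)) / K"
      unfolding T_def K_def using x(1) nz by (simp add: divide_simps) (simp add: algebra_simps)
    have 1: "(- \<kappa> * ?R x - (q / (4 * s) - \<kappa> * (4 * \<kappa> * a + \<gamma>))) * (4 * s / K) =
        (- \<kappa> * (x + s)\<^sup>2 / x - q + \<kappa> * (4 * \<kappa> * (1 + s)\<^sup>2 + 4 * s * \<gamma>)) / K"
      unfolding R a_def using s x(1) K by (simp add: divide_simps) (simp add: algebra_simps)
    have "((- \<kappa> * (x + s)\<^sup>2 / x - q + \<kappa> * (4 * \<kappa> * (1 + s)\<^sup>2 + 4 * s * \<gamma>)) / K) -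
        (\<gamma> * T + 2 * (2 * \<kappa> / x)) * (2 * \<kappa> / x) + (2 * \<kappa> / x)\<^sup>2 - - (2 * \<kappa> / x\<^sup>2)
        = ((2 * \<gamma> - 1) * \<gamma> * x - q) / K"
    proof -
      have "- (\<kappa> * (x + s)\<^sup>2) * x + \<kappa> * (4 * \<kappa> * (1 + s)\<^sup>2 + 4 * s * \<gamma>) * x\<^sup>2
          - 2 * \<gamma> * \<kappa> * x * ((x - 1) * (x - s\<^sup>2) + x * (x - s\<^sup>2) + x * (x - 1))
          + (2 * \<kappa> - 4 * \<kappa>\<^sup>2) * K = (2 * \<gamma> - 1) * \<gamma> * x * x\<^sup>2"
        unfolding K_def \<kappa>_def by (simp add: algebra_simps eval_nat_numeral)
      then show ?thesis unfolding T using K x(1) by (simp add: divide_simps) algebra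
    qed
    then show ?case unfolding src mid \<kappa>2 K_def[symmetric] 1 .
  qed
qed

lemma quartic_map_sel:
  "poly (fst (quartic_map a)) x = 4 * a * x * (1 - x) * (a - x)"
  "poly (snd (quartic_map a)) x = (a - x\<^sup>2)\<^sup>2"
  unfolding quartic_map_def fst_conv snd_conv poly_mult poly_power by (simp_all add: power2_eq_square)

lemma degree_quartic_map:
  assumes "a \<noteq> 0"
  shows "degree (fst (quartic_map a)) = 3" "degree (snd (quartic_map a)) = 4" "rat_deg (quartic_map a) = 4"
proof -
  have "fst (quartic_map a) = [:0, 4 * a\<^sup>2, - (4 * a * (a + 1)), 4 * a:]"
    unfolding quartic_map_def fst_conv by (simp add: algebra_simps power2_eq_square)
  then show 1: "degree (fst (quartic_map a)) = 3" using assms by simp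
  show 2: "degree (snd (quartic_map a)) = 4"
    unfolding quartic_map_def snd_conv by (subst degree_power_eq) auto
  show "rat_deg (quartic_map a) = 4" using 1 2 by (simp add: rat_deg_def)
qed

lemma coprime_quartic_map:
  assumes "a \<noteq> 0" "a \<noteq> 1"
  shows "coprime (fst (quartic_map a)) (snd (quartic_map a))"
proof (rule coprime_if_no_common_root)
  fix x assume "poly (fst (quartic_map a)) x = 0"
  then have "x = 0 \<or> x = 1 \<or> x = a" using assms by (auto simp: quartic_map_sel)
  moreover have "a - a\<^sup>2 = a * (1 - a)" by (simp add: power2_eq_square algebra_simps)
  ultimately show "poly (snd (quartic_map a)) x \<noteq> 0" using assms by (auto simp: quartic_map_sel)
qed

lemma pderiv_poly: "poly (pderiv f) x = deriv (poly f) x" for x :: complex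
  by (rule DERIV_imp_deriv[OF poly_DERIV, symmetric])

lemma quartic_map_fibre_0:
  assumes a: "a \<noteq> 0" "a \<noteq> 1" and z: "z \<in> {Pt 0, Pt 1, Pt a, Infinity}"
  shows "rat_mult (quartic_map a) (Pt 0) z = 1"
proof (cases z)
  case (Pt x)
  let ?f = "fst (quartic_map a)"
  have "deriv (poly ?f) x = 4 * a * ((1 - x) * (a - x) - x * (a - x) - x * (1 - x))"
  proof (rule DERIV_imp_deriv)
    have "poly ?f = (\<lambda>x. 4 * a * x * (1 - x) * (a - x))" by (rule ext) (rule quartic_map_sel)
    then show "(poly ?f has_field_derivative 4 * a * ((1 - x) * (a - x) - x * (a - x) - x * (1 - x))) (at x)"
      by (auto intro!: derivative_eq_intros simp: algebra_simps)
  qed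
  moreover have "x = 0 \<or> x = 1 \<or> x = a" using z Pt by auto
  ultimately have "poly ?f x = 0 \<and> poly (pderiv ?f) x \<noteq> 0"
    using a unfolding pderiv_poly by (auto simp: quartic_map_sel)
  then show ?thesis using order_simple_root[of ?f x] Pt by simp
next
  case Infinity
  then show ?thesis using degree_quartic_map[OF a(1)] by simp
qed

text \<open>A critical point is a zero of the Wronskian, which factors into the three quadratic
  polynomials that vanish over \<open>1\<close>, \<open>a\<close> and \<open>\<infinity>\<close>.\<close>

lemma critical_values_quartic_map:
  assumes a: "a \<noteq> 0" "a \<noteq> 1"
  shows "critical_values (quartic_map a) \<subseteq> {Pt 1, Pt a, Infinity}"
proof
  fix w assume "w \<in> critical_values (quartic_map a)"
  then obtain z where z: "2 \<le> rat_mult (quartic_map a) w z" by (auto simp: critical_values_def)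
  let ?N = "fst (quartic_map a)" and ?D = "snd (quartic_map a)"
  show "w \<in> {Pt 1, Pt a, Infinity}"
  proof (cases w)
    case (Pt c)
    have "c = 1 \<or> c = a"
    proof (cases z)
      case Infinity
      have "degree (?N - smult c ?D) \<ge> 3"
      proof (cases "c = 0")
        case True
        then show ?thesis using degree_quartic_map[OF a(1)] by simp
      next
        case False
        then have "degree ?N < degree (- smult c ?D)" using degree_quartic_map[OF a(1)] by simp
        from degree_add_eq_right[OF this] False show ?thesis using degree_quartic_map[OF a(1)] by simp
      qed
      then show ?thesis using z Pt Infinity degree_quartic_map[OF a(1)] by simp
    next
      case z': (Pt x)
      define D F G where defs: "D = a - x\<^sup>2" "F = a - 2 * a * x + x\<^sup>2" "G = a - 2 * x + x\<^sup>2"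
      have root: "poly (?N - smult c ?D) x = 0" "poly (pderiv (?N - smult c ?D)) x = 0"
        using double_root[of x "?N - smult c ?D"] z Pt z' by auto
      have N: "poly ?N x = 4 * a * x * (1 - x) * (a - x)" and D: "poly ?D x = D\<^sup>2"
        by (simp_all add: quartic_map_sel defs)
      have N': "poly (pderiv ?N) x = 4 * a * ((1 - x) * (a - x) - x * (a - x) - x * (1 - x))"
      proof -
        have "poly ?N = (\<lambda>x. 4 * a * x * (1 - x) * (a - x))" by (rule ext) (rule quartic_map_sel)
        then have "(poly ?N has_field_derivative 4 * a * ((1 - x) * (a - x) - x * (a - x) - x * (1 - x))) (at x)"
          by (auto intro!: derivative_eq_intros simp: algebra_simps)
        then show ?thesis using poly_DERIV[of ?N x] DERIV_unique by blast
      qed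
      have D': "poly (pderiv ?D) x = - 4 * x * D"
      proof -
        have "poly ?D = (\<lambda>x. (a - x\<^sup>2)\<^sup>2)" by (rule ext) (rule quartic_map_sel)
        then have "(poly ?D has_field_derivative - 4 * x * D) (at x)"
          by (auto intro!: derivative_eq_intros simp: defs)
        then show ?thesis using poly_DERIV[of ?D x] DERIV_unique by blast
      qed
      have 1: "4 * a * x * (1 - x) * (a - x) = c * D\<^sup>2" using root(1) N D by simp
      have 2: "4 * a * ((1 - x) * (a - x) - x * (a - x) - x * (1 - x)) = c * (- 4 * x * D)"
      proof -
        have "poly (pderiv ?N) x - c * poly (pderiv ?D) x = 0"
          using root(2) by (simp add: pderiv_diff pderiv_smult)
        then show ?thesis unfolding N' D' by (simp only: right_minus_eq)
      qed
      have "D \<noteq> 0" using coprime_poly_0[OF coprime_quartic_map[OF a], of x] N D 1 by auto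
      have "4 * a * (F * G) = 4 * a * (((1 - x) * (a - x) - x * (a - x) - x * (1 - x)) * D + 4 * x * x * (1 - x) * (a - x))"
        unfolding defs by algebra
      also have "\<dots> = (4 * a * ((1 - x) * (a - x) - x * (a - x) - x * (1 - x))) * D + 4 * x * (4 * a * x * (1 - x) * (a - x))"
        by (simp add: algebra_simps)
      also have "\<dots> = 0" unfolding 1 2 by (simp add: power2_eq_square)
      finally have "F = 0 \<or> G = 0" using a by simp
      then show ?thesis
      proof
        assume "F = 0"
        have "4 * a * x * (1 - x) * (a - x) = D\<^sup>2 - F\<^sup>2" unfolding defs by algebra
        then have "c * D\<^sup>2 = D\<^sup>2" using 1 \<open>F = 0\<close> by simp
        then show ?thesis using \<open>D \<noteq> 0\<close> by simp
      next
        assume "G = 0"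
        have "4 * a * x * (1 - x) * (a - x) = a * D\<^sup>2 - a * G\<^sup>2" unfolding defs by algebra
        then have "c * D\<^sup>2 = a * D\<^sup>2" using 1 \<open>G = 0\<close> by simp
        then show ?thesis using \<open>D \<noteq> 0\<close> by simp
      qed
    qed
    then show ?thesis using Pt by auto
  qed simp
qed

lemma rat_lift_quartic_map:
  assumes s: "s \<noteq> 0" "s\<^sup>2 \<noteq> 1"
  shows "rat_lift (heun_ode (quartic_source (s\<^sup>2) q \<gamma>)) (\<lambda>x. \<Sum>c\<in>{s, - s}. (1/2 - \<gamma>) / (x - c))
    (quartic_map (s\<^sup>2)) (heun_ode (quartic_target (s\<^sup>2) q \<gamma>))"
proof (rule rat_lift_sum)
  have a: "s\<^sup>2 \<noteq> 0" using s by simp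
  show "coprime (fst (quartic_map (s\<^sup>2))) (snd (quartic_map (s\<^sup>2)))" by (rule coprime_quartic_map[OF a s(2)])
  show "0 < rat_deg (quartic_map (s\<^sup>2))" using degree_quartic_map[OF a] by simp
  have "\<forall>\<^sub>\<infinity>x. poly [:s\<^sup>2, - 2 * s\<^sup>2, 1:] x \<noteq> 0" "\<forall>\<^sub>\<infinity>x. poly [:s\<^sup>2, - 2, 1:] x \<noteq> 0"
    by (rule cofinite_poly_nz; simp)+
  then show "\<forall>\<^sub>\<infinity>x. ode_at (ode_rescale (\<lambda>x. \<Sum>c\<in>{s, - s}. (1/2 - \<gamma>) / (x - c))
      (ode_pullback (rat_fun (quartic_map (s\<^sup>2))) (heun_ode (quartic_target (s\<^sup>2) q \<gamma>)))) x =
    ode_at (heun_ode (quartic_source (s\<^sup>2) q \<gamma>)) x"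
    using cofinite_neq[of 0] cofinite_neq[of 1] cofinite_neq[of "s\<^sup>2"] cofinite_neq[of s] cofinite_neq[of "- s"]
  proof eventually_elim
    case (elim x)
    have sq: "x\<^sup>2 \<noteq> s\<^sup>2" using elim by (simp add: power2_eq_iff)
    have "s\<^sup>2 - 2 * s\<^sup>2 * x + x\<^sup>2 \<noteq> 0" "s\<^sup>2 - 2 * x + x\<^sup>2 \<noteq> 0"
      using elim(1,2) by (simp_all add: power2_eq_square algebra_simps)
    note lift = ode_at_quartic_lift[OF a elim(3,4,5) sq this, of \<gamma> q]
    have "\<forall>\<^sub>F y in nhds x. y \<noteq> s" "\<forall>\<^sub>F y in nhds x. y \<noteq> - s"
      using elim(6,7) t1_space_nhds by blast+
    then have "\<forall>\<^sub>F y in nhds x. (\<Sum>c\<in>{s, - s}. (1/2 - \<gamma>) / (y - c)) = (2 * \<gamma> - 1) * y / (s\<^sup>2 - y\<^sup>2)"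
    proof eventually_elim
      case (elim y)
      have "y - s \<noteq> 0" "y + s \<noteq> 0" using elim by (auto simp: add_eq_0_iff)
      then have "(1/2 - \<gamma>) / (y - s) + (1/2 - \<gamma>) / (y + s) =
          ((1/2 - \<gamma>) * (y + s) + (1/2 - \<gamma>) * (y - s)) / ((y - s) * (y + s))"
        by (rule add_frac_eq)
      also have "(1/2 - \<gamma>) * (y + s) + (1/2 - \<gamma>) * (y - s) = - ((2 * \<gamma> - 1) * y)"
        by (simp add: algebra_simps add_divide_distrib diff_divide_distrib)
      also have "(y - s) * (y + s) = - (s\<^sup>2 - y\<^sup>2)" by algebra
      finally have "(1/2 - \<gamma>) / (y - s) + (1/2 - \<gamma>) / (y + s) = (2 * \<gamma> - 1) * y / (s\<^sup>2 - y\<^sup>2)"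
        by (simp only: minus_divide_divide)
      moreover have "s \<noteq> - s" using s(1) by simp
      ultimately show ?case by simp
    qed
    from ode_at_rescale_cong[OF refl this] lift show ?case by simp
  qed
qed simp

lemma heun_equation_source:
  assumes s: "s \<noteq> 0" "s\<^sup>2 \<noteq> 1" and "heun_equation (quartic_target (s\<^sup>2) q \<gamma>)"
  shows "heun_equation (quartic_source (s\<^sup>2) q \<gamma>)"
proof (rule heun_equation_lift[OF rat_lift_quartic_map[OF s] assms(3)])
  fix z assume "z \<in> heun_points (quartic_source (s\<^sup>2) q \<gamma>)"
  then have "z \<in> {Pt 0, Pt 1, Pt (s\<^sup>2), Infinity}" by (simp add: heun_points_def quartic_source_def)
  moreover have "s\<^sup>2 \<noteq> 0" using s by simp
  ultimately have "rat_mult (quartic_map (s\<^sup>2)) (Pt 0) z = 1" using quartic_map_fibre_0 s by blast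
  then show "\<exists>w \<in> heun_points (quartic_target (s\<^sup>2) q \<gamma>). rat_mult (quartic_map (s\<^sup>2)) w z = 1"
    by (auto simp: heun_points_def)
qed (use s in \<open>auto simp: quartic_source_def\<close>)

lemma quartic_heun_lift:
  assumes s: "s \<noteq> 0" "s\<^sup>2 \<noteq> 1" and "heun_equation (quartic_target (s\<^sup>2) q \<gamma>)"
  shows "heun_lift (quartic_map (s\<^sup>2)) (quartic_source (s\<^sup>2) q \<gamma>) (quartic_target (s\<^sup>2) q \<gamma>)
    (\<lambda>x. \<Sum>c\<in>{s, - s}. (1/2 - \<gamma>) / (x - c))"
proof (rule heun_lift_intro[OF rat_lift_quartic_map[OF s] heun_equation_source[OF assms] assms(3)])
  show "critical_values (quartic_map (s\<^sup>2)) \<subseteq> heun_points (quartic_target (s\<^sup>2) q \<gamma>)"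
    using critical_values_quartic_map[of "s\<^sup>2"] s by (auto simp: heun_points_def quartic_target_def)
qed

lemma second_map_degree:
  assumes "s \<noteq> 0"
  shows "degree (fst (second_map s)) = 1" "degree (snd (second_map s)) = 2" "rat_deg (second_map s) = 2"
  using assms by (auto simp: second_map_def rat_deg_def)

lemma coprime_second_map:
  assumes "s \<noteq> 0" "s\<^sup>2 \<noteq> 1"
  shows "coprime (fst (second_map s)) (snd (second_map s))"
proof (rule coprime_if_no_common_root)
  fix y assume y: "poly (fst (second_map s)) y = 0"
  have 0: "1 + s \<noteq> 0" "s - 1 \<noteq> 0" using assms(2) by (auto simp: add_eq_0_iff)
  have sy: "s * y = (1 + s)\<^sup>2 / 4" using y by (simp add: second_map_def algebra_simps)
  have "y \<noteq> 0" using sy 0 by auto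
  moreover have "y \<noteq> 1"
  proof
    assume "y = 1"
    then have "4 * s = (1 + s)\<^sup>2" using sy by (simp add: mult.commute)
    then have "(s - 1)\<^sup>2 = 0" by algebra
    then show False using 0 by simp
  qed
  ultimately have "y \<noteq> 0" "y \<noteq> 1" by auto
  then show "poly (snd (second_map s)) y \<noteq> 0" by (simp add: second_map_def)
qed

lemma rat_lift_second_map:
  assumes s: "s \<noteq> 0" "s\<^sup>2 \<noteq> 1"
  shows "rat_lift (heun_ode (middle s q \<gamma>)) (\<lambda>x. \<Sum>c\<in>{0, 1}. (1/4 - \<gamma> / 2) / (x - c))
    (second_map s) (heun_ode (quartic_target (s\<^sup>2) q \<gamma>))"
proof (rule rat_lift_sum)
  show "coprime (fst (second_map s)) (snd (second_map s))" by (rule coprime_second_map[OF s])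
  show "0 < rat_deg (second_map s)" using second_map_degree[OF s(1)] by simp
  have "\<forall>\<^sub>\<infinity>y. y \<noteq> (1 + s)\<^sup>2 / 4 / s" "\<forall>\<^sub>\<infinity>y. y \<noteq> (1 + s) / 2" "\<forall>\<^sub>\<infinity>y. y \<noteq> (1 + s) / 2 / s"
    by (rule cofinite_neq)+
  then show "\<forall>\<^sub>\<infinity>y. ode_at (ode_rescale (\<lambda>x. \<Sum>c\<in>{0, 1}. (1/4 - \<gamma> / 2) / (x - c))
      (ode_pullback (rat_fun (second_map s)) (heun_ode (quartic_target (s\<^sup>2) q \<gamma>)))) y =
    ode_at (heun_ode (middle s q \<gamma>)) y"
    using cofinite_neq[of 0] cofinite_neq[of 1]
  proof eventually_elim
    case (elim y)
    have "s * y \<noteq> (1 + s)\<^sup>2 / 4" "s * y \<noteq> (1 + s) / 2"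
      using elim(1,3) s(1) by (metis nonzero_mult_div_cancel_left)+
    from ode_at_second_lift[OF s(1) elim(4,5) this(1) elim(2) this(2) refl, of \<gamma> q]
    show ?case by simp
  qed
qed simp

lemma middle_par_a:
  assumes "s \<noteq> 0" "s\<^sup>2 \<noteq> 1"
  shows "par_a (middle s q \<gamma>) = (1 + s)\<^sup>2 / (4 * s)" "par_a (middle s q \<gamma>) \<noteq> 0" "par_a (middle s q \<gamma>) \<noteq> 1"
proof -
  show e: "par_a (middle s q \<gamma>) = (1 + s)\<^sup>2 / (4 * s)" by (simp add: middle_def Let_def)
  have 0: "1 + s \<noteq> 0" "s - 1 \<noteq> 0" using assms(2) by (auto simp: add_eq_0_iff)
  then show "par_a (middle s q \<gamma>) \<noteq> 0" unfolding e using assms(1) by simp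
  have "(1 + s)\<^sup>2 - 4 * s = (s - 1)\<^sup>2" by algebra
  then have "(1 + s)\<^sup>2 \<noteq> 4 * s" using 0 by force
  then show "par_a (middle s q \<gamma>) \<noteq> 1" unfolding e using assms(1) by (simp add: field_simps)
qed

lemma heun_equation_middle:
  assumes s: "s \<noteq> 0" "s\<^sup>2 \<noteq> 1" and "heun_equation (quartic_target (s\<^sup>2) q \<gamma>)"
  shows "heun_equation (middle s q \<gamma>)"
proof (rule heun_equation_lift[OF rat_lift_second_map[OF s] assms(3) middle_par_a(2,3)[OF s]])
  fix z assume z: "z \<in> heun_points (middle s q \<gamma>)"
  let ?a = "(1 + s)\<^sup>2 / (4 * s)"
  consider "z = Pt 0" | "z = Pt 1" | "z = Pt ?a" | "z = Infinity"
    using z unfolding heun_points_def middle_par_a(1)[OF s] by blast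
  then have "rat_mult (second_map s) Infinity z = 1 \<or> rat_mult (second_map s) (Pt 0) z = 1"
  proof cases
    case 1
    then show ?thesis using order_simple_root[of "[:0, -1, 1:]" 0] by (simp add: second_map_def pderiv_pCons)
  next
    case 2
    then show ?thesis using order_simple_root[of "[:0, -1, 1:]" 1] by (simp add: second_map_def pderiv_pCons)
  next
    case 3
    then show ?thesis using order_simple_root[of "[:- ((1 + s)\<^sup>2 / 4), s:]" ?a] s(1)
      by (simp add: second_map_def pderiv_pCons)
  next
    case 4
    then show ?thesis using second_map_degree[OF s(1)] by simp
  qed
  then show "\<exists>w \<in> heun_points (quartic_target (s\<^sup>2) q \<gamma>). rat_mult (second_map s) w z = 1"
    by (auto simp: heun_points_def)
qed

lemma second_heun_transformation:
  assumes s: "s \<noteq> 0" "s\<^sup>2 \<noteq> 1" and "heun_equation (quartic_target (s\<^sup>2) q \<gamma>)"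
  shows "heun_transformation 2 (second_map s) (middle s q \<gamma>) (quartic_target (s\<^sup>2) q \<gamma>)"
proof -
  have "critical_values (second_map s) \<subseteq> heun_points (quartic_target (s\<^sup>2) q \<gamma>)"
  proof
    fix w assume w: "w \<in> critical_values (second_map s)"
    show "w \<in> heun_points (quartic_target (s\<^sup>2) q \<gamma>)"
    proof (cases w)
      case (Pt c)
      have "(s + c)\<^sup>2 = c * (1 + s)\<^sup>2"
        using w[unfolded quadratic_critical_value_iff[OF coprime_second_map[OF s] second_map_degree(3)[OF s(1)]]] Pt
        by (simp add: second_map_def coeff_pCons numeral_2_eq_2)
      then have "(c - 1) * (c - s\<^sup>2) = 0" by algebra
      then show ?thesis using Pt by (auto simp: heun_points_def quartic_target_def)
    qed (simp add: heun_points_def)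
  qed
  then have "heun_lift (second_map s) (middle s q \<gamma>) (quartic_target (s\<^sup>2) q \<gamma>)
      (\<lambda>x. \<Sum>c\<in>{0, 1}. (1/4 - \<gamma> / 2) / (x - c))"
    by (rule heun_lift_intro[OF rat_lift_second_map[OF s] heun_equation_middle[OF assms] assms(3)])
  then show ?thesis unfolding heun_transformation_def using second_map_degree[OF s(1)]
    by (intro conjI exI[of _ "{0, 1}"] exI[of _ "\<lambda>_. 1/4 - \<gamma> / 2"]) auto
qed

lemma first_map_degree:
  assumes "s \<noteq> 0"
  shows "rat_deg (first_map s) = 2"
  using assms by (simp add: first_map_def rat_deg_def)

lemma coprime_first_map:
  assumes "s \<noteq> 0"
  shows "coprime (fst (first_map s)) (snd (first_map s))"
proof (rule coprime_if_no_common_root)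
  fix x assume "poly (fst (first_map s)) x = 0"
  then have "x \<noteq> 0" using assms by (auto simp: first_map_def)
  then show "poly (snd (first_map s)) x \<noteq> 0" using assms by (simp add: first_map_def)
qed

lemma first_heun_transformation:
  assumes s: "s \<noteq> 0" "s\<^sup>2 \<noteq> 1" and target: "heun_equation (quartic_target (s\<^sup>2) q \<gamma>)"
  shows "heun_transformation 2 (first_map s) (quartic_source (s\<^sup>2) q \<gamma>) (middle s q \<gamma>)"
proof -
  have "rat_lift (heun_ode (quartic_source (s\<^sup>2) q \<gamma>)) (\<lambda>x. \<Sum>c\<in>{0}. (1/2 - \<gamma>) / (x - c))
      (first_map s) (heun_ode (middle s q \<gamma>))"
  proof (rule rat_lift_sum)
    show "coprime (fst (first_map s)) (snd (first_map s))" by (rule coprime_first_map[OF s(1)])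
    show "0 < rat_deg (first_map s)" using first_map_degree[OF s(1)] by simp
    show "\<forall>\<^sub>\<infinity>x. ode_at (ode_rescale (\<lambda>x. \<Sum>c\<in>{0}. (1/2 - \<gamma>) / (x - c))
        (ode_pullback (rat_fun (first_map s)) (heun_ode (middle s q \<gamma>)))) x =
      ode_at (heun_ode (quartic_source (s\<^sup>2) q \<gamma>)) x"
      using cofinite_neq[of 0] cofinite_neq[of 1] cofinite_neq[of "s\<^sup>2"] cofinite_neq[of s] cofinite_neq[of "- s"]
    proof eventually_elim
      case (elim x)
      from ode_at_first_lift[OF s(1) elim, of \<gamma> q] show ?case by simp
    qed
  qed simp
  moreover have "critical_values (first_map s) \<subseteq> heun_points (middle s q \<gamma>)"
  proof
    fix w assume w: "w \<in> critical_values (first_map s)"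
    show "w \<in> heun_points (middle s q \<gamma>)"
    proof (cases w)
      case (Pt c)
      have "(2 * s - c * (4 * s))\<^sup>2 = 4 * s\<^sup>2"
        using w[unfolded quadratic_critical_value_iff[OF coprime_first_map[OF s(1)] first_map_degree[OF s(1)]]] Pt
        by (simp add: first_map_def coeff_pCons numeral_2_eq_2)
      then have "s\<^sup>2 * (c * (c - 1)) = 0" by algebra
      then show ?thesis using Pt s(1) by (auto simp: heun_points_def)
    qed (simp add: heun_points_def)
  qed
  ultimately have "heun_lift (first_map s) (quartic_source (s\<^sup>2) q \<gamma>) (middle s q \<gamma>)
      (\<lambda>x. \<Sum>c\<in>{0}. (1/2 - \<gamma>) / (x - c))"
    by (intro heun_lift_intro heun_equation_source[OF assms] heun_equation_middle[OF assms])
  then show ?thesis unfolding heun_transformation_def using first_map_degree[OF s(1)]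
    by (intro conjI exI[of _ "{0}"] exI[of _ "\<lambda>_. 1/2 - \<gamma>"]) auto
qed

lemma biquadratic_quartic_map:
  assumes s: "s \<noteq> 0" "s\<^sup>2 \<noteq> 1" and target: "heun_equation (quartic_target (s\<^sup>2) q \<gamma>)"
  shows "biquadratic (quartic_map (s\<^sup>2)) (quartic_source (s\<^sup>2) q \<gamma>) (quartic_target (s\<^sup>2) q \<gamma>)"
proof -
  have "heun_transformation 4 (quartic_map (s\<^sup>2)) (quartic_source (s\<^sup>2) q \<gamma>) (quartic_target (s\<^sup>2) q \<gamma>)"
    unfolding heun_transformation_def using quartic_heun_lift[OF assms] degree_quartic_map(3)[of "s\<^sup>2"] s(1)
    by (intro conjI exI[of _ "{s, - s}"] exI[of _ "\<lambda>_. 1/2 - \<gamma>"]) auto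
  moreover have "\<forall>\<^sub>\<infinity>x. rat_fun (quartic_map (s\<^sup>2)) x = rat_fun (second_map s) (rat_fun (first_map s) x)"
    using cofinite_neq[of 0] cofinite_neq[of s] cofinite_neq[of "- s"]
  proof eventually_elim
    case (elim x)
    have nz: "x - s \<noteq> 0" "x + s \<noteq> 0" "s\<^sup>2 - x\<^sup>2 \<noteq> 0"
      using elim by (auto simp: add_eq_0_iff power2_eq_iff)
    let ?y = "rat_fun (first_map s) x"
    have y: "?y = (x + s)\<^sup>2 / (4 * s * x)" by (rule rat_fun_first_map)
    have "?y - 1 = (x - s)\<^sup>2 / (4 * s * x)"
    proof -
      have "(x + s)\<^sup>2 = 4 * s * x + (x - s)\<^sup>2" by algebra
      then show ?thesis unfolding y using elim(1) s by (simp add: add_divide_distrib)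
    qed
    then have "?y * (?y - 1) = (s\<^sup>2 - x\<^sup>2)\<^sup>2 / (16 * s\<^sup>2 * x\<^sup>2)"
    proof -
      assume y1: "?y - 1 = (x - s)\<^sup>2 / (4 * s * x)"
      have "(x + s)\<^sup>2 * (x - s)\<^sup>2 = (s\<^sup>2 - x\<^sup>2)\<^sup>2" by algebra
      then show ?thesis unfolding y1 unfolding y by (simp add: power2_eq_square)
    qed
    moreover have "s * ?y - (1 + s)\<^sup>2 / 4 = (1 - x) * (s\<^sup>2 - x) / (4 * x)"
    proof -
      have "s * ?y = (x + s)\<^sup>2 / (4 * x)" unfolding y using s(1) by simp
      moreover have "(x + s)\<^sup>2 = (1 + s)\<^sup>2 * x + (1 - x) * (s\<^sup>2 - x)" by algebra
      ultimately show ?thesis using elim(1) by (simp add: add_divide_distrib)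
    qed
    ultimately have "rat_fun (second_map s) ?y =
        (1 - x) * (s\<^sup>2 - x) / (4 * x) / ((s\<^sup>2 - x\<^sup>2)\<^sup>2 / (16 * s\<^sup>2 * x\<^sup>2))"
      by (simp only: rat_fun_second_map)
    also have "\<dots> = 4 * s\<^sup>2 * x * (1 - x) * (s\<^sup>2 - x) / (s\<^sup>2 - x\<^sup>2)\<^sup>2"
      using nz elim(1) s(1) by (simp add: divide_simps power2_eq_square)
    finally show ?case by (simp add: rat_fun_quartic_map)
  qed
  ultimately show ?thesis
    unfolding biquadratic_def
    using first_heun_transformation[OF assms] second_heun_transformation[OF assms] by blast
qed

section \<open>Existence and uniqueness of the local function\<close>

text \<open>The left-hand side of the Heun equation, multiplied by \<open>x (x - 1) (x - a)\<close>, as an operator on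
  formal power series.\<close>

definition heun_operator :: "heun \<Rightarrow> complex fps \<Rightarrow> complex fps" where
  "heun_operator p F =
     (let a = par_a p; X = fps_X; F' = fps_deriv F; F'' = fps_deriv F' in
      X * (X * (X * F'')) - fps_const (1 + a) * (X * (X * F'')) + fps_const a * (X * F'')
      + fps_const (par_gamma p + par_delta p + par_epsilon p) * (X * (X * F'))
      - fps_const (par_gamma p * (1 + a) + par_delta p * a + par_epsilon p) * (X * F')
      + fps_const (par_gamma p * a) * F'
      + fps_const (par_alpha p * par_beta p) * (X * F) - fps_const (par_q p) * F)"

text \<open>The middle coefficient of the three-term recurrence for the coefficients of \<open>Hl\<close>.\<close>

definition recurrence_mid :: "heun \<Rightarrow> nat \<Rightarrow> complex" where
  "recurrence_mid p n = of_nat n * ((of_nat n - 1 + par_gamma p) * (1 + par_a p) +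
     par_a p * par_delta p + par_epsilon p) + par_q p"

lemma heun_operator_eq_0_iff:
  "heun_operator p F = 0 \<longleftrightarrow>
     par_a p * par_gamma p * fps_nth F 1 = par_q p * fps_nth F 0 \<and>
     (\<forall>n. par_a p * (of_nat n + 2) * (of_nat n + 1 + par_gamma p) * fps_nth F (Suc (Suc n)) =
        recurrence_mid p (Suc n) * fps_nth F (Suc n) -
        (of_nat n + par_alpha p) * (of_nat n + par_beta p) * fps_nth F n)"
proof -
  have fuchs: "par_gamma p + par_delta p + par_epsilon p = par_alpha p + par_beta p + 1"
    by (simp add: par_epsilon_def)
  have 0: "fps_nth (heun_operator p F) 0 = par_a p * par_gamma p * fps_nth F 1 - par_q p * fps_nth F 0"
    by (simp add: heun_operator_def Let_def)
  have Suc: "fps_nth (heun_operator p F) (Suc n) =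
      par_a p * (of_nat n + 2) * (of_nat n + 1 + par_gamma p) * fps_nth F (Suc (Suc n)) -
      (recurrence_mid p (Suc n) * fps_nth F (Suc n) -
        (of_nat n + par_alpha p) * (of_nat n + par_beta p) * fps_nth F n)" for n
  proof (cases n)
    case 0
    then show ?thesis by (simp add: heun_operator_def Let_def recurrence_mid_def numeral_2_eq_2 algebra_simps)
  next
    case (Suc m)
    show ?thesis
    proof (cases m)
      case 0
      then show ?thesis
        by (simp add: Suc heun_operator_def Let_def recurrence_mid_def fuchs numeral_2_eq_2)
          (simp add: algebra_simps)
    next
      case m: (Suc k)
      show ?thesis
        by (simp add: Suc m heun_operator_def Let_def recurrence_mid_def fuchs)
          (simp add: algebra_simps)
    qed
  qed
  have "heun_operator p F = 0 \<longleftrightarrow>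
      fps_nth (heun_operator p F) 0 = 0 \<and> (\<forall>n. fps_nth (heun_operator p F) (Suc n) = 0)"
    unfolding fps_eq_iff by (metis fps_zero_nth not0_implies_Suc)
  then show ?thesis unfolding 0 Suc by (simp only: right_minus_eq)
qed

lemma has_fps_expansion_eventually_at_0:
  assumes "g has_fps_expansion G" "\<forall>\<^sub>F x in at 0. g x = (0::complex)"
  shows "G = 0"
proof -
  have "isCont g 0" using has_fps_expansion_imp_continuous[OF assms(1)] .
  then have "(g \<longlongrightarrow> g 0) (at 0)" by (rule isContD)
  from Lim_transform_eventually[OF this assms(2)] have "g 0 = 0"
    by (simp add: tendsto_const_iff)
  then have "\<forall>\<^sub>F x in nhds 0. g x = 0" using assms(2) by (simp add: eventually_nhds_conv_at)
  then have "g has_fps_expansion 0" by (simp add: has_fps_expansion_0_iff)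
  then show ?thesis using assms(1) fps_expansion_unique_complex by blast
qed

lemma ode_solves_iff_heun_operator:
  assumes f: "f has_fps_expansion F" and a: "par_a p \<noteq> 0"
  shows "(\<forall>\<^sub>F x in at 0. ode_solves (heun_ode p) f x) \<longleftrightarrow> heun_operator p F = 0"
proof -
  let ?a = "par_a p"
  define g where "g = (\<lambda>x. x * (x * (x * deriv (deriv f) x)) - (1 + ?a) * (x * (x * deriv (deriv f) x))
      + ?a * (x * deriv (deriv f) x)
      + (par_gamma p + par_delta p + par_epsilon p) * (x * (x * deriv f x))
      - (par_gamma p * (1 + ?a) + par_delta p * ?a + par_epsilon p) * (x * deriv f x)
      + (par_gamma p * ?a) * deriv f x + (par_alpha p * par_beta p) * (x * f x) - par_q p * f x)"
  have g: "g has_fps_expansion heun_operator p F"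
    unfolding g_def heun_operator_def Let_def by (intro fps_expansion_intros f)
  have "ode_solves (heun_ode p) f x \<longleftrightarrow> g x = 0" if x: "x \<noteq> 0 \<and> x \<noteq> 1 \<and> x \<noteq> ?a" for x
  proof -
    have nz: "x \<noteq> 0" "x - 1 \<noteq> 0" "x - ?a \<noteq> 0" using x by auto
    define K where "K = x * (x - 1) * (x - ?a)"
    have K: "K \<noteq> 0" using nz by (simp add: K_def)
    have P: "K * fst (heun_ode p) x = par_gamma p * ((x - 1) * (x - ?a)) + par_delta p * (x * (x - ?a)) +
        par_epsilon p * (x * (x - 1))"
      unfolding heun_ode_def fst_conv K_def using nz by (simp add: distrib_left)
    have Q: "K * snd (heun_ode p) x = par_alpha p * par_beta p * x - par_q p"
      unfolding heun_ode_def snd_conv K_def using nz by simp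
    have "K * (deriv (deriv f) x + fst (heun_ode p) x * deriv f x + snd (heun_ode p) x * f x) =
        K * deriv (deriv f) x + (K * fst (heun_ode p) x) * deriv f x + (K * snd (heun_ode p) x) * f x"
      by (simp add: algebra_simps)
    also have "\<dots> = g x" unfolding P Q unfolding K_def g_def by (simp add: algebra_simps)
    finally show ?thesis using K by (auto simp: ode_solves_def)
  qed
  then have *: "\<forall>\<^sub>F x in at 0. ode_solves (heun_ode p) f x \<longleftrightarrow> g x = 0"
    using eventually_at_0_regular[of ?a] by (auto elim: eventually_mono)
  show ?thesis
  proof
    assume "\<forall>\<^sub>F x in at 0. ode_solves (heun_ode p) f x"
    then have "\<forall>\<^sub>F x in at 0. g x = 0" using * by eventually_elim simp
    then show "heun_operator p F = 0" by (rule has_fps_expansion_eventually_at_0[OF g])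
  next
    assume "heun_operator p F = 0"
    then have "\<forall>\<^sub>F x in nhds 0. g x = 0" using g by (simp add: has_fps_expansion_0_iff)
    then have "\<forall>\<^sub>F x in at 0. g x = 0" by (simp add: eventually_nhds_conv_at)
    then show "\<forall>\<^sub>F x in at 0. ode_solves (heun_ode p) f x" using * by eventually_elim simp
  qed
qed

lemma of_nat_plus_nz:
  assumes "\<gamma> \<notin> \<int>\<^sub>\<le>\<^sub>0"
  shows "of_nat n + \<gamma> \<noteq> (0::complex)"
proof
  assume "of_nat n + \<gamma> = 0"
  then have "\<gamma> = - of_nat n" by (simp add: add_eq_0_iff)
  then show False using assms by auto
qed

text \<open>The leading coefficient \<open>a (n + 2) (n + 1 + \<gamma>)\<close> of the recurrence does not vanish.\<close>

lemma heun_operator_unique: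
  assumes "par_a p \<noteq> 0" "par_gamma p \<notin> \<int>\<^sub>\<le>\<^sub>0"
    and F: "heun_operator p F = 0" and G: "heun_operator p G = 0" and "fps_nth F 0 = fps_nth G 0"
  shows "F = G"
proof -
  have "fps_nth F n = fps_nth G n \<and> fps_nth F (Suc n) = fps_nth G (Suc n)" for n
  proof (induction n)
    case 0
    have "par_gamma p \<noteq> 0" using of_nat_plus_nz[OF assms(2), of 0] by simp
    then have "par_a p * par_gamma p \<noteq> 0" using assms(1) by simp
    moreover have "par_a p * par_gamma p * fps_nth F 1 = par_a p * par_gamma p * fps_nth G 1"
      using F G assms(5) by (simp add: heun_operator_eq_0_iff)
    ultimately show ?case using assms(5) by simp
  next
    case (Suc n)
    let ?c = "par_a p * (of_nat n + 2) * (of_nat n + 1 + par_gamma p)"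
    have "of_nat (n + 2) \<noteq> (0::complex)" by (simp only: of_nat_eq_0_iff)
    then have "?c \<noteq> 0"
      using assms(1) of_nat_plus_nz[OF assms(2), of "Suc n"] by (simp add: add_ac)
    moreover have "?c * fps_nth F (Suc (Suc n)) = ?c * fps_nth G (Suc (Suc n))"
      using F G Suc by (simp add: heun_operator_eq_0_iff)
    ultimately show ?case using Suc by simp
  qed
  then show ?thesis by (simp add: fps_eq_iff)
qed

lemma linear_ratio_tendsto:
  "(\<lambda>n. (u * of_nat n + v) / (of_nat n + w)) \<longlonglongrightarrow> (u::complex)"
proof (rule Lim_transform_eventually)
  have "(\<lambda>n. (u + v * (1 / of_nat n)) / (1 + w * (1 / of_nat n))) \<longlonglongrightarrow> (u + v * 0) / (1 + w * 0)"
    by (intro tendsto_intros; simp)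
  then show "(\<lambda>n. (u + v * (1 / of_nat n)) / (1 + w * (1 / of_nat n))) \<longlonglongrightarrow> u" by simp
  show "\<forall>\<^sub>F n in sequentially. (u + v * (1 / of_nat n)) / (1 + w * (1 / of_nat n)) =
      (u * of_nat n + v) / (of_nat n + w)"
    using eventually_gt_at_top[of 0]
  proof eventually_elim
    case (elim n)
    have "(u * of_nat n + v) / (of_nat n + w) =
        (of_nat n * (u + v * (1 / of_nat n))) / (of_nat n * (1 + w * (1 / of_nat n)))"
      using elim by (simp add: distrib_left mult.commute)
    also have "\<dots> = (u + v * (1 / of_nat n)) / (1 + w * (1 / of_nat n))"
      using elim by (subst mult_divide_mult_cancel_left) auto
    finally show ?case by simp
  qed
qed

text \<open>The coefficients of the three-term recurrence, divided by the leading one, are bounded, so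
  that the solution has geometrically bounded coefficients.\<close>

lemma heun_operator_exists:
  assumes a: "par_a p \<noteq> 0" and \<gamma>: "par_gamma p \<notin> \<int>\<^sub>\<le>\<^sub>0"
  obtains F where "heun_operator p F = 0" "fps_nth F 0 = 1" "fps_conv_radius F > 0"
proof -
  let ?a = "par_a p" and ?\<gamma> = "par_gamma p"
  define d where "d n = ?a * (of_nat n + 2) * (of_nat n + 1 + ?\<gamma>)" for n :: nat
  define A where "A n = recurrence_mid p (Suc n) / d n" for n
  define B where "B n = (of_nat n + par_alpha p) * (of_nat n + par_beta p) / d n" for n
  have d: "d n \<noteq> 0" for n
  proof -
    have "of_nat (n + 2) \<noteq> (0::complex)" by (simp only: of_nat_eq_0_iff)
    then show ?thesis using a of_nat_plus_nz[OF \<gamma>, of "Suc n"] by (simp add: d_def add_ac)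
  qed
  have "convergent A"
  proof -
    let ?e = "?\<gamma> * (1 + ?a) + ?a * par_delta p + par_epsilon p"
    have "A = (\<lambda>n. 1 / ?a * ((1 * of_nat n + 1) / (of_nat n + 2)) * (((1 + ?a) * of_nat n + ?e) / (of_nat n + (1 + ?\<gamma>)))
        + par_q p / ?a * ((0 * of_nat n + 1) / (of_nat n + 2)) * ((0 * of_nat n + 1) / (of_nat n + (1 + ?\<gamma>))))"
    proof
      fix n
      have "recurrence_mid p (Suc n) = (of_nat n + 1) * ((1 + ?a) * of_nat n + ?e) + par_q p"
        by (simp add: recurrence_mid_def algebra_simps)
      then have "A n = ((of_nat n + 1) * ((1 + ?a) * of_nat n + ?e) + par_q p) /
          (?a * (of_nat n + 2) * (of_nat n + (1 + ?\<gamma>)))"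
        by (simp only: A_def d_def add.assoc)
      moreover have "(N * L + q) / (a * M * G) = 1 / a * (N / M) * (L / G) + q / a * (1 / M) * (1 / G)"
        for N L q a M G :: complex by (simp add: add_divide_distrib)
      ultimately show "A n = 1 / ?a * ((1 * of_nat n + 1) / (of_nat n + 2)) * (((1 + ?a) * of_nat n + ?e) / (of_nat n + (1 + ?\<gamma>)))
        + par_q p / ?a * ((0 * of_nat n + 1) / (of_nat n + 2)) * ((0 * of_nat n + 1) / (of_nat n + (1 + ?\<gamma>)))"
        by (simp only: mult_1_left mult_zero_left add_0_left)
    qed
    moreover have "\<dots> \<longlonglongrightarrow> 1 / ?a * 1 * (1 + ?a) + par_q p / ?a * 0 * 0"
      by (intro tendsto_intros linear_ratio_tendsto)
    ultimately show ?thesis by (metis convergentI)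
  qed
  then obtain KA where KA: "\<And>n. norm (A n) \<le> KA"
    using convergent_imp_Bseq[of A] by (auto simp: Bseq_def)
  have "convergent B"
  proof -
    have "B = (\<lambda>n. 1 / ?a * ((1 * of_nat n + par_alpha p) / (of_nat n + 2)) *
        ((1 * of_nat n + par_beta p) / (of_nat n + (1 + ?\<gamma>))))"
      by (rule ext) (simp add: B_def d_def mult.assoc add.assoc)
    moreover have "\<dots> \<longlonglongrightarrow> 1 / ?a * 1 * 1"
      by (intro tendsto_intros linear_ratio_tendsto)
    ultimately show ?thesis by (metis convergentI)
  qed
  then obtain KB where KB: "\<And>n. norm (B n) \<le> KB"
    using convergent_imp_Bseq[of B] by (auto simp: Bseq_def)
  define c where "c = rec_nat (1, par_q p / (?a * ?\<gamma>)) (\<lambda>n (x, y). (y, A n * y - B n * x))"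
  have c_Suc: "c (Suc n) = (snd (c n), A n * snd (c n) - B n * fst (c n))" for n
    by (simp add: c_def case_prod_unfold)
  define F where "F = Abs_fps (\<lambda>n. fst (c n))"
  have F: "fps_nth F 0 = 1" "fps_nth F 1 = par_q p / (?a * ?\<gamma>)"
    "fps_nth F (Suc (Suc n)) = A n * fps_nth F (Suc n) - B n * fps_nth F n" for n
    by (simp_all add: F_def c_Suc) (simp_all add: c_def)
  have "?\<gamma> \<noteq> 0" using of_nat_plus_nz[OF \<gamma>, of 0] by simp
  moreover have "d n * fps_nth F (Suc (Suc n)) = recurrence_mid p (Suc n) * fps_nth F (Suc n) -
      (of_nat n + par_alpha p) * (of_nat n + par_beta p) * fps_nth F n" for n
    unfolding F(3) A_def B_def using d[of n] by (simp add: right_diff_distrib)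
  ultimately have op: "heun_operator p F = 0"
    using F(1,2) a unfolding heun_operator_eq_0_iff d_def by simp
  define M where "M = max 1 (max (norm (fps_nth F 1)) (KA + KB))"
  have M: "1 \<le> M" "norm (fps_nth F 1) \<le> M" "KA + KB \<le> M" by (auto simp: M_def)
  have K0: "0 \<le> KA" "0 \<le> KB" using KA KB norm_ge_zero order_trans by blast+
  have bound: "norm (fps_nth F n) \<le> M ^ n \<and> norm (fps_nth F (Suc n)) \<le> M ^ Suc n" for n
  proof (induction n)
    case 0
    then show ?case using F(1) M(2) by simp
  next
    case (Suc n)
    have "norm (fps_nth F (Suc (Suc n))) \<le> norm (A n) * norm (fps_nth F (Suc n)) + norm (B n) * norm (fps_nth F n)"
      unfolding F(3) by (metis norm_mult norm_triangle_ineq4)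
    also have "\<dots> \<le> KA * M ^ Suc n + KB * M ^ Suc n"
    proof (intro add_mono mult_mono KA KB)
      have "M ^ n \<le> M ^ Suc n" using M(1) by (intro power_increasing) auto
      then show "norm (fps_nth F n) \<le> M ^ Suc n" using Suc by linarith
    qed (use Suc K0 in auto)
    also have "\<dots> = (KA + KB) * M ^ Suc n" by (simp add: distrib_right)
    also have "\<dots> \<le> M * M ^ Suc n" using M by (intro mult_right_mono) auto
    finally show ?case using Suc by simp
  qed
  let ?z = "1 / (2 * complex_of_real M)"
  have "summable (\<lambda>n. fps_nth F n * ?z ^ n)"
  proof (rule summable_comparison_test)
    show "\<exists>N. \<forall>n\<ge>N. norm (fps_nth F n * ?z ^ n) \<le> (1/2) ^ n"
    proof (intro exI allI impI)
      fix n
      have "norm (fps_nth F n * ?z ^ n) \<le> M ^ n * (1 / (2 * M)) ^ n"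
        using bound[of n] M(1) by (simp add: norm_mult norm_power norm_divide mult_right_mono)
      also have "\<dots> = (1/2) ^ n" using M(1) by (simp flip: power_mult_distrib)
      finally show "norm (fps_nth F n * ?z ^ n) \<le> (1/2) ^ n" .
    qed
    show "summable (\<lambda>n. (1/2::real) ^ n)" by (rule summable_geometric) simp
  qed
  then have "ereal (norm ?z) \<le> fps_conv_radius F"
    unfolding fps_conv_radius_def by (rule conv_radius_geI)
  moreover have "0 < norm ?z" using M(1) by simp
  ultimately have "fps_conv_radius F > 0" by (metis ereal_less(2) order_less_le_trans)
  then show thesis using that op F(1) by blast
qed

definition is_Hl_series :: "heun \<Rightarrow> complex fps \<Rightarrow> bool" where
  "is_Hl_series p F \<longleftrightarrow> fps_conv_radius F > 0 \<and> eval_fps F 0 = 1 \<and>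
     (\<forall>\<^sub>F x in at 0. ode_solves (heun_ode p) (eval_fps F) x)"

lemma is_Hl_series_iff:
  assumes "par_a p \<noteq> 0"
  shows "is_Hl_series p F \<longleftrightarrow> fps_conv_radius F > 0 \<and> fps_nth F 0 = 1 \<and> heun_operator p F = 0"
  using ode_solves_iff_heun_operator[OF eval_fps_has_fps_expansion assms, of F]
  by (auto simp: is_Hl_series_def eval_fps_at_0)

lemma Hl_eq_eval_fps:
  assumes "par_a p \<noteq> 0" "par_gamma p \<notin> \<int>\<^sub>\<le>\<^sub>0" "is_Hl_series p F"
  shows "Hl p = eval_fps F"
proof -
  have "(THE F. is_Hl_series p F) = F"
    using assms(3) heun_operator_unique[OF assms(1,2)] by (intro the_equality) (auto simp: is_Hl_series_iff[OF assms(1)])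
  then show ?thesis by (simp add: Hl_def is_Hl_series_def)
qed

lemma Hl_solution:
  assumes "par_a p \<noteq> 0" "par_gamma p \<notin> \<int>\<^sub>\<le>\<^sub>0"
  shows "Hl p analytic_on {0}" "Hl p 0 = 1" "\<forall>\<^sub>F x in at 0. ode_solves (heun_ode p) (Hl p) x"
proof -
  obtain F where "heun_operator p F = 0" "fps_nth F 0 = 1" "fps_conv_radius F > 0"
    using heun_operator_exists[OF assms] by blast
  then have F: "is_Hl_series p F" by (simp add: is_Hl_series_iff[OF assms(1)])
  note Hl_eq = Hl_eq_eval_fps[OF assms F]
  show "Hl p 0 = 1" "\<forall>\<^sub>F x in at 0. ode_solves (heun_ode p) (Hl p) x"
    unfolding Hl_eq using F by (auto simp: is_Hl_series_def)
  show "Hl p analytic_on {0}"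
    unfolding Hl_eq using F eval_fps_has_fps_expansion[of F] has_fps_expansion_imp_analytic_0
    by (auto simp: is_Hl_series_def)
qed

lemma Hl_unique:
  assumes "par_a p \<noteq> 0" "par_gamma p \<notin> \<int>\<^sub>\<le>\<^sub>0"
    and f: "f analytic_on {0}" "f 0 = 1" "\<forall>\<^sub>F x in at 0. ode_solves (heun_ode p) f x"
  shows "\<forall>\<^sub>F x in nhds 0. Hl p x = f x"
proof -
  let ?F = "fps_expansion f 0"
  have exp: "f has_fps_expansion ?F" by (rule analytic_at_imp_has_fps_expansion_0[OF f(1)])
  then have rad: "fps_conv_radius ?F > 0" and ev: "\<forall>\<^sub>F x in nhds 0. eval_fps ?F x = f x"
    by (auto simp: has_fps_expansion_def)
  have "heun_operator p ?F = 0" using ode_solves_iff_heun_operator[OF exp assms(1)] f(3) by simp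
  moreover have "fps_nth ?F 0 = 1"
    using eventually_nhds_x_imp_x[OF ev] f(2) by (simp add: eval_fps_at_0)
  ultimately have "is_Hl_series p ?F" using rad by (simp add: is_Hl_series_iff[OF assms(1)])
  then show ?thesis using Hl_eq_eval_fps[OF assms(1,2)] ev by simp
qed

lemma ode_solves_lift:
  assumes \<phi>: "\<phi> analytic_on {t}" "deriv \<phi> t \<noteq> 0" and u: "u analytic_on {\<phi> t}"
    and h: "h analytic_on {t}" "h t \<noteq> 0" and sol: "ode_solves E' u (\<phi> t)"
    and E: "ode_at (ode_rescale (\<lambda>x. deriv h x / h x) (ode_pullback \<phi> E')) t = ode_at E t"
  shows "ode_solves E (\<lambda>x. h x * u (\<phi> x)) t"
proof -
  let ?U = "\<lambda>x. u (\<phi> x)"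
  define \<eta> where "\<eta> = deriv h t / h t"
  define \<eta>' where "\<eta>' = deriv (\<lambda>x. deriv h x / h x) t"
  have U: "?U analytic_on {t}" by (rule analytic_at_compose[OF \<phi>(1) u])
  have h1: "deriv h t = \<eta> * h t" using h(2) by (simp add: \<eta>_def)
  have h2: "deriv (deriv h) t = (\<eta>' + \<eta>\<^sup>2) * h t"
  proof -
    have "((\<lambda>x. deriv h x / h x) has_field_derivative
        (deriv (deriv h) t * h t - deriv h t * deriv h t) / (h t * h t)) (at t)"
      by (rule DERIV_divide[OF analytic_at_imp_has_deriv[OF analytic_deriv[OF h(1)]] analytic_at_imp_has_deriv[OF h(1)] h(2)])
    then have "\<eta>' = (deriv (deriv h) t * h t - deriv h t * deriv h t) / (h t * h t)"
      unfolding \<eta>'_def by (rule DERIV_imp_deriv)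
    then have "\<eta>' = deriv (deriv h) t / h t - \<eta>\<^sup>2"
      unfolding h1 using h(2) by (simp add: diff_divide_distrib power2_eq_square)
    then show ?thesis using h(2) by simp
  qed
  have "\<forall>\<^sub>F x in nhds t. deriv (\<lambda>x. h x * ?U x) x = h x * deriv ?U x + deriv h x * ?U x"
    using eventually_nhds_analytic_at[OF h(1)] eventually_nhds_analytic_at[OF U]
    by eventually_elim (rule complex_derivative_mult_at)
  note ev = this
  have v1: "deriv (\<lambda>x. h x * ?U x) t = h t * deriv ?U t + deriv h t * ?U t"
    using eventually_nhds_x_imp_x[OF ev] .
  have "deriv (deriv (\<lambda>x. h x * ?U x)) t = deriv (\<lambda>x. h x * deriv ?U x + deriv h x * ?U x) t"
    by (rule deriv_cong_ev[OF ev refl])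
  also have "\<dots> = (h t * deriv (deriv ?U) t + deriv h t * deriv ?U t) +
      (deriv h t * deriv ?U t + deriv (deriv h) t * ?U t)"
    using h(1) U analytic_deriv
    by (simp add: complex_derivative_add_at complex_derivative_mult_at analytic_intros)
  finally have v2: "deriv (deriv (\<lambda>x. h x * ?U x)) t =
      (h t * deriv (deriv ?U) t + deriv h t * deriv ?U t) + (deriv h t * deriv ?U t + deriv (deriv h) t * ?U t)" .
  define A B where "A = fst (ode_pullback \<phi> E') t" and "B = snd (ode_pullback \<phi> E') t"
  have U1: "deriv ?U t = deriv u (\<phi> t) * deriv \<phi> t" by (rule deriv_compose_at[OF \<phi>(1) u])
  have U2: "deriv (deriv ?U) t = - A * deriv ?U t - B * ?U t"
  proof -
    have "deriv (deriv u) (\<phi> t) = - (fst E' (\<phi> t) * deriv u (\<phi> t)) - snd E' (\<phi> t) * u (\<phi> t)"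
      using sol unfolding ode_solves_def by algebra
    moreover have "deriv (deriv \<phi>) t / deriv \<phi> t * deriv \<phi> t = deriv (deriv \<phi>) t" using \<phi>(2) by simp
    ultimately show ?thesis
      unfolding deriv2_compose_at[OF \<phi>(1) u] U1 A_def B_def ode_pullback_def fst_conv snd_conv by algebra
  qed
  have PQ: "fst E t = A - 2 * \<eta>" "snd E t = B - A * \<eta> + \<eta>\<^sup>2 - \<eta>'"
    using E by (simp_all add: ode_at_eq_iff ode_rescale_def A_def B_def \<eta>_def \<eta>'_def)
  show ?thesis unfolding ode_solves_def PQ v1 v2 U2 h1 h2 by algebra
qed

text \<open>The right-hand side is analytic at \<open>0\<close>, equals \<open>1\<close> there and solves the equation of \<open>p\<close>.\<close>

lemma Hl_normalized_lift:
  assumes L: "normalized_lift p h \<phi> p'" and p: "par_a p \<noteq> 0" "par_gamma p \<notin> \<int>\<^sub>\<le>\<^sub>0"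
    and p': "par_a p' \<noteq> 0" "par_gamma p' \<notin> \<int>\<^sub>\<le>\<^sub>0"
  shows "\<forall>\<^sub>F x in nhds 0. Hl p x = h x * Hl p' (\<phi> x)"
proof (rule Hl_unique[OF p])
  have \<phi>: "\<phi> analytic_on {0}" "\<phi> 0 = 0" "deriv \<phi> 0 \<noteq> 0" and h: "h analytic_on {0}" "h 0 = 1"
    and E: "germ_lift (heun_ode p) (\<lambda>x. deriv h x / h x) \<phi> (heun_ode p')"
    using L by (auto simp: normalized_lift_def)
  note u = Hl_solution[OF p']
  have u0: "Hl p' analytic_on {\<phi> 0}" using u(1) \<phi>(2) by simp
  show "(\<lambda>x. h x * Hl p' (\<phi> x)) analytic_on {0}"
    using h analytic_at_compose[OF \<phi>(1) u0] by (auto intro: analytic_intros)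
  show "h 0 * Hl p' (\<phi> 0) = 1" using h \<phi> u by simp
  have g: "filterlim \<phi> (at 0) (at 0)" "\<forall>\<^sub>F t in at 0. deriv \<phi> t \<noteq> 0"
    using germ_map_if_deriv_nz(1)[OF \<phi>] by (auto simp: germ_map_def)
  have "\<forall>\<^sub>F t in at 0. ode_solves (heun_ode p') (Hl p') (\<phi> t)"
    by (rule eventually_compose_filterlim[OF u(3) g(1)])
  moreover have "\<forall>\<^sub>F t in at 0. Hl p' analytic_on {\<phi> t}"
    by (rule eventually_compose_filterlim[OF eventually_at_analytic_at[OF u(1)] g(1)])
  moreover have "\<forall>\<^sub>F t in at 0. h t \<noteq> 0"
    using analytic_eventually_nz[OF h] by (simp add: eventually_nhds_conv_at)
  ultimately show "\<forall>\<^sub>F x in at 0. ode_solves (heun_ode p) (\<lambda>x. h x * Hl p' (\<phi> x)) x"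
    using eventually_at_analytic_at[OF \<phi>(1)] eventually_at_analytic_at[OF h(1)] g(2) E[unfolded germ_lift_def]
  proof eventually_elim
    case (elim t)
    show ?case by (rule ode_solves_lift[OF elim(4,6,2,5,3,1,7)])
  qed
qed

section \<open>The classification\<close>

lemma prefactor_product:
  fixes \<kappa> :: "complex \<Rightarrow> complex"
  assumes "finite C" "0 \<notin> C"
  defines "h \<equiv> \<lambda>x. \<Prod>c\<in>C. (1 - x / c) powr \<kappa> c"
  shows "h analytic_on {0::complex}" "h 0 = 1"
    "\<forall>\<^sub>F x in at 0. deriv h x / h x = (\<Sum>c\<in>C. \<kappa> c / (x - c))"
proof -
  have "h analytic_on {0} \<and> h 0 = 1 \<and> (\<forall>\<^sub>F x in at 0. deriv h x / h x = (\<Sum>c\<in>C. \<kappa> c / (x - c)))"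
    unfolding h_def using assms(1,2)
  proof (induction C rule: finite_induct)
    case empty
    then show ?case by simp
  next
    case (insert b C)
    let ?g = "\<lambda>x. (1 - x / b) powr \<kappa> b" and ?h = "\<lambda>x. \<Prod>c\<in>C. (1 - x / c) powr \<kappa> c"
    have b: "b \<noteq> 0" using insert by auto
    have IH: "?h analytic_on {0}" "?h 0 = 1"
      "\<forall>\<^sub>F x in at 0. deriv ?h x / ?h x = (\<Sum>c\<in>C. \<kappa> c / (x - c))"
      using insert by auto
    have g: "?g analytic_on {0}" "?g 0 = 1" using b by (auto intro!: analytic_intros)
    have "filterlim (\<lambda>x. x / b) (at 0) (at 0)"
      using b eventually_neq_at_within[of "0::complex" 0]
      by (auto simp: filterlim_at intro!: tendsto_eq_intros elim!: eventually_mono)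
    from eventually_compose_filterlim[OF log_deriv_powr(3)[of "\<kappa> b"] this]
      eventually_compose_filterlim[OF eventually_at_analytic_at[OF log_deriv_powr(1)[of "\<kappa> b"]] this]
    have dg: "\<forall>\<^sub>F x in at 0. deriv ?g x / ?g x = \<kappa> b / (x - b)"
      using eventually_neq_at_within[of b 0]
    proof eventually_elim
      case (elim x)
      have "(\<lambda>x. x / b) analytic_on {x}" using b by (auto intro!: analytic_intros)
      from deriv_compose_at[OF this elim(2)]
      have "deriv ?g x = deriv (\<lambda>y. (1 - y) powr \<kappa> b) (x / b) * deriv (\<lambda>x. x / b) x" .
      moreover have "deriv (\<lambda>x. x / b) x = 1 / b"
        by (rule DERIV_imp_deriv) (use b in \<open>auto intro!: derivative_eq_intros\<close>)
      ultimately have "deriv ?g x / ?g x = deriv (\<lambda>y. (1 - y) powr \<kappa> b) (x / b) / ?g x * (1 / b)"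
        by simp
      also have "\<dots> = \<kappa> b / (x / b - 1) * (1 / b)" unfolding elim(1) ..
      also have "x / b - 1 = (x - b) / b" using b by (simp add: diff_divide_distrib)
      finally show ?case using b by simp
    qed
    have "\<forall>\<^sub>F x in at 0. deriv (\<lambda>x. ?g x * ?h x) x / (?g x * ?h x) = \<kappa> b / (x - b) + (\<Sum>c\<in>C. \<kappa> c / (x - c))"
      using dg IH(3) eventually_at_analytic_at[OF g(1)] eventually_at_analytic_at[OF IH(1)]
        analytic_eventually_nz[OF g, unfolded eventually_nhds_conv_at, THEN conjunct1]
        analytic_eventually_nz[OF IH(1,2), unfolded eventually_nhds_conv_at, THEN conjunct1]
    proof eventually_elim
      case (elim x)
      have quot: "(g * k' + g' * k) / (g * k) = g' / g + k' / k" if "g \<noteq> 0" "k \<noteq> 0" for g g' k k' :: complex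
        using that by (simp add: add_divide_distrib)
      have "deriv (\<lambda>x. ?g x * ?h x) x / (?g x * ?h x) = deriv ?g x / ?g x + deriv ?h x / ?h x"
        unfolding complex_derivative_mult_at[OF elim(3,4)] by (rule quot[OF elim(5,6)])
      then show ?case unfolding elim(1,2) .
    qed
    moreover have h: "(\<lambda>x. \<Prod>c\<in>insert b C. (1 - x / c) powr \<kappa> c) = (\<lambda>x. ?g x * ?h x)"
      using insert by simp
    moreover have "(\<Sum>c\<in>insert b C. \<kappa> c / (x - c)) = \<kappa> b / (x - b) + (\<Sum>c\<in>C. \<kappa> c / (x - c))" for x
      using insert by simp
    ultimately have "\<forall>\<^sub>F x in at 0. deriv (\<lambda>x. \<Prod>c\<in>insert b C. (1 - x / c) powr \<kappa> c) x /
        (\<Prod>c\<in>insert b C. (1 - x / c) powr \<kappa> c) = (\<Sum>c\<in>insert b C. \<kappa> c / (x - c))"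
      by (simp only: fun_cong[OF h])
    moreover have "(\<lambda>x. \<Prod>c\<in>insert b C. (1 - x / c) powr \<kappa> c) analytic_on {0}"
      unfolding h by (rule analytic_on_mult[OF g(1) IH(1)])
    moreover have "(\<Prod>c\<in>insert b C. (1 - 0 / c) powr \<kappa> c) = 1"
      unfolding fun_cong[OF h] g(2) IH(2) by simp
    ultimately show ?case by blast
  qed
  then show "h analytic_on {0::complex}" "h 0 = 1"
    "\<forall>\<^sub>F x in at 0. deriv h x / h x = (\<Sum>c\<in>C. \<kappa> c / (x - c))" by auto
qed

text \<open>The exponents \<open>\<kappa>\<close> of the prefactor are the residues of \<open>\<eta>\<close>, so \<open>\<eta>\<close> is its logarithmic derivative.\<close>

lemma Hl_transformation_normalized_lift:
  assumes C: "finite C" "0 \<notin> C" and L: "heun_lift R p p' (\<lambda>x. \<Sum>c\<in>C. \<kappa> c / (x - c))"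
    and h: "\<forall>\<^sub>F x in nhds 0. h x = (\<Prod>c\<in>C. (1 - x / c) powr \<kappa> c)"
    and R: "poly (snd R) 0 \<noteq> 0" "poly (fst R) 0 = 0" "deriv (rat_fun R) 0 \<noteq> 0"
  shows "normalized_lift p h (rat_fun R) p'"
proof -
  let ?h = "\<lambda>x. \<Prod>c\<in>C. (1 - x / c) powr \<kappa> c" and ?\<eta> = "\<lambda>x. \<Sum>c\<in>C. \<kappa> c / (x - c)"
  note H = prefactor_product[OF C, of \<kappa>]
  have "\<forall>\<^sub>\<infinity>x. ode_at (ode_rescale ?\<eta> (ode_pullback (rat_fun R) (heun_ode p'))) x = ode_at (heun_ode p) x"
    using L by (simp add: heun_lift_def ode_at_def)
  from eventually_chart_cofinite[OF this, of "Pt 0"]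
  have "germ_lift (heun_ode p) ?\<eta> (rat_fun R) (heun_ode p')" by (simp add: germ_lift_def)
  then have "germ_lift (heun_ode p) (\<lambda>x. deriv ?h x / ?h x) (rat_fun R) (heun_ode p')"
    by (rule germ_lift_cong) (use H(3) in \<open>auto elim: eventually_mono\<close>)
  then have "normalized_lift p ?h (rat_fun R) p'"
    using H(1,2) R rat_fun_analytic[OF R(1)] by (simp add: normalized_lift_def rat_fun_def)
  then show ?thesis
    by (rule normalized_lift_cong) (use h in \<open>auto elim: eventually_mono\<close>)
qed

lemma quartic_transformation_Hl:
  assumes a: "a \<noteq> 0" "a \<noteq> 1" and \<gamma>: "\<gamma> \<notin> \<int>\<^sub>\<le>\<^sub>0"
  shows "\<forall>\<^sub>F x in nhds 0. Hl (quartic_source a q \<gamma>) x =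
    quartic_prefactor a \<gamma> x * Hl (quartic_target a q \<gamma>) (rat_fun (quartic_map a) x)"
  by (rule Hl_normalized_lift[OF normalized_lift_quartic[OF a]])
     (use a \<gamma> in \<open>auto simp: quartic_source_def quartic_target_def\<close>)

lemma quartic_biquadratic_Hl_transformation:
  assumes a: "a \<noteq> 0" "a \<noteq> 1" and \<gamma>: "\<gamma> \<notin> \<int>\<^sub>\<le>\<^sub>0" and target: "heun_equation (quartic_target a q \<gamma>)"
  shows "biquadratic_Hl_transformation (quartic_source a q \<gamma>) (quartic_prefactor a \<gamma>) (quartic_map a)
    (quartic_target a q \<gamma>)"
proof -
  define s where "s = csqrt a"
  have a_s: "a = s\<^sup>2" by (simp add: s_def)
  have s: "s \<noteq> 0" "s\<^sup>2 \<noteq> 1" using a a_s by auto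
  let ?C = "{s, - s}" and ?\<kappa> = "\<lambda>_::complex. 1/2 - \<gamma>"
  have L: "heun_lift (quartic_map a) (quartic_source a q \<gamma>) (quartic_target a q \<gamma>)
      (\<lambda>x. \<Sum>c\<in>?C. ?\<kappa> c / (x - c))"
    using quartic_heun_lift[OF s] target unfolding a_s by simp
  have C: "finite ?C" "0 \<notin> ?C" using s by auto
  let ?h = "\<lambda>x. \<Prod>c\<in>?C. (1 - x / c) powr ?\<kappa> c"
  \<comment> \<open>both prefactors have the logarithmic derivative that the first coefficients prescribe\<close>
  have "0\<^sup>2 \<noteq> a" using a by simp
  from deriv_quartic_map(2)[OF this] have "deriv (rat_fun (quartic_map a)) 0 \<noteq> 0" using a by simp
  then have "normalized_lift (quartic_source a q \<gamma>) ?h (rat_fun (quartic_map a)) (quartic_target a q \<gamma>)"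
    by (intro Hl_transformation_normalized_lift[OF C L]) (use a in \<open>auto simp: quartic_map_sel\<close>)
  then have h: "\<forall>\<^sub>F x in nhds 0. quartic_prefactor a \<gamma> x = ?h x"
    using normalized_lift_unique(2)[OF _ _ a] normalized_lift_quartic[OF a, of q \<gamma>]
    unfolding quartic_source_def by blast
  have "Hl_transformation (quartic_source a q \<gamma>) (quartic_prefactor a \<gamma>) (quartic_map a) (quartic_target a q \<gamma>)"
    unfolding Hl_transformation_def
  proof (intro conjI exI[of _ ?C] exI[of _ ?\<kappa>])
    show "poly (fst (quartic_map a)) 0 = 0" by (simp add: quartic_map_sel)
  qed (use quartic_transformation_Hl[OF a \<gamma>] L C h \<gamma> in \<open>auto simp: quartic_source_def quartic_target_def\<close>)
  moreover have "biquadratic (quartic_map a) (quartic_source a q \<gamma>) (quartic_target a q \<gamma>)"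
    using biquadratic_quartic_map[OF s] target unfolding a_s by simp
  ultimately show ?thesis by (simp add: biquadratic_Hl_transformation_def)
qed

text \<open>The normal form determines the map up to Moebius transformations, and all exponent differences up to sign.
The chain from \<open>p\<close> to the source, through \<open>S\<close>, and from the target to \<open>p'\<close> is then built from \<open>p'\<close>
backwards, which fixes the accessory parameter along the way. It realizes the same map, hence the same
prefactor, and starts at \<open>p\<close> itself.\<close>

lemma biquadratic_Hl_transformation_unique:
  assumes B: "biquadratic_Hl_transformation p h R p'"
    and unram: "all_exponent_differences_half p' \<longrightarrow> Pt 0 \<notin> critical_values R"
  obtains a q \<gamma> k l \<psi> where "a \<noteq> 0" "a \<noteq> 1" "\<gamma> \<notin> \<int>\<^sub>\<le>\<^sub>0"
    "moebius_F p k (\<lambda>x. x) (quartic_source a q \<gamma>)" "moebius_F (quartic_target a q \<gamma>) l \<psi> p'"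
    "\<forall>\<^sub>F x in nhds 0. rat_fun R x = \<psi> (rat_fun (quartic_map a) x)"
    "\<forall>\<^sub>F x in nhds 0. h x = k x * quartic_prefactor a \<gamma> x * l (rat_fun (quartic_map a) x)"
proof -
  have bi: "biquadratic R p p'" and T: "Hl_transformation p h R p'"
    using B by (auto simp: biquadratic_Hl_transformation_def)
  obtain C \<kappa> where C: "finite C" "0 \<notin> C" and L: "heun_lift R p p' (\<lambda>x. \<Sum>c\<in>C. \<kappa> c / (x - c))"
    and h: "\<forall>\<^sub>F x in nhds 0. h x = (\<Prod>c\<in>C. (1 - x / c) powr \<kappa> c)"
    using T unfolding Hl_transformation_def by blast
  have \<gamma>: "par_gamma p \<notin> \<int>\<^sub>\<le>\<^sub>0" and R0: "poly (fst R) 0 = 0"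
    using T by (auto simp: Hl_transformation_def)
  have deg: "rat_deg R = 4" using bi by (simp add: biquadratic_def heun_transformation_def)
  interpret heun_lifting R p p' "\<lambda>x. \<Sum>c\<in>C. \<kappa> c / (x - c)"
    by (rule heun_lifting_intro[OF L C(1)]) (simp add: deg)
  have "0 < rat_mult R (Pt 0) (Pt 0)" using rat_mult_pos_Pt[OF R, of "Pt 0" 0] R0 by simp
  from biquadratic_fibre[OF bi this]
  have fibre0: "(\<forall>z \<in> heun_points p. 0 < rat_mult R (Pt 0) z) \<or> Pt 0 \<notin> critical_values R"
    using unram all_exponent_differences_half_iff[OF par_a(3,4)] by blast
  obtain r s t v where nf: "finite_points_perm (par_a p) r s t" "v \<noteq> 0" "par_a p' = (s - t) / (r - t)"
    "\<And>x. poly (fst R) x = v\<^sup>2 * (s - t) * (x * (x - 1) * (x - par_a p))"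
    "snd R = smult (v\<^sup>2 / 4) ([:r * t - r * s + s * t, - 2 * t, 1:]\<^sup>2)"
    and half: "\<And>w. w \<in> heun_points p' \<Longrightarrow> w \<noteq> Pt 0 \<Longrightarrow> exponent_diff_sq p' w = 1/4"
    and same: "\<And>z. z \<in> heun_points p \<Longrightarrow> exponent_diff_sq p z = exponent_diff_sq p' (Pt 0)"
    using quartic_normal_form[OF deg fibre0] by blast
  obtain a q \<alpha> \<beta> \<gamma> \<delta> where p: "p = Heun a q \<alpha> \<beta> \<gamma> \<delta>" by (cases p)
  obtain a' q' \<alpha>' \<beta>' \<gamma>' \<delta>' where p': "p' = Heun a' q' \<alpha>' \<beta>' \<gamma>' \<delta>'" by (cases p')
  have a: "a \<noteq> 0" "a \<noteq> 1" using par_a p by auto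
  have ne: "s \<noteq> t" using finite_points_perm_distinct[OF nf(1)] par_a by blast
  let ?S = "rat_fun (quartic_map a)"
  have D0: "poly (snd R) 0 \<noteq> 0" using coprime_poly_0[OF R(1), of 0] R0 by simp
  have dR: "deriv (rat_fun R) 0 \<noteq> 0"
  proof -
    have "poly (fst R) = (\<lambda>x. v\<^sup>2 * (s - t) * (x * (x - 1) * (x - a)))" using nf(4) p by auto
    then have N: "(poly (fst R) has_field_derivative v\<^sup>2 * (s - t) * a) (at 0)"
      by (auto intro!: derivative_eq_intros)
    have "(rat_fun R has_field_derivative
        (v\<^sup>2 * (s - t) * a * poly (snd R) 0 - poly (fst R) 0 * poly (pderiv (snd R)) 0) /
        (poly (snd R) 0 * poly (snd R) 0)) (at 0)"
      unfolding rat_fun_def [abs_def] by (rule DERIV_divide[OF N poly_DERIV D0])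
    then show ?thesis using DERIV_imp_deriv R0 D0 nf(2) ne a by fastforce
  qed
  have NL: "normalized_lift p h (rat_fun R) p'"
    by (rule Hl_transformation_normalized_lift[OF C L h D0 R0 dR])
  have \<gamma>': "\<gamma>' = \<gamma>" using normalized_lift_gamma[OF NL par_a(1,3)] p p' by simp
  obtain \<psi> where mv: "moebius_moves \<gamma> a \<psi> a'"
    and \<psi>: "\<forall>\<^sub>F x in nhds 0. 4 * (s - t) * (x * (x - 1) * (x - a)) / (x\<^sup>2 - 2 * t * x + (r * t - r * s + s * t))\<^sup>2 =
       \<psi> (?S x)"
    using quartic_map_moebius[OF a, of r s t \<gamma>] nf(1,3) p p' by auto
  have R\<psi>: "\<forall>\<^sub>F x in nhds 0. rat_fun R x = \<psi> (?S x)"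
    using \<psi>
  proof eventually_elim
    case (elim x)
    have "poly (snd R) x = v\<^sup>2 / 4 * (x\<^sup>2 - 2 * t * x + (r * t - r * s + s * t))\<^sup>2"
      unfolding nf(5) poly_smult poly_power by (simp add: power2_eq_square algebra_simps)
    then have "rat_fun R x = v\<^sup>2 * (s - t) * (x * (x - 1) * (x - a)) /
        (v\<^sup>2 / 4 * (x\<^sup>2 - 2 * t * x + (r * t - r * s + s * t))\<^sup>2)"
      using nf(4)[of x] p by (simp only: rat_fun_def heun.sel)
    also have "\<dots> = 4 * (s - t) * (x * (x - 1) * (x - a)) / (x\<^sup>2 - 2 * t * x + (r * t - r * s + s * t))\<^sup>2"
    proof -
      have "v\<^sup>2 * A * M / (v\<^sup>2 / 4 * Q) = 4 * A * M / Q" for A M Q using nf(2) by simp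
      then show ?thesis .
    qed
    finally show ?case using elim by simp
  qed
  \<comment> \<open>from the target to \<open>p'\<close>: first the Moebius part, then the signs of the exponent differences\<close>
  have "half_differences (\<gamma> / 2 - 1/4) (\<gamma> / 2 + 1/4) \<gamma> (1/2)"
    by (simp add: half_differences_def power2_eq_square)
  then obtain \<alpha>2 \<beta>2 \<delta>2 where m: "half_differences \<alpha>2 \<beta>2 \<gamma> \<delta>2"
    "\<And>q2. \<exists>q l. moebius_F (Heun a q (\<gamma> / 2 - 1/4) (\<gamma> / 2 + 1/4) \<gamma> (1/2)) l \<psi> (Heun a' q2 \<alpha>2 \<beta>2 \<gamma> \<delta>2)"
    using mv unfolding moebius_moves_def by blast
  have half': "half_differences \<alpha>' \<beta>' \<gamma> \<delta>'"
    using half[of "Pt 1"] half[of "Pt a'"] half[of Infinity] p' par_a \<gamma>'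
    by (simp add: heun_points_def half_differences_def par_epsilon_def)
  have signs: "(1 - \<delta>')\<^sup>2 = (1 - \<delta>2)\<^sup>2"
    "(1 - (\<alpha>' + \<beta>' - \<gamma> - \<delta>' + 1))\<^sup>2 = (1 - (\<alpha>2 + \<beta>2 - \<gamma> - \<delta>2 + 1))\<^sup>2"
    "(\<alpha>' - \<beta>')\<^sup>2 = (\<alpha>2 - \<beta>2)\<^sup>2"
    using m(1) half' unfolding half_differences_def by (metis (no_types))+
  have "a' \<noteq> 0" using par_a p' by simp
  obtain k2 s2 where k2: "\<And>q. moebius_F (Heun a' q \<alpha>2 \<beta>2 \<gamma> \<delta>2) k2 (\<lambda>x. x) (Heun a' (q + s2) \<alpha>' \<beta>' \<gamma> \<delta>')"
    using moebius_F_exponent_signs[OF \<open>a' \<noteq> 0\<close> signs] by blast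
  obtain q1 l1 where "moebius_F (Heun a q1 (\<gamma> / 2 - 1/4) (\<gamma> / 2 + 1/4) \<gamma> (1/2)) l1 \<psi> (Heun a' (q' - s2) \<alpha>2 \<beta>2 \<gamma> \<delta>2)"
    using m(2) by blast
  from compose[OF this k2] obtain l where
    l: "moebius_F (quartic_target a (4 * q1) \<gamma>) l \<psi> p'"
    by (simp add: quartic_target_def p' \<gamma>')
  \<comment> \<open>from \<open>p\<close> to the source, with an accessory parameter still to be identified with that of \<open>p\<close>\<close>
  have src: "(1 - \<gamma>)\<^sup>2 = (1 - \<delta>)\<^sup>2" "(2 * \<gamma> - 1 - \<gamma>)\<^sup>2 = (\<alpha> - \<beta>)\<^sup>2"
    "(1 - (2 * \<gamma> - 1 + \<gamma> - \<gamma> - \<gamma> + 1))\<^sup>2 = (1 - (\<alpha> + \<beta> - \<gamma> - \<delta> + 1))\<^sup>2"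
  proof -
    have e: "exponent_diff_sq p z = (1 - \<gamma>)\<^sup>2" if "z \<in> heun_points p" for z
      using same[OF that] p' \<gamma>' by simp
    show "(1 - \<gamma>)\<^sup>2 = (1 - \<delta>)\<^sup>2" using e[of "Pt 1"] p by (simp add: heun_points_def)
    show "(2 * \<gamma> - 1 - \<gamma>)\<^sup>2 = (\<alpha> - \<beta>)\<^sup>2"
      using e[of Infinity] p power2_commute[of 1 \<gamma>] by (simp add: heun_points_def)
    show "(1 - (2 * \<gamma> - 1 + \<gamma> - \<gamma> - \<gamma> + 1))\<^sup>2 = (1 - (\<alpha> + \<beta> - \<gamma> - \<delta> + 1))\<^sup>2"
      using e[of "Pt a"] p a by (simp add: heun_points_def par_epsilon_def)
  qed
  obtain k s1 where k: "\<And>q. moebius_F (Heun a q \<alpha> \<beta> \<gamma> \<delta>) k (\<lambda>x. x) (Heun a (q + s1) (2 * \<gamma> - 1) \<gamma> \<gamma> \<gamma>)"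
    using moebius_F_exponent_signs[OF a(1) src(1,3,2)] by blast
  \<comment> \<open>the accessory parameter from which the chain arrives at \<open>q'\<close>\<close>
  define q0 where "q0 = 4 * q1 - s1"
  let ?p = "Heun a q0 \<alpha> \<beta> \<gamma> \<delta>"
  have k': "moebius_F ?p k (\<lambda>x. x) (quartic_source a (4 * q1) \<gamma>)"
    using k[of q0] by (simp add: quartic_source_def q0_def)
  have "normalized_lift ?p k (\<lambda>x. x) (quartic_source a (4 * q1) \<gamma>)"
    using moebius_F_normalized_lift[OF k'] a by simp
  moreover have "normalized_lift (quartic_target a (4 * q1) \<gamma>) l \<psi> p'"
    using moebius_F_normalized_lift[OF l] a by (simp add: quartic_target_def)
  ultimately have "normalized_lift ?p (\<lambda>x. k x * (quartic_prefactor a \<gamma> x * l (?S x))) (\<lambda>x. \<psi> (?S x)) p'"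
    using normalized_lift_compose[OF _ normalized_lift_compose[OF normalized_lift_quartic[OF a]]] by blast
  then have "normalized_lift ?p (\<lambda>x. k x * (quartic_prefactor a \<gamma> x * l (?S x))) (rat_fun R) p'"
    by (rule normalized_lift_cong) (use R\<psi> in \<open>auto elim: eventually_mono\<close>)
  from normalized_lift_unique[OF NL[unfolded p] this a]
  have "q = q0" and hk: "\<forall>\<^sub>F x in nhds 0. h x = k x * (quartic_prefactor a \<gamma> x * l (?S x))" by auto
  show thesis
  proof (rule that)
    show "\<gamma> \<notin> \<int>\<^sub>\<le>\<^sub>0" using \<gamma> p by simp
    show "moebius_F p k (\<lambda>x. x) (quartic_source a (4 * q1) \<gamma>)" using k' p \<open>q = q0\<close> by simp
    show "\<forall>\<^sub>F x in nhds 0. h x = k x * quartic_prefactor a \<gamma> x * l (?S x)"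
      using hk by (simp add: mult.assoc)
  qed (use a l R\<psi> in auto)
qed

theorem theorem4p2:
  shows "(\<forall>a q \<gamma> :: complex. a \<noteq> 0 \<longrightarrow> a \<noteq> 1 \<longrightarrow> \<gamma> \<notin> \<int>\<^sub>\<le>\<^sub>0 \<longrightarrow>
      (\<forall>x. x\<^sup>2 \<noteq> a \<longrightarrow>
         rat_fun (quartic_map a) x = 4 * a * x * (1 - x) * (a - x) / (a - x\<^sup>2)\<^sup>2 \<and>
         rat_fun (quartic_map a) x = 1 - (a - 2 * a * x + x\<^sup>2)\<^sup>2 / (a - x\<^sup>2)\<^sup>2 \<and>
         rat_fun (quartic_map a) x = a - a * (a - 2 * x + x\<^sup>2)\<^sup>2 / (a - x\<^sup>2)\<^sup>2) \<and>
      (\<forall>\<^sub>F x in nhds 0.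
         Hl (Heun a q (2 * \<gamma> - 1) \<gamma> \<gamma> \<gamma>) x =
           (1 - x\<^sup>2 / a) powr (- \<gamma> + 1/2) *
           Hl (Heun a (q / 4) (\<gamma> / 2 - 1/4) (\<gamma> / 2 + 1/4) \<gamma> (1/2)) (rat_fun (quartic_map a) x)) \<and>
      (heun_equation (quartic_target a q \<gamma>) \<longrightarrow>
         biquadratic_Hl_transformation
           (quartic_source a q \<gamma>) (quartic_prefactor a \<gamma>) (quartic_map a) (quartic_target a q \<gamma>)))
    \<and>
    (\<forall>p h R p'. biquadratic_Hl_transformation p h R p' \<longrightarrow>
      (all_exponent_differences_half p' \<longrightarrow> Pt 0 \<notin> critical_values R) \<longrightarrow>
      (\<exists>a q \<gamma> k \<phi> l \<psi>. a \<noteq> 0 \<and> a \<noteq> 1 \<and> \<gamma> \<notin> \<int>\<^sub>\<le>\<^sub>0 \<and>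
         moebius_F p k \<phi> (quartic_source a q \<gamma>) \<and>
         moebius_F (quartic_target a q \<gamma>) l \<psi> p' \<and>
         (\<forall>\<^sub>F x in nhds 0.
            rat_fun R x = \<psi> (rat_fun (quartic_map a) (\<phi> x)) \<and>
            h x = k x * quartic_prefactor a \<gamma> (\<phi> x) * l (rat_fun (quartic_map a) (\<phi> x)))))"
proof (intro conjI allI impI)
  fix a q \<gamma> :: complex assume a: "a \<noteq> 0" "a \<noteq> 1" and \<gamma>: "\<gamma> \<notin> \<int>\<^sub>\<le>\<^sub>0"
  show "\<forall>\<^sub>F x in nhds 0.
         Hl (Heun a q (2 * \<gamma> - 1) \<gamma> \<gamma> \<gamma>) x =
           (1 - x\<^sup>2 / a) powr (- \<gamma> + 1/2) *
           Hl (Heun a (q / 4) (\<gamma> / 2 - 1/4) (\<gamma> / 2 + 1/4) \<gamma> (1/2)) (rat_fun (quartic_map a) x)"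
    using quartic_transformation_Hl[OF a \<gamma>, of q]
    unfolding quartic_source_def quartic_target_def quartic_prefactor_def .
  show "biquadratic_Hl_transformation
      (quartic_source a q \<gamma>) (quartic_prefactor a \<gamma>) (quartic_map a) (quartic_target a q \<gamma>)"
    if "heun_equation (quartic_target a q \<gamma>)"
    using quartic_biquadratic_Hl_transformation[OF a \<gamma> that] .
next
  fix p h R p'
  assume B: "biquadratic_Hl_transformation p h R p'"
    and unram: "all_exponent_differences_half p' \<longrightarrow> Pt 0 \<notin> critical_values R"
  obtain a q \<gamma> k l \<psi> where *: "a \<noteq> 0" "a \<noteq> 1" "\<gamma> \<notin> \<int>\<^sub>\<le>\<^sub>0"
    "moebius_F p k (\<lambda>x. x) (quartic_source a q \<gamma>)" "moebius_F (quartic_target a q \<gamma>) l \<psi> p'"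
    "\<forall>\<^sub>F x in nhds 0. rat_fun R x = \<psi> (rat_fun (quartic_map a) x)"
    "\<forall>\<^sub>F x in nhds 0. h x = k x * quartic_prefactor a \<gamma> x * l (rat_fun (quartic_map a) x)"
    using biquadratic_Hl_transformation_unique[OF B unram] .
  show "\<exists>a q \<gamma> k \<phi> l \<psi>. a \<noteq> 0 \<and> a \<noteq> 1 \<and> \<gamma> \<notin> \<int>\<^sub>\<le>\<^sub>0 \<and>
         moebius_F p k \<phi> (quartic_source a q \<gamma>) \<and>
         moebius_F (quartic_target a q \<gamma>) l \<psi> p' \<and>
         (\<forall>\<^sub>F x in nhds 0.
            rat_fun R x = \<psi> (rat_fun (quartic_map a) (\<phi> x)) \<and>
            h x = k x * quartic_prefactor a \<gamma> (\<phi> x) * l (rat_fun (quartic_map a) (\<phi> x)))"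
    by (rule exI[of _ a], rule exI[of _ q], rule exI[of _ \<gamma>], rule exI[of _ k],
        rule exI[of _ "\<lambda>x. x"], rule exI[of _ l], rule exI[of _ \<psi>])
       (use * in \<open>auto intro: eventually_conj\<close>)
qed (rule rat_fun_quartic_map, erule quartic_map_minus_1, erule quartic_map_minus_a)

end
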